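(* Let $P\subset\mathbb{R}^d$ be a lattice polytope. Then the following are equivalent. (i) $P$ is centrally symmetric. (ii) For every $c\in\mathbb{Q}^d$, the Ehrhart quasi-polynomial $L_{c+P}(t)$ of the translated polytope $c+P$ is symmetric.
   Context: A polytope is the convex hull of finitely many points of $\mathbb{R}^d$ (at least one point); it need not be full-dimensional. It is a lattice polytope (resp. rational polytope) if all its vertices lie in $\mathbb{Z}^d$ (resp. $\mathbb{Q}^d$). A polytope $P$ is centrally symmetric if there exists $c\in\mathbb{R}^d$ with $P=c+(-P)$. A quasi-polynomial is a function $L$ on the positive integers for which there are an integer $\rho>0$ (a period) and polynomials $f_1,\dots,f_\rho\in\mathbb{Q}[x]$ (the constituents) such that $L(t)=f_k(t)$ whenever $t\equiv k \pmod \rho$, for $1\le k\le\rho$; one also writes $f_0:=f_\rho$. The minimal period is the smallest possible period. For a rational polytope $Q\subset\mathbb{R}^d$, the function $L_Q(t):=\#(tQ\cap\mathbb{Z}^d)$, $t\in\mathbb{Z}_{>0}$, is a quasi-polynomial, called the Ehrhart quasi-polynomial of $Q$. A quasi-polynomial with period $\rho$ and constituents $f_0=f_\rho,f_1,\dots,f_{\rho-1}$ is symmetric if $f_k=f_{\rho-k}$ for all $0\le k\le\rho$. By convention $\rho$ is the minimal period (the notion does not depend on which period is used). *)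

theory Defs
  imports
    "HOL-Analysis.Analysis"
    "HOL-Computational_Algebra.Polynomial"
    "HOL-Number_Theory.Cong"
begin

definition int_points :: "(real ^ 'n) set" where
  "int_points = {x. \<forall>i. x $ i \<in> \<int>}"

definition rat_points :: "(real ^ 'n) set" where
  "rat_points = {x. \<forall>i. x $ i \<in> \<rat>}"

text \<open>The library's \<^const>\<open>polytope\<close> admits the empty set, which is excluded here.\<close>

definition lattice_polytope :: "(real ^ 'n) set \<Rightarrow> bool" where
  "lattice_polytope P \<longleftrightarrow>
     polytope P \<and> P \<noteq> {} \<and> {v. v extreme_point_of P} \<subseteq> int_points"

definition centrally_symmetric :: "(real ^ 'n) set \<Rightarrow> bool" where
  "centrally_symmetric P \<longleftrightarrow> (\<exists>c. P = (\<lambda>x. c + x) ` (uminus ` P))"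

text \<open>
  Functions on the positive integers are modelled as functions on \<^typ>\<open>nat\<close>; none of the
  definitions below depends on the value at 0.
  The constituents are \<open>f 1, \<dots>, f \<rho>\<close>, with \<open>f 0\<close> a second name for \<open>f \<rho>\<close>;
  values of \<open>f\<close> beyond \<open>\<rho>\<close> are irrelevant.
\<close>

definition has_constituents :: "(nat \<Rightarrow> rat) \<Rightarrow> nat \<Rightarrow> (nat \<Rightarrow> rat poly) \<Rightarrow> bool" where
  "has_constituents L \<rho> f \<longleftrightarrow>
     \<rho> > 0 \<and> f 0 = f \<rho> \<and>
     (\<forall>k\<in>{1..\<rho>}. \<forall>t>0. [t = k] (mod \<rho>) \<longrightarrow> L t = poly (f k) (of_nat t))"

definition quasi_period :: "(nat \<Rightarrow> rat) \<Rightarrow> nat \<Rightarrow> bool" where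
  "quasi_period L \<rho> \<longleftrightarrow> (\<exists>f. has_constituents L \<rho> f)"

definition quasi_polynomial :: "(nat \<Rightarrow> rat) \<Rightarrow> bool" where
  "quasi_polynomial L \<longleftrightarrow> (\<exists>\<rho>. quasi_period L \<rho>)"

definition minimal_period :: "(nat \<Rightarrow> rat) \<Rightarrow> nat" where
  "minimal_period L = (LEAST \<rho>. quasi_period L \<rho>)"

text \<open>
  For a given period the constituents \<open>f 0, \<dots>, f \<rho>\<close> are uniquely determined by \<open>L\<close>, each of
  them being prescribed at infinitely many points, so the existential quantifier over \<open>f\<close>
  involves no choice.
\<close>

definition symmetric_quasi_polynomial :: "(nat \<Rightarrow> rat) \<Rightarrow> bool" where
  "symmetric_quasi_polynomial L \<longleftrightarrow>
     quasi_polynomial L \<and>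
     (\<exists>f. has_constituents L (minimal_period L) f \<and>
          (\<forall>k\<le>minimal_period L. f k = f (minimal_period L - k)))"

definition ehrhart :: "(real ^ 'n) set \<Rightarrow> nat \<Rightarrow> rat" where
  "ehrhart Q t = of_nat (card ((\<lambda>x. real t *\<^sub>R x) ` Q \<inter> int_points))"

end

theory Submission
  imports Defs "HOL-Probability.Probability"
begin

text \<open>
  Every constituent of \<open>L\<^bsub>c+P\<^esub>\<close> is a polynomial counting the lattice points of \<open>kc + tP\<close> for a fixed
  \<open>k\<close>: the cone over \<open>P\<close> is a disjoint union of relatively open simplicial cones generated by lattice
  points at height 1. Hence (ii) says that \<open>c + P\<close> and \<open>-c + P\<close> contain equally many lattice points
  for all rational \<open>c\<close>. For a centrally symmetric lattice polytope this is clear, since its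
  centre is half a lattice point.

  Conversely, let \<open>P\<close> be full-dimensional. Integrating the count over the unit cube gives
  \<open>vol (P \<inter> S) = vol (-P \<inter> S)\<close> for every measurable set \<open>S\<close> that is periodic under the integer lattice. Taking for
  \<open>S\<close> a family of thin parallel slabs, one finds that the slabs of width \<open>s\<close> cut off \<open>P\<close> at opposite
  facets (or faces) have equal volumes up to \<open>O(s\<^sup>2)\<close>. Therefore \<open>(1-s)P + s(-P)\<close> has volume at most
  \<open>vol P + O(s\<^sup>2)\<close> as \<open>s\<close> tends to \<open>0\<close>. Since the volume is log-concave along this segment, with equal values at the
  ends \<open>P\<close> and \<open>-P\<close>, the volume of the midpoint body is \<open>vol P\<close>, and the equality case of the
  Brunn-Minkowski inequality shows that \<open>-P\<close> is a translate of \<open>P\<close>.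

  If \<open>P\<close> is not full-dimensional, it becomes so, and keeps the symmetry of its counts, after adding a
  centrally symmetric lattice polytope in complementary directions.
\<close>

section \<open>Ehrhart's theorem for translates of lattice polytopes\<close>

text \<open>Translation and dilation have to be separated. In the Ehrhart function of c + P they are
  tied together, the translation being tc; in \<open>translate_count P v t\<close> the vector v
  stays fixed while t varies, and this makes the count a polynomial in t. An identity between
  constituents can then be evaluated at t = 1, although the Ehrhart function samples each of them
  only in a residue class.

  In the language of mixed volumes, equal slabs at opposite facets mean equal facet volumes. The
  derivative of vol((1-s)P + s(-P)) at s = 0, which is d(V_1(P,-P) - vol P), then vanishes, and the
  rest is the equality case of Minkowski's first inequality. Here neither mixed volumes nor facet
  volumes are formed: slabs are compared up to O(s^2), and this error term comes from pairs of slabs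
  with non-parallel normals, which meet in volume O(s^2).

  The facet normals can be scaled to integer vectors because the vertices are lattice points. This
  makes the families of slabs periodic, and it puts the extreme hyperplanes of P at integer
  levels.\<close>

lemma sum_in_convex_cone_hull:
  assumes "finite W" "\<And>w. 0 \<le> l w"
  shows "(\<Sum>w\<in>W. l w *\<^sub>R w) \<in> convex_cone hull (W :: 'a::euclidean_space set)"
proof -
  have "(\<Sum>w\<in>X. l w *\<^sub>R w) \<in> convex_cone hull W" if "X \<subseteq> W" for X
    using finite_subset[OF that assms(1)] that
  proof (induction X rule: finite_induct)
    case (insert x F)
    then have "l x *\<^sub>R x \<in> convex_cone hull W"
      by (intro convex_cone_hull_mul hull_inc assms) auto
    then show ?case using insert by (simp add: convex_cone_hull_add)
  qed (simp add: convex_cone_hull_contains_0)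
  then show ?thesis by blast
qed

lemma convex_cone_hull_insert:
  "convex_cone hull (insert w W) = {y. \<exists>\<mu>\<ge>0. y - \<mu> *\<^sub>R w \<in> convex_cone hull W}" for w :: "'a::euclidean_space"
proof -
  have "convex_cone hull {w} = {\<mu> *\<^sub>R w |\<mu>. \<mu> \<ge> 0}"
    by (subst convex_cone_hull_convex_hull_nonempty) auto
  then show ?thesis
    unfolding insert_is_Un[of w W] convex_cone_hull_Un
    by (force simp: algebra_simps)
qed

lemma convex_cone_hull_beyond:
  assumes "p \<in> convex_cone hull W" "p + \<mu> *\<^sub>R w \<in> convex_cone hull W" "0 \<le> \<nu>" "\<nu> \<le> \<mu>"
  shows "p + \<nu> *\<^sub>R w \<in> convex_cone hull (W :: 'a::euclidean_space set)"
proof (cases "\<mu> = 0")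
  case True then show ?thesis using assms by simp
next
  case False
  then have "\<mu> > 0" using assms by linarith
  have "(1 - \<nu>/\<mu>) *\<^sub>R p + (\<nu>/\<mu>) *\<^sub>R (p + \<mu> *\<^sub>R w) \<in> convex_cone hull W"
    by (rule convex_cone_hull_add; rule convex_cone_hull_mul) (use assms \<open>\<mu> > 0\<close> in auto)
  also have "(1 - \<nu>/\<mu>) *\<^sub>R p + (\<nu>/\<mu>) *\<^sub>R (p + \<mu> *\<^sub>R w) = p + \<nu> *\<^sub>R w"
    using \<open>\<mu> > 0\<close> by (simp add: scaleR_left_diff_distrib scaleR_right_distrib)
  finally show ?thesis .
qed

text \<open>
  The members of \<open>D\<close> are the generating sets of relatively open simplicial cones that partition the
  cone over \<open>W\<close>; \<open>{}\<close> stands for the apex.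
\<close>

definition decomposes_cone :: "'a::euclidean_space set \<Rightarrow> 'a set set \<Rightarrow> bool" where
  "decomposes_cone W D \<longleftrightarrow> (\<forall>y\<in>convex_cone hull W.
     \<exists>!l. (\<forall>w. 0 \<le> l w) \<and> {w. l w \<noteq> 0} \<in> D \<and> (\<Sum>w\<in>W. l w *\<^sub>R w) = y)"

text \<open>The generators are placed one at a time. A point y of the enlarged cone is pushed back
  along w by the least amount \<open>m\<close> that brings it into the old cone. If \<open>m\<close>
  is 0, the old representation of y stays; otherwise the foot lies in a visible cell, and w joins
  this cell with coefficient \<open>m\<close>. Linear independence of the cells is not tracked;
  uniqueness of the coefficients is carried through the induction in its place.\<close>

lemma ex_simplicial_decomposition:
  fixes W :: "'a::euclidean_space set"
  assumes "finite W"
  shows "\<exists>D\<subseteq>Pow W. decomposes_cone W D"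
  using assms
proof (induction W rule: finite_induct)
  case empty
  have "decomposes_cone {} {{} :: 'a set}"
    by (auto simp: decomposes_cone_def)
  then show ?case by blast
next
  case (insert w W)
  then obtain D where D: "D \<subseteq> Pow W" "decomposes_cone W D" by blast
  let ?C = "convex_cone hull W"
  let ?s = "\<lambda>l. \<Sum>w\<in>W. l w *\<^sub>R w"
  \<comment> \<open>A placing decomposition: \<open>vis \<sigma>\<close> says that moving from the cone over \<open>\<sigma>\<close> in direction \<open>w\<close> leaves \<open>?C\<close>.\<close>
  define vis where "vis \<sigma> \<longleftrightarrow> \<sigma> \<in> D \<and>
    (\<exists>l. (\<forall>w. 0 \<le> l w) \<and> {w. l w \<noteq> 0} = \<sigma> \<and> (\<forall>\<mu>>0. ?s l + \<mu> *\<^sub>R w \<notin> ?C))" for \<sigma>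
  define D' where "D' = D \<union> insert w ` {\<sigma>. vis \<sigma>}"
  have inC: "?s l \<in> ?C" if "\<forall>w. 0 \<le> l w" for l
    using that insert.hyps by (intro sum_in_convex_cone_hull) auto
  have uniq: "l1 = l2" if "\<forall>w. 0 \<le> l1 w" "{w. l1 w \<noteq> 0} \<in> D" "\<forall>w. 0 \<le> l2 w" "{w. l2 w \<noteq> 0} \<in> D" "?s l1 = ?s l2" for l1 l2
    using D(2)[unfolded decomposes_cone_def, rule_format, OF inC[OF that(1)]] that by (metis (no_types, lifting))
  \<comment> \<open>Visibility belongs to the cell and not to the point that witnesses it: for small
    e > 0 the vector l - e l' is still nonnegative, so a move along w that stays in the cone from l'
    would, scaled by e, yield one from l.\<close>
  have visible: "?s l' + \<mu> *\<^sub>R w \<notin> ?C" if vis: "vis {w. l' w \<noteq> 0}" and l': "\<forall>w. 0 \<le> l' w" and "\<mu> > 0" for l' \<mu>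
  proof
    assume *: "?s l' + \<mu> *\<^sub>R w \<in> ?C"
    let ?\<sigma> = "{w. l' w \<noteq> 0}"
    obtain l where l: "\<forall>w. 0 \<le> l w" "{w. l w \<noteq> 0} = ?\<sigma>" "\<forall>\<mu>>0. ?s l + \<mu> *\<^sub>R w \<notin> ?C"
      using vis unfolding vis_def by blast
    have fin: "finite ?\<sigma>" using vis D(1) insert.hyps unfolding vis_def by (meson PowD finite_subset subsetD)
    obtain e where e: "e > 0" "\<forall>w. e * l' w \<le> l w"
    proof -
      define e where "e = Min (insert 1 ((\<lambda>w. l w / l' w) ` ?\<sigma>))"
      have "e > 0" unfolding e_def
        using fin l l' by (subst Min_gr_iff) (auto simp: order_less_le)
      moreover have "e * l' w \<le> l w" for w
      proof (cases "l' w = 0")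
        case False
        then have "e \<le> l w / l' w" unfolding e_def using fin by (intro Min_le) auto
        then show ?thesis using False l' by (simp add: le_divide_eq order_less_le)
      qed (use l in auto)
      ultimately show ?thesis using that by blast
    qed
    have "?s (\<lambda>w. l w - e * l' w) \<in> ?C" using e by (intro inC) auto
    then have "e *\<^sub>R (?s l' + \<mu> *\<^sub>R w) + ?s (\<lambda>w. l w - e * l' w) \<in> ?C"
      using * e by (simp add: convex_cone_hull_add convex_cone_hull_mul)
    also have "e *\<^sub>R (?s l' + \<mu> *\<^sub>R w) + ?s (\<lambda>w. l w - e * l' w) = ?s l + (e * \<mu>) *\<^sub>R w"
      by (simp add: algebra_simps sum_subtractf scaleR_sum_right)
    finally show False using l(3) e \<open>\<mu> > 0\<close> by simp
  qed
  have sum_ins: "(\<Sum>x\<in>insert w W. l x *\<^sub>R x) = l w *\<^sub>R w + ?s (l(w := 0))" for l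
  proof -
    have "?s l = ?s (l(w := 0))" using insert.hyps by (intro sum.cong) auto
    then show ?thesis using insert.hyps by simp
  qed
  have nw: "w \<notin> \<sigma>" if "\<sigma> \<in> D" for \<sigma> using that D(1) insert.hyps by auto
  have dec: "{x. (l(w := 0)) x \<noteq> 0} \<in> D \<and> (0 < l w \<longrightarrow> vis {x. (l(w := 0)) x \<noteq> 0})"
    if "\<forall>w. 0 \<le> l w" "{w. l w \<noteq> 0} \<in> D'" for l :: "'a \<Rightarrow> real"
    using that(2) unfolding D'_def
  proof
    assume "{w. l w \<noteq> 0} \<in> D"
    moreover from nw[OF this] have lw: "l w = 0" by simp
    moreover from lw have "l(w := 0) = l" by (simp add: fun_upd_idem)
    ultimately show ?thesis by simp
  next
    assume "{w. l w \<noteq> 0} \<in> insert w ` {\<sigma>. vis \<sigma>}"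
    then obtain \<sigma> where \<sigma>: "vis \<sigma>" "{w. l w \<noteq> 0} = insert w \<sigma>" by auto
    have "\<sigma> \<in> D" using \<sigma> by (simp add: vis_def)
    then have "{x. (l(w := 0)) x \<noteq> 0} = \<sigma>" using nw[of \<sigma>] \<sigma>(2) by (auto split: if_splits)
    then show ?thesis using \<sigma> \<open>\<sigma> \<in> D\<close> by simp
  qed
  have "decomposes_cone (insert w W) D'"
    unfolding decomposes_cone_def
  proof (rule ballI, rule ex_ex1I)
    fix y assume y: "y \<in> convex_cone hull (insert w W)"
    define S where "S = {\<mu>. \<mu> \<ge> 0 \<and> y - \<mu> *\<^sub>R w \<in> ?C}"
    define m where "m = Inf S"
    have "closed S"
    proof -
      have "S = {0..} \<inter> (\<lambda>\<mu>. y - \<mu> *\<^sub>R w) -` ?C" by (auto simp: S_def)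
      moreover have "closed ((\<lambda>\<mu>. y - \<mu> *\<^sub>R w) -` ?C)"
        using insert.hyps
        by (intro closed_vimage polyhedron_imp_closed polyhedron_convex_cone_hull) (auto intro!: continuous_intros)
      ultimately show ?thesis by auto
    qed
    moreover have "S \<noteq> {}" using y by (auto simp: S_def convex_cone_hull_insert)
    moreover have bdd: "bdd_below S" by (auto simp: S_def intro!: bdd_belowI[of _ 0])
    ultimately have m: "m \<in> S" unfolding m_def by (metis closed_contains_Inf)
    then obtain l where l: "\<forall>w. 0 \<le> l w" "{w. l w \<noteq> 0} \<in> D" "?s l = y - m *\<^sub>R w"
      using D(2) unfolding S_def decomposes_cone_def by blast
    have lw: "l w = 0" using nw[OF l(2)] by auto
    show "\<exists>l. (\<forall>w. 0 \<le> l w) \<and> {w. l w \<noteq> 0} \<in> D' \<and> (\<Sum>x\<in>insert w W. l x *\<^sub>R x) = y"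
    proof (cases "m = 0")
      case True
      then show ?thesis using l lw insert.hyps by (intro exI[of _ l]) (auto simp: D'_def)
    next
      case False
      then have mpos: "m > 0" using m by (auto simp: S_def)
      have "?s l + \<mu> *\<^sub>R w \<notin> ?C" if "\<mu> > 0" for \<mu>
      proof
        assume "?s l + \<mu> *\<^sub>R w \<in> ?C"
        from convex_cone_hull_beyond[OF inC[OF l(1)] this, of "min \<mu> m"]
        have "?s l + (min \<mu> m) *\<^sub>R w \<in> ?C" using that mpos by auto
        then have "m - min \<mu> m \<in> S" using l mpos by (auto simp: S_def algebra_simps)
        then have "m \<le> m - min \<mu> m" unfolding m_def using bdd by (intro cInf_lower) auto
        then show False using that mpos by auto
      qed
      then have "vis {w. l w \<noteq> 0}" using l unfolding vis_def by blast
      moreover have "{x. (l(w := m)) x \<noteq> 0} = insert w {w. l w \<noteq> 0}" using mpos by auto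
      ultimately have "{x. (l(w := m)) x \<noteq> 0} \<in> D'" unfolding D'_def by blast
      moreover have "(\<Sum>x\<in>insert w W. (l(w := m)) x *\<^sub>R x) = y"
      proof -
        have upd: "(l(w := m))(w := 0) = l" using lw by (auto simp: fun_upd_def)
        show ?thesis unfolding sum_ins upd fun_upd_same using l by simp
      qed
      ultimately show ?thesis using l mpos by (intro exI[of _ "l(w := m)"]) auto
    qed
  next
    fix y l1 l2
    assume l1: "(\<forall>w. 0 \<le> l1 w) \<and> {w. l1 w \<noteq> 0} \<in> D' \<and> (\<Sum>x\<in>insert w W. l1 x *\<^sub>R x) = y"
      and l2: "(\<forall>w. 0 \<le> l2 w) \<and> {w. l2 w \<noteq> 0} \<in> D' \<and> (\<Sum>x\<in>insert w W. l2 x *\<^sub>R x) = y"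
    \<comment> \<open>If the coefficients of w differ, cancelling the smaller multiple of w shows
      that the foot of the other representation, a point of a visible cell, can be moved along w
      inside the old cone.\<close>
    have no: False if "\<forall>w. 0 \<le> l w" "{w. l w \<noteq> 0} \<in> D'" "\<forall>w. 0 \<le> l' w" "{w. l' w \<noteq> 0} \<in> D'"
      "(\<Sum>x\<in>insert w W. l x *\<^sub>R x) = (\<Sum>x\<in>insert w W. l' x *\<^sub>R x)" "l w < l' w" for l l'
    proof -
      have "?s (l'(w := 0)) + (l' w - l w) *\<^sub>R w = ?s (l(w := 0))"
        using that(5) unfolding sum_ins by (simp add: algebra_simps)
      moreover have "?s (l(w := 0)) \<in> ?C" using that by (intro inC) auto
      moreover have "0 < l' w" using that by (meson order_le_less_trans)
      moreover have "\<forall>x. 0 \<le> (l'(w := 0)) x" using that by auto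
      ultimately show False using visible[of "l'(w := 0)" "l' w - l w"] dec[of l'] that by simp
    qed
    have "l1 w = l2 w" using no[of l1 l2] no[of l2 l1] l1 l2 by (metis linorder_neqE_linordered_idom)
    moreover have "l1(w := 0) = l2(w := 0)"
    proof (rule uniq)
      show "?s (l1(w := 0)) = ?s (l2(w := 0))" using l1 l2 calculation unfolding sum_ins by auto
    qed (use dec l1 l2 in auto)
    ultimately show "l1 = l2" by (metis fun_upd_triv fun_upd_upd)
  qed
  moreover have "D' \<subseteq> Pow (insert w W)" using D(1) by (auto simp: D'_def vis_def)
  ultimately show ?case by blast
qed

section \<open>Lattice points in a single relatively open simplicial cone\<close>

lemma poly_binomial:
  fixes k j :: nat
  assumes "1 \<le> k" "j \<le> k"
  shows "\<exists>p :: rat poly. \<forall>t>0. of_nat (if j \<le> t then (k + (t - j) - 1) choose (t - j) else 0) = poly p (of_nat t)"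
proof -
  define p :: "rat poly" where
    "p = smult (1 / fact (k - 1)) (\<Prod>i\<in>{0..<k-1}. [:of_nat (k - 1) - of_nat j - of_nat i, 1:])"
  have "of_nat (if j \<le> t then (k + (t - j) - 1) choose (t - j) else 0) = poly p (of_nat t)" if "t > 0" for t
  proof -
    have "poly p (of_nat t) = (of_nat (t + (k - 1) - j) gchoose (k - 1))"
      using assms that by (simp add: p_def gbinomial_prod_rev poly_prod of_nat_diff algebra_simps)
    also have "\<dots> = of_nat ((t + (k - 1) - j) choose (k - 1))" by (simp add: binomial_gbinomial)
    \<comment> \<open>For 0 < t < j the number t + k - 1 - j lies between 0 and k - 2, because j
      \<le> k, and the binomial coefficient vanishes there; so one polynomial covers both cases. At
      t = 0 and j = k its argument would be -1, where it does not vanish.\<close>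
    also have "(t + (k - 1) - j) choose (k - 1) = (if j \<le> t then (k + (t - j) - 1) choose (t - j) else 0)"
    proof (cases "j \<le> t")
      case True
      then have "t + (k - 1) - j = k + (t - j) - 1" using assms by auto
      moreover have "(k + (t - j) - 1) choose (t - j) = (k + (t - j) - 1) choose (k - 1)"
        using assms True by (subst binomial_symmetric) auto
      ultimately show ?thesis using True by simp
    next
      case False
      then have "t + (k - 1) - j < k - 1" using assms that by linarith
      then show ?thesis using False by (simp add: binomial_eq_0)
    qed
    finally show ?thesis by simp
  qed
  then show ?thesis by blast
qed

text \<open>
  Splitting every coefficient into a part in \<open>(0,1]\<close> and a natural number reduces the count of the
  lattice points in the relatively open cone over \<open>\<sigma>\<close> to finitely many multiset counts.
\<close>

lemma simplex_count_poly:
  fixes \<sigma> :: "((real ^ 'n) \<times> real) set" and v :: "real ^ 'n"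
  assumes fin: "finite \<sigma>" and \<sigma>: "\<And>w. w \<in> \<sigma> \<Longrightarrow> fst w \<in> int_points \<and> snd w = 1"
  defines "X \<equiv> \<lambda>t::nat. {l. (\<forall>w. 0 \<le> l w) \<and> {w. l w \<noteq> 0} = \<sigma> \<and>
     (\<exists>z\<in>int_points. (\<Sum>w\<in>\<sigma>. l w *\<^sub>R w) = (z - v, real t))}"
  assumes finX: "\<And>t. finite (X t)"
  shows "\<exists>p :: rat poly. \<forall>t>0. of_nat (card (X t)) = poly p (of_nat t)"
proof (cases "\<sigma> = {}")
  case True
  then have "X t = {}" if "t > 0" for t using that by (auto simp: X_def zero_prod_def)
  then show ?thesis by (intro exI[of _ 0]) auto
next
  case False
  define k where "k = card \<sigma>"
  have k: "k \<ge> 1" using False fin by (simp add: k_def Suc_leI card_gt_0_iff)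
  have X_sum: "(\<Sum>w\<in>\<sigma>. l w) = real t" if "l \<in> X t" for l t
  proof -
    obtain z where "(\<Sum>w\<in>\<sigma>. l w *\<^sub>R w) = (z - v, real t)" using \<open>l \<in> X t\<close> by (auto simp: X_def)
    then have "real t = (\<Sum>w\<in>\<sigma>. snd (l w *\<^sub>R w))" by (metis snd_conv snd_sum)
    also have "\<dots> = (\<Sum>w\<in>\<sigma>. l w)" using \<sigma> by (intro sum.cong) auto
    finally show ?thesis by simp
  qed
  \<comment> \<open>A remainder has k coefficients in (0,1], hence height at most k. Restricting to
    these heights loses nothing and makes \<open>R\<close> finite.\<close>
  define R where "R = {r \<in> (\<Union>t\<le>k. X t). \<forall>w. r w \<le> 1}"
  have finR: "finite R" using finX by (simp add: R_def)
  define j where "j r = nat \<lfloor>\<Sum>w\<in>\<sigma>. r w\<rfloor>" for r :: "_ \<Rightarrow> real"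
  have j: "r \<in> X (j r)" "j r \<le> k" if r: "r \<in> R" for r
  proof -
    from r obtain t where "t \<le> k" "r \<in> X t" by (auto simp: R_def)
    moreover from X_sum[OF this(2)] have "j r = t" by (simp add: j_def)
    ultimately show "r \<in> X (j r)" "j r \<le> k" by auto
  qed
  define Y where "Y t = (SIGMA r:{r \<in> R. j r \<le> t}. multisets_of_size \<sigma> (t - j r))" for t
  define \<Phi> :: "((real ^ 'n) \<times> real \<Rightarrow> real) \<times> ((real ^ 'n) \<times> real) multiset \<Rightarrow> (real ^ 'n) \<times> real \<Rightarrow> real"
    where "\<Phi> = (\<lambda>(r, M) w. r w + real (count M w) :: real)"
  have supp: "r w > 0 \<longleftrightarrow> w \<in> \<sigma>" "r w = 0 \<longleftrightarrow> w \<notin> \<sigma>" if "r \<in> X t" for r t w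
  proof -
    have "0 \<le> r w" "r w \<noteq> 0 \<longleftrightarrow> w \<in> \<sigma>" using that unfolding X_def by blast+
    then show "r w > 0 \<longleftrightarrow> w \<in> \<sigma>" "r w = 0 \<longleftrightarrow> w \<notin> \<sigma>" by auto
  qed
  have shift: "(\<Sum>w\<in>\<sigma>. real (n w) *\<^sub>R fst w) \<in> int_points" for n :: "_ \<Rightarrow> nat"
    using \<sigma> by (auto simp: int_points_def intro!: Ints_sum Ints_mult)
  have nsum: "(\<Sum>w\<in>\<sigma>. real (n w) *\<^sub>R w) = (\<Sum>w\<in>\<sigma>. real (n w) *\<^sub>R fst w, real (\<Sum>w\<in>\<sigma>. n w))" for n :: "_ \<Rightarrow> nat"
    using \<sigma> by (auto simp: prod_eq_iff fst_sum snd_sum intro!: sum.cong)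
  have "bij_betw \<Phi> (Y t) (X t)" for t
    unfolding bij_betw_def
  proof (intro conjI equalityI subsetI)
    show "inj_on \<Phi> (Y t)"
    proof (rule inj_onI, clarify)
      fix r M r' M'
      assume Y: "(r, M) \<in> Y t" "(r', M') \<in> Y t" and eq: "\<Phi> (r, M) = \<Phi> (r', M')"
      then have R: "r \<in> R" "r' \<in> R" and sM: "set_mset M \<subseteq> \<sigma>" "set_mset M' \<subseteq> \<sigma>"
        by (auto simp: Y_def multisets_of_size_def)
      have "r w = r' w \<and> count M w = count M' w" for w
      proof (cases "w \<in> \<sigma>")
        case True
        then have "0 < r w" "r w \<le> 1" "0 < r' w" "r' w \<le> 1"
          using supp[OF j(1)[OF R(1)], of w] supp[OF j(1)[OF R(2)], of w] R unfolding R_def by blast+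
        moreover have "r w + real (count M w) = r' w + real (count M' w)"
          using fun_cong[OF eq, of w] by (simp add: \<Phi>_def)
        ultimately have "\<bar>real_of_int (int (count M w) - int (count M' w))\<bar> < 1" by auto
        then have "count M w = count M' w" by linarith
        with \<open>r w + _ = _\<close> show ?thesis by simp
      next
        case False
        then have "count M w = 0" "count M' w = 0" using sM by (auto simp: count_eq_zero_iff)
        then show ?thesis using False supp[OF j(1)[OF R(1)], of w] supp[OF j(1)[OF R(2)], of w] by simp
      qed
      then show "r = r' \<and> M = M'" by (auto intro: multiset_eqI)
    qed
  next
    fix l assume "l \<in> \<Phi> ` Y t"
    then obtain r M where rM: "r \<in> R" "j r \<le> t" "set_mset M \<subseteq> \<sigma>" "size M = t - j r" and l: "l = \<Phi> (r, M)"
      by (auto simp: Y_def multisets_of_size_def)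
    have lw: "l w = r w + real (count M w)" for w by (simp add: l \<Phi>_def)
    obtain z where z: "z \<in> int_points" "(\<Sum>w\<in>\<sigma>. r w *\<^sub>R w) = (z - v, real (j r))"
      using j(1)[OF rM(1)] by (auto simp: X_def)
    have size: "(\<Sum>w\<in>\<sigma>. count M w) = t - j r"
      using rM fin by (metis size_multiset_overloaded_eq sum.mono_neutral_left count_eq_zero_iff DiffD2)
    define y where "y = (\<Sum>w\<in>\<sigma>. real (count M w) *\<^sub>R fst w)"
    have y: "y \<in> int_points" "(\<Sum>w\<in>\<sigma>. real (count M w) *\<^sub>R w) = (y, real (t - j r))"
      using shift nsum[of "count M"] by (simp_all add: y_def size)
    have "(\<Sum>w\<in>\<sigma>. l w *\<^sub>R w) = (z - v, real (j r)) + (y, real (t - j r))"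
      unfolding lw scaleR_add_left sum.distrib z y ..
    also have "\<dots> = ((z + y) - v, real t)" using rM by simp
    finally have "(\<Sum>w\<in>\<sigma>. l w *\<^sub>R w) = ((z + y) - v, real t)" .
    moreover have "z + y \<in> int_points" using z y by (auto simp: int_points_def)
    moreover have "0 \<le> l w" "l w \<noteq> 0 \<longleftrightarrow> w \<in> \<sigma>" for w
    proof -
      have "count M w = 0" if "w \<notin> \<sigma>" using that rM by (auto simp: count_eq_zero_iff)
      then show "0 \<le> l w" "l w \<noteq> 0 \<longleftrightarrow> w \<in> \<sigma>"
        using supp[OF j(1)[OF rM(1)], of w] by (cases "w \<in> \<sigma>"; simp add: lw)+
    qed
    ultimately show "l \<in> X t" unfolding X_def by auto
  next
    fix l assume l: "l \<in> X t"
    \<comment> \<open>Rounding up and subtracting 1 puts the remainder into (0,1] and not [0,1), so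
      that it keeps the full support \<sigma>: the cones are relatively open.\<close>
    define n where "n w = (if w \<in> \<sigma> then nat (\<lceil>l w\<rceil> - 1) else 0)" for w
    define r where "r w = l w - real (n w)" for w
    define M where "M = (\<Sum>w\<in>\<sigma>. replicate_mset (n w) w)"
    have cM: "count M w = n w" for w
      using fin by (auto simp: M_def count_sum n_def if_distrib sum.If_cases)
    have r1: "0 < r w \<and> r w \<le> 1" if "w \<in> \<sigma>" for w
    proof -
      have "l w > 0" using supp[OF l] that by auto
      then have "real (n w) = of_int (\<lceil>l w\<rceil> - 1)" using that by (simp add: n_def)
      then show ?thesis by (simp add: r_def) linarith
    qed
    have r0: "r w = 0" if "w \<notin> \<sigma>" for w using supp[OF l, of w] that by (simp add: r_def n_def)
    obtain z where z: "z \<in> int_points" "(\<Sum>w\<in>\<sigma>. l w *\<^sub>R w) = (z - v, real t)"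
      using l by (auto simp: X_def)
    define y where "y = (\<Sum>w\<in>\<sigma>. real (n w) *\<^sub>R fst w)"
    define N where "N = (\<Sum>w\<in>\<sigma>. n w)"
    have y: "y \<in> int_points" "(\<Sum>w\<in>\<sigma>. real (n w) *\<^sub>R w) = (y, real N)"
      using shift nsum[of n] by (simp_all add: y_def N_def)
    have rs: "(\<Sum>w\<in>\<sigma>. r w) = real t - real N"
      unfolding r_def sum_subtractf X_sum[OF l] by (simp add: N_def)
    have "(\<Sum>w\<in>\<sigma>. r w) \<le> (\<Sum>w\<in>\<sigma>. 1)" using r1 by (intro sum_mono) auto
    then have le: "real t - real N \<le> real k" using rs by (simp add: k_def)
    have "0 \<le> (\<Sum>w\<in>\<sigma>. r w)" using r1 by (intro sum_nonneg) (auto intro: less_imp_le)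
    then have Nt: "N \<le> t" using rs by simp
    have "(\<Sum>w\<in>\<sigma>. r w *\<^sub>R w) = (z - v, real t) - (y, real N)"
      unfolding r_def scaleR_diff_left sum_subtractf z y ..
    also have "\<dots> = ((z - y) - v, real (t - N))" using Nt by simp
    finally have "(\<Sum>w\<in>\<sigma>. r w *\<^sub>R w) = ((z - y) - v, real (t - N))" .
    moreover have "z - y \<in> int_points" using z y by (auto simp: int_points_def)
    moreover have "0 \<le> r w" "r w \<noteq> 0 \<longleftrightarrow> w \<in> \<sigma>" "r w \<le> 1" for w
      using r1[of w] r0[of w] by (cases "w \<in> \<sigma>"; force)+
    ultimately have "r \<in> X (t - N)" unfolding X_def by auto
    then have "r \<in> R" unfolding R_def using le \<open>\<And>w. r w \<le> 1\<close> by (auto intro!: bexI[of _ "t - N"])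
    moreover have "j r = t - N" unfolding j_def using rs Nt by (simp flip: of_nat_diff)
    moreover have "size M = N" using fin by (simp add: M_def N_def size_multiset_sum)
    moreover have "set_mset M \<subseteq> \<sigma>" using cM by (auto simp: n_def simp flip: count_greater_zero_iff split: if_splits)
    ultimately have "(r, M) \<in> Y t" using Nt by (auto simp: Y_def multisets_of_size_def)
    moreover have "\<Phi> (r, M) = l" by (auto simp: \<Phi>_def cM r_def)
    ultimately show "l \<in> \<Phi> ` Y t" by (metis image_eqI)
  qed
  then have cX: "card (X t) = card (Y t)" for t by (metis bij_betw_same_card)
  have cY: "card (Y t) = (\<Sum>r\<in>R. if j r \<le> t then (k + (t - j r) - 1) choose (t - j r) else 0)" for t
  proof -
    have "card (Y t) = (\<Sum>r\<in>{r \<in> R. j r \<le> t}. card (multisets_of_size \<sigma> (t - j r)))"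
      unfolding Y_def using finR fin by (subst card_SigmaI) auto
    also have "\<dots> = (\<Sum>r\<in>R. if j r \<le> t then card (multisets_of_size \<sigma> (t - j r)) else 0)"
      using finR by (simp add: sum.inter_filter)
    finally show ?thesis using fin by (simp add: card_multisets_of_size k_def cong: if_cong)
  qed
  have "\<forall>r\<in>R. \<exists>p :: rat poly. \<forall>t>0. of_nat (if j r \<le> t then (k + (t - j r) - 1) choose (t - j r) else 0) = poly p (of_nat t)"
    using poly_binomial[OF k] j(2) by blast
  then obtain p :: "_ \<Rightarrow> rat poly" where
    p: "\<And>r t. r \<in> R \<Longrightarrow> t > 0 \<Longrightarrow> of_nat (if j r \<le> t then (k + (t - j r) - 1) choose (t - j r) else 0) = poly (p r) (of_nat t)"
    by metis
  have "of_nat (card (X t)) = poly (\<Sum>r\<in>R. p r) (of_nat t)" if "t > 0" for t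
    unfolding cX cY of_nat_sum poly_sum by (intro sum.cong refl p that)
  then show ?thesis by blast
qed

lemma finite_int_points_bounded:
  assumes "bounded (S :: (real ^ 'n) set)"
  shows "finite (int_points \<inter> S)"
proof -
  obtain B where B: "\<And>x. x \<in> S \<Longrightarrow> norm x \<le> B" using assms unfolding bounded_iff by blast
  let ?I = "{k \<in> \<int>. \<bar>k\<bar> \<le> B}"
  have "finite (PiE UNIV (\<lambda>_ :: 'n. ?I))" by (intro finite_PiE finite_abs_int_segment) auto
  moreover have "(\<lambda>x i. x $ i) ` (int_points \<inter> S) \<subseteq> PiE UNIV (\<lambda>_. ?I)"
  proof clarify
    fix x i assume x: "x \<in> int_points" "x \<in> S"
    have "\<bar>x $ i\<bar> \<le> B" for i using B[OF x(2)] component_le_norm_cart[of x i] by linarith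
    then show "(\<lambda>i. x $ i) \<in> PiE UNIV (\<lambda>_. ?I)"
      using x by (auto simp: int_points_def)
  qed
  ultimately have "finite ((\<lambda>x i. x $ i) ` (int_points \<inter> S))" by (rule finite_subset[rotated])
  then show ?thesis by (rule finite_imageD) (auto simp: inj_on_def vec_eq_iff fun_eq_iff)
qed

definition translate_count :: "(real ^ 'n) set \<Rightarrow> real ^ 'n \<Rightarrow> nat \<Rightarrow> nat" where
  "translate_count P v t = card {z \<in> int_points. z - v \<in> (\<lambda>x. real t *\<^sub>R x) ` P}"

text \<open>A lattice point z of v + tP corresponds to the point (z - v, t) of the cone over P
  placed at height 1, and this point lies in exactly one cell; \<open>g\<close> reads z off from its
  coefficients. The decomposition depends on V alone, so each cell contributes a polynomial of its
  own.\<close>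

theorem translate_count_poly:
  fixes V :: "(real ^ 'n) set" and v :: "real ^ 'n"
  assumes fin: "finite V" and V: "V \<subseteq> int_points"
  shows "\<exists>p :: rat poly. \<forall>t>0. of_nat (translate_count (convex hull V) v t) = poly p (of_nat t)"
proof -
  define W where "W = (\<lambda>x. (x, 1 :: real)) ` V"
  have finW: "finite W" and Wint: "\<And>w. w \<in> W \<Longrightarrow> fst w \<in> int_points \<and> snd w = 1"
    using fin V by (auto simp: W_def)
  obtain D where D: "D \<subseteq> Pow W" "decomposes_cone W D" using ex_simplicial_decomposition[OF finW] by blast
  have finD: "finite D" using D finW by (meson finite_Pow_iff finite_subset)
  define X where "X \<sigma> t = {l. (\<forall>w. 0 \<le> l w) \<and> {w. l w \<noteq> 0} = \<sigma> \<and>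
     (\<exists>z\<in>int_points. (\<Sum>w\<in>\<sigma>. l w *\<^sub>R w) = (z - v, real t))}" for \<sigma> and t :: nat
  let ?s = "\<lambda>l. \<Sum>w\<in>W. l w *\<^sub>R w"
  have uniq: "l1 = l2" if "\<forall>w. 0 \<le> l1 w" "{w. l1 w \<noteq> 0} \<in> D" "\<forall>w. 0 \<le> l2 w" "{w. l2 w \<noteq> 0} \<in> D" "?s l1 = ?s l2" for l1 l2
    using D(2)[unfolded decomposes_cone_def, rule_format, OF sum_in_convex_cone_hull[OF finW], of l1] that by (metis (no_types, lifting))
  have sW: "(\<Sum>w\<in>\<sigma>. l w *\<^sub>R w) = ?s l" if "\<sigma> \<in> D" "{w. l w \<noteq> 0} = \<sigma>" for l \<sigma>
    using D that finW by (intro sum.mono_neutral_left) auto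
  define g where "g l = fst (?s l) + v" for l
  have g: "?s l = (g l - v, real t)" "g l \<in> int_points" if "l \<in> X \<sigma> t" "\<sigma> \<in> D" for l \<sigma> t
  proof -
    obtain z where "z \<in> int_points" "?s l = (z - v, real t)" using \<open>l \<in> X \<sigma> t\<close> sW[OF \<open>\<sigma> \<in> D\<close>, of l] by (auto simp: X_def)
    then show "?s l = (g l - v, real t)" "g l \<in> int_points" by (auto simp: g_def)
  qed
  have Xpos: "0 \<le> l w" if "l \<in> X \<sigma> t" for l \<sigma> t w using that unfolding X_def by blast
  have sums: "g l - v = (\<Sum>w\<in>W. l w *\<^sub>R fst w)" "(\<Sum>w\<in>W. l w) = real t" if "l \<in> X \<sigma> t" "\<sigma> \<in> D" for l \<sigma> t
  proof -
    show "g l - v = (\<Sum>w\<in>W. l w *\<^sub>R fst w)" by (simp add: g_def fst_sum)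
    have "real t = (\<Sum>w\<in>W. snd (l w *\<^sub>R w))" using g(1)[OF that] by (metis snd_conv snd_sum)
    also have "\<dots> = (\<Sum>w\<in>W. l w)" using Wint by (intro sum.cong) auto
    finally show "(\<Sum>w\<in>W. l w) = real t" by simp
  qed
  have inj: "inj_on g (\<Union>\<sigma>\<in>D. X \<sigma> t)" for t
  proof (rule inj_onI)
    fix l1 l2 assume l: "l1 \<in> (\<Union>\<sigma>\<in>D. X \<sigma> t)" "l2 \<in> (\<Union>\<sigma>\<in>D. X \<sigma> t)" and eq: "g l1 = g l2"
    obtain \<sigma>1 \<sigma>2 where \<sigma>: "\<sigma>1 \<in> D" "l1 \<in> X \<sigma>1 t" "\<sigma>2 \<in> D" "l2 \<in> X \<sigma>2 t" using l by blast
    have s: "?s l1 = ?s l2" using g(1)[OF \<sigma>(2,1)] g(1)[OF \<sigma>(4,3)] eq by simp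
    have "\<forall>w. 0 \<le> l1 w" "{w. l1 w \<noteq> 0} \<in> D" "\<forall>w. 0 \<le> l2 w" "{w. l2 w \<noteq> 0} \<in> D"
      using \<sigma> unfolding X_def by blast+
    with s show "l1 = l2" by (intro uniq)
  qed
  have finX: "finite (X \<sigma> t)" if \<sigma>: "\<sigma> \<in> D" for \<sigma> t
  proof -
    obtain B where B: "\<And>w. w \<in> W \<Longrightarrow> norm (fst w) \<le> B"
      using finite_imp_bounded[OF finite_imageI[OF finW, of fst]] unfolding bounded_iff by blast
    have "g ` X \<sigma> t \<subseteq> int_points \<inter> cball v (real t * B)"
    proof clarify
      fix l assume l: "l \<in> X \<sigma> t"
      have "norm (g l - v) \<le> (\<Sum>w\<in>W. l w * B)"
        unfolding sums(1)[OF l \<sigma>]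
        by (rule sum_norm_le) (use Xpos[OF l] B in \<open>auto intro!: mult_left_mono\<close>)
      also have "\<dots> = real t * B" using sums(2)[OF l \<sigma>] by (simp flip: sum_distrib_right)
      finally show "g l \<in> int_points \<inter> cball v (real t * B)" using g(2)[OF l \<sigma>] by (simp add: dist_norm norm_minus_commute)
    qed
    then have "finite (g ` X \<sigma> t)" by (rule finite_subset) (simp add: finite_int_points_bounded)
    moreover have "inj_on g (X \<sigma> t)" using inj[of t] \<sigma> by (meson UN_upper inj_on_subset)
    ultimately show ?thesis by (rule finite_imageD)
  qed
  have "\<exists>p :: rat poly. \<forall>t>0. of_nat (card (X \<sigma> t)) = poly p (of_nat t)" if "\<sigma> \<in> D" for \<sigma>
    unfolding X_def
  proof (rule simplex_count_poly)
    show "finite \<sigma>" using that D finW by (meson PowD finite_subset subsetD)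
    show "fst w \<in> int_points \<and> snd w = 1" if "w \<in> \<sigma>" for w using that \<open>\<sigma> \<in> D\<close> D Wint by blast
  qed (use finX[OF that] in \<open>simp add: X_def\<close>)
  then obtain p :: "_ \<Rightarrow> rat poly" where p: "\<And>\<sigma> t. \<sigma> \<in> D \<Longrightarrow> t > 0 \<Longrightarrow> of_nat (card (X \<sigma> t)) = poly (p \<sigma>) (of_nat t)"
    by metis
  have "of_nat (translate_count (convex hull V) v t) = poly (\<Sum>\<sigma>\<in>D. p \<sigma>) (of_nat t)" if t: "t > 0" for t
  proof -
    have "g ` (\<Union>\<sigma>\<in>D. X \<sigma> t) = {z \<in> int_points. z - v \<in> (\<lambda>x. real t *\<^sub>R x) ` (convex hull V)}" (is "?L = ?R")
    proof (intro equalityI subsetI)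
      fix z assume "z \<in> ?L"
      then obtain l \<sigma> where l: "\<sigma> \<in> D" "l \<in> X \<sigma> t" "z = g l" by auto
      have "(\<Sum>w\<in>W. (l w / real t) *\<^sub>R fst w) \<in> convex hull V"
      proof (rule convex_sum)
        show "(\<Sum>w\<in>W. l w / real t) = 1" using sums(2)[OF l(2,1)] t by (simp flip: sum_divide_distrib)
        show "0 \<le> l w / real t" for w using Xpos[OF l(2)] by simp
        show "fst w \<in> convex hull V" if "w \<in> W" for w using that by (auto simp: W_def intro: hull_inc)
      qed (use finW in auto)
      moreover have "z - v = real t *\<^sub>R (\<Sum>w\<in>W. (l w / real t) *\<^sub>R fst w)"
        unfolding l(3) sums(1)[OF l(2,1)] scaleR_sum_right using t by (intro sum.cong) auto
      ultimately show "z \<in> ?R" using g(2)[OF l(2,1)] l(3) by auto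
    next
      fix z assume "z \<in> ?R"
      then obtain x where z: "z \<in> int_points" "z - v = real t *\<^sub>R x" "x \<in> convex hull V" by auto
      then obtain u where u: "\<And>x. x \<in> V \<Longrightarrow> 0 \<le> u x" "sum u V = 1" "(\<Sum>x\<in>V. u x *\<^sub>R x) = x"
        using fin by (auto simp: convex_hull_finite)
      define l where "l w = (if w \<in> W then real t * u (fst w) else 0)" for w
      have "?s l = (\<Sum>x\<in>V. (real t * u x) *\<^sub>R (x, 1))"
        unfolding W_def by (subst sum.reindex) (auto simp: inj_on_def l_def W_def intro!: sum.cong)
      also have "\<dots> = real t *\<^sub>R (\<Sum>x\<in>V. u x *\<^sub>R (x, 1))" by (simp only: scaleR_sum_right scaleR_scaleR)
      also have "(\<Sum>x\<in>V. u x *\<^sub>R (x, 1 :: real)) = (x, 1)"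
        using u by (simp add: prod_eq_iff fst_sum snd_sum)
      finally have "?s l = (z - v, real t)" using z by simp
      moreover have "?s l \<in> convex_cone hull W"
        using u finW by (intro sum_in_convex_cone_hull) (auto simp: l_def W_def)
      ultimately have "(z - v, real t) \<in> convex_cone hull W" by simp
      then obtain m where m: "\<forall>w. 0 \<le> m w" "{w. m w \<noteq> 0} \<in> D" "?s m = (z - v, real t)"
        using D(2) unfolding decomposes_cone_def by blast
      have "(\<Sum>w\<in>{w. m w \<noteq> 0}. m w *\<^sub>R w) = (z - v, real t)" using sW[OF m(2) refl] m(3) by simp
      then have "m \<in> X {w. m w \<noteq> 0} t" using z(1) m(1) unfolding X_def by blast
      moreover have "z = g m" using m by (simp add: g_def)
      ultimately show "z \<in> ?L" using m(2) by blast
    qed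
    then have "translate_count (convex hull V) v t = card (\<Union>\<sigma>\<in>D. X \<sigma> t)"
      unfolding translate_count_def using card_image[OF inj[of t]] by simp
    also have "\<dots> = (\<Sum>\<sigma>\<in>D. card (X \<sigma> t))"
      by (rule card_UN_disjoint) (use finD finX in \<open>auto simp: X_def\<close>)
    finally show ?thesis using p t by (simp add: poly_sum)
  qed
  then show ?thesis by blast
qed

section \<open>Symmetric quasi-polynomials\<close>

lemma int_points_add: "x \<in> int_points \<Longrightarrow> y \<in> int_points \<Longrightarrow> x + y \<in> int_points"
  and int_points_diff: "x \<in> int_points \<Longrightarrow> y \<in> int_points \<Longrightarrow> x - y \<in> int_points"
  and int_points_minus: "x \<in> int_points \<Longrightarrow> - x \<in> int_points"
  and int_points_scaleR: "x \<in> int_points \<Longrightarrow> real k *\<^sub>R x \<in> int_points"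
  and int_points_0: "0 \<in> int_points"
  by (auto simp: int_points_def)

lemma int_points_minus_iff: "- x \<in> int_points \<longleftrightarrow> x \<in> int_points"
  using int_points_minus[of x] int_points_minus[of "- x"] by auto

lemma ehrhart_translate:
  "ehrhart ((\<lambda>x. c + x) ` P) t = of_nat (translate_count P (real t *\<^sub>R c) t)"
proof -
  have "(\<lambda>x. real t *\<^sub>R x) ` (\<lambda>x. c + x) ` P \<inter> int_points
     = {z \<in> int_points. z - real t *\<^sub>R c \<in> (\<lambda>x. real t *\<^sub>R x) ` P}"
    by (auto simp: scaleR_add_right image_iff diff_eq_eq add.commute)
  then show ?thesis by (simp add: ehrhart_def translate_count_def)
qed

lemma translate_count_shift:
  assumes "y \<in> int_points"
  shows "translate_count P (v + y) t = translate_count P v t"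
proof -
  have "bij_betw (\<lambda>z. z + y) {z \<in> int_points. z - v \<in> (\<lambda>x. real t *\<^sub>R x) ` P}
     {z \<in> int_points. z - (v + y) \<in> (\<lambda>x. real t *\<^sub>R x) ` P}"
    by (rule bij_betw_byWitness[where f' = "\<lambda>z. z - y"])
       (auto simp: int_points_add int_points_diff assms diff_diff_eq2 diff_diff_eq add.commute)
  from bij_betw_same_card[OF this] show ?thesis by (simp add: translate_count_def)
qed

text \<open>The centre of P is c/2. The reflection z -> tc - z preserves the lattice because c,
  twice the centre, is integral.\<close>

lemma translate_count_minus:
  assumes sym: "P = (\<lambda>x. c + x) ` uminus ` P" and c: "c \<in> int_points"
  shows "translate_count P (- v) t = translate_count P v t"
proof -
  have P: "c - x \<in> P" if "x \<in> P" for x using that by (subst sym) auto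
  have tP: "real t *\<^sub>R c - y \<in> (\<lambda>x. real t *\<^sub>R x) ` P" if "y \<in> (\<lambda>x. real t *\<^sub>R x) ` P" for y
  proof -
    obtain x where "x \<in> P" "y = real t *\<^sub>R x" using \<open>y \<in> _\<close> by auto
    then show ?thesis using P[of x] by (intro image_eqI[of _ _ "c - x"]) (simp_all add: scaleR_diff_right)
  qed
  define B where "B v = {z \<in> int_points. z - v \<in> (\<lambda>x. real t *\<^sub>R x) ` P}" for v
  have A: "real t *\<^sub>R c - z \<in> B (- v)" if "z \<in> B v" for z v
    using that tP[of "z - v"] c by (auto simp: B_def algebra_simps int_points_diff int_points_scaleR)
  have "bij_betw (\<lambda>z. real t *\<^sub>R c - z) (B v) (B (- v))"
    by (rule bij_betw_byWitness[where f' = "\<lambda>z. real t *\<^sub>R c - z"])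
       (use A[of _ v] A[of _ "- v"] in \<open>simp_all add: image_subset_iff\<close>)
  from bij_betw_same_card[OF this] show ?thesis by (simp add: translate_count_def B_def)
qed

section \<open>Uniqueness and symmetry of constituents\<close>

lemma poly_eq_on_nats:
  fixes p q :: "rat poly"
  assumes "infinite T" "\<And>t. t \<in> T \<Longrightarrow> poly p (of_nat t) = poly q (of_nat t)"
  shows "p = q"
proof (rule ccontr)
  assume "p \<noteq> q"
  then have "finite {x. poly (p - q) x = 0}" by (intro poly_roots_finite) auto
  moreover have "of_nat ` T \<subseteq> {x. poly (p - q) x = 0}" using assms by auto
  ultimately have "finite (of_nat ` T :: rat set)" by (rule finite_subset[rotated])
  then show False using assms(1) by (auto dest!: finite_imageD simp: inj_on_def)
qed

lemma has_constituents_periodic: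
  fixes f :: "nat \<Rightarrow> rat poly"
  assumes q: "q > 0" and per: "\<And>k k'. [k = k'] (mod q) \<Longrightarrow> f k = f k'"
    and L: "\<And>t. t > 0 \<Longrightarrow> L t = poly (f t) (of_nat t)"
  shows "has_constituents L q f"
  unfolding has_constituents_def
proof (intro conjI ballI allI impI)
  show "f 0 = f q" by (rule per) (simp add: cong_def)
  show "L t = poly (f k) (of_nat t)" if "t > 0" "[t = k] (mod q)" for k t
    using L[OF that(1)] per[OF that(2)] by simp
qed (fact q)

text \<open>The two descriptions have unrelated periods q and \<rho>. Along the progression k' + q
  \<rho> i each of them uses a single polynomial, and infinitely many common values identify the
  two.\<close>

lemma constituents_unique:
  fixes f :: "nat \<Rightarrow> rat poly"
  assumes q: "q > 0" and per: "\<And>k k'. [k = k'] (mod q) \<Longrightarrow> f k = f k'"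
    and L: "\<And>t. t > 0 \<Longrightarrow> L t = poly (f t) (of_nat t)"
    and g: "has_constituents L \<rho> g" and k: "k \<in> {1..\<rho>}" "k' > 0" "[k' = k] (mod \<rho>)"
  shows "g k = f k'"
proof (rule poly_eq_on_nats)
  have "q * \<rho> > 0" using q g by (auto simp: has_constituents_def)
  then show "infinite (range (\<lambda>i. k' + q * \<rho> * i))"
    by (intro range_inj_infinite) (auto simp: inj_on_def)
  fix t assume "t \<in> range (\<lambda>i. k' + q * \<rho> * i)"
  then obtain i where t: "t = k' + q * \<rho> * i" by auto
  have "[t = k'] (mod q)" "[t = k'] (mod \<rho>)"
    using t by (simp add: cong_def mult.assoc) (simp add: t cong_def mult.assoc mult.left_commute[of q \<rho>])
  then have "f t = f k'" "[t = k] (mod \<rho>)" using per k cong_trans by blast+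
  moreover have "t > 0" using k t by simp
  ultimately show "poly (g k) (of_nat t) = poly (f k') (of_nat t)"
    using L[of t] g k by (auto simp: has_constituents_def)
qed

text \<open>The minimal period is never computed. Its constituents are values of f at any positive
  index in the right residue class, and the index \<open>2 * q * ?\<rho> - k\<close> is congruent to
  -k modulo both periods at once, so symmetry passes from q to the minimal period.\<close>

lemma symmetric_quasi_polynomial_periodic:
  fixes f :: "nat \<Rightarrow> rat poly"
  assumes q: "q > 0" and per: "\<And>k k'. [k = k'] (mod q) \<Longrightarrow> f k = f k'"
    and L: "\<And>t. t > 0 \<Longrightarrow> L t = poly (f t) (of_nat t)"
    and sym: "\<And>k k'. q dvd k + k' \<Longrightarrow> f k = f k'"
  shows "symmetric_quasi_polynomial L"
proof -
  let ?\<rho> = "minimal_period L"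
  have qp: "quasi_period L q" using has_constituents_periodic[OF q per L] by (auto simp: quasi_period_def)
  then have "quasi_period L ?\<rho>" unfolding minimal_period_def by (rule LeastI)
  then obtain g where g: "has_constituents L ?\<rho> g" by (auto simp: quasi_period_def)
  note uniq = constituents_unique[OF q per L g]
  have \<rho>: "?\<rho> > 0" "g 0 = g ?\<rho>" using g by (auto simp: has_constituents_def)
  have "g k = g (?\<rho> - k)" if "k \<le> ?\<rho>" for k
  proof (cases "k = 0 \<or> k = ?\<rho>")
    case True then show ?thesis using \<rho> by auto
  next
    case False
    then have k: "0 < k" "k < ?\<rho>" using that by auto
    have less: "k < 2 * q * ?\<rho>" using k(2) q by (metis less_le_trans mult.commute mult_le_mono1 nat_mult_1 One_nat_def Suc_leI mult_pos_pos zero_less_numeral)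
    have "[2 * q * ?\<rho> - k = ?\<rho> - k] (mod ?\<rho>)"
    proof -
      obtain n where "2 * q = n + 1" using q by (metis Suc_eq_plus1 gr0_implies_Suc nat_0_less_mult_iff zero_less_numeral)
      then have "2 * q * ?\<rho> - k = (?\<rho> - k) + n * ?\<rho>" using k by simp
      then show ?thesis by (simp add: cong_def)
    qed
    then have "g (?\<rho> - k) = f (2 * q * ?\<rho> - k)" using k less by (intro uniq) auto
    moreover have "g k = f k" using k by (intro uniq) auto
    moreover have "f k = f (2 * q * ?\<rho> - k)" using less by (intro sym) auto
    ultimately show ?thesis by simp
  qed
  then show ?thesis unfolding symmetric_quasi_polynomial_def quasi_polynomial_def using qp g by blast
qed

lemma symmetric_quasi_polynomial_periodicD:
  fixes f :: "nat \<Rightarrow> rat poly"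
  assumes q: "q > 0" and per: "\<And>k k'. [k = k'] (mod q) \<Longrightarrow> f k = f k'"
    and L: "\<And>t. t > 0 \<Longrightarrow> L t = poly (f t) (of_nat t)"
    and sym: "symmetric_quasi_polynomial L"
  shows "\<exists>m. q dvd m + 1 \<and> f m = f 1"
proof -
  let ?\<rho> = "minimal_period L"
  from sym obtain g where g: "has_constituents L ?\<rho> g" and s: "\<And>k. k \<le> ?\<rho> \<Longrightarrow> g k = g (?\<rho> - k)"
    by (auto simp: symmetric_quasi_polynomial_def)
  note uniq = constituents_unique[OF q per L g]
  have \<rho>: "?\<rho> > 0" "g 0 = g ?\<rho>" using g by (auto simp: has_constituents_def)
  \<comment> \<open>\<open>m\<close> is congruent to -1 modulo both periods; the factor 2 keeps it
    positive when both of them are 1.\<close>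
  define m where "m = 2 * q * ?\<rho> - 1"
  have m: "m + 1 = 2 * q * ?\<rho>" "m > 0"
  proof -
    have "2 * q * ?\<rho> \<ge> 2 * 1 * 1" using q \<rho> by (intro mult_le_mono) auto
    then show "m + 1 = 2 * q * ?\<rho>" "m > 0" unfolding m_def by linarith+
  qed
  have "g 1 = f 1" using \<rho> by (intro uniq) auto
  moreover have "g 1 = f m"
  \<comment> \<open>Constituents are compared at indices from 1 to the period, and the period minus
    1 leaves this range when the period is 1.\<close>
  proof (cases "?\<rho> = 1")
    case True then show ?thesis using m by (intro uniq) auto
  next
    case False
    have "[m = ?\<rho> - 1] (mod ?\<rho>)"
    proof (rule cong_add_rcancel_nat[THEN iffD1])
      show "[m + 1 = ?\<rho> - 1 + 1] (mod ?\<rho>)" using m \<rho> by (simp add: cong_def)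
    qed
    then have "g (?\<rho> - 1) = f m" using m \<rho> False by (intro uniq) auto
    then show ?thesis using s[of 1] \<rho> by simp
  qed
  ultimately show ?thesis using m by (intro exI[of _ m]) auto
qed

section \<open>Constituents of the Ehrhart function of a translate\<close>

lemma rat_points_denominator:
  assumes "c \<in> rat_points"
  obtains q :: nat where "q > 0" "real q *\<^sub>R c \<in> int_points"
proof -
  have "\<forall>i. \<exists>d::nat. d > 0 \<and> real d * c $ i \<in> \<int>"
  proof
    fix i
    obtain a b :: int where "b > 0" "c $ i = of_int a / of_int b"
      using assms unfolding rat_points_def by (metis (mono_tags) Rats_cases' mem_Collect_eq)
    then show "\<exists>d::nat. d > 0 \<and> real d * c $ i \<in> \<int>" by (intro exI[of _ "nat b"]) auto
  qed
  then obtain d :: "_ \<Rightarrow> nat" where d: "\<And>i. d i > 0" "\<And>i. real (d i) * c $ i \<in> \<int>" by metis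
  define q where "q = (\<Prod>i\<in>UNIV. d i)"
  have "real q * c $ i \<in> \<int>" for i
  proof -
    have "q = (\<Prod>j\<in>UNIV - {i}. d j) * d i" unfolding q_def by (simp add: prod.remove[of UNIV i] mult.commute)
    then have "real q * c $ i = real (\<Prod>j\<in>UNIV - {i}. d j) * (real (d i) * c $ i)" by (simp add: mult.assoc)
    then show ?thesis using d(2) by (metis Ints_mult Ints_of_nat)
  qed
  then show ?thesis using d(1) by (intro that[of q]) (auto simp: int_points_def q_def)
qed

text \<open>Index and argument are separated: f k counts for the fixed translation kc at every t >
  0, and the Ehrhart function is the diagonal \<open>poly (f t) (of_nat t)\<close>. Adding q to k
  shifts by the integer vector qc, whence the period.\<close>

lemma ehrhart_constituents:
  fixes V :: "(real ^ 'n) set"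
  assumes V: "finite V" "V \<subseteq> int_points" and c: "c \<in> rat_points"
  obtains q f where "q > 0" "real q *\<^sub>R c \<in> int_points" "\<forall>k k'. [k = k'] (mod q) \<longrightarrow> f k = f k'"
    "\<forall>k. \<forall>t>0. of_nat (translate_count (convex hull V) (real k *\<^sub>R c) t) = poly (f k :: rat poly) (of_nat t)"
proof -
  obtain q where q: "q > 0" "real q *\<^sub>R c \<in> int_points" by (rule rat_points_denominator[OF c])
  have "\<forall>k::nat. \<exists>p :: rat poly. \<forall>t>0. of_nat (translate_count (convex hull V) (real k *\<^sub>R c) t) = poly p (of_nat t)"
    by (intro allI translate_count_poly V)
  then obtain f :: "nat \<Rightarrow> rat poly" where
    f: "\<And>k t. t > 0 \<Longrightarrow> of_nat (translate_count (convex hull V) (real k *\<^sub>R c) t) = poly (f k) (of_nat t)"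
    unfolding choice_iff by blast
  have step: "f k = f (k + i * q)" for k i
  proof (rule poly_eq_on_nats[of "{0<..}"])
    show "infinite {0::nat<..}" by (rule infinite_Ioi)
    fix t :: nat assume "t \<in> {0<..}"
    moreover have "real (k + i * q) *\<^sub>R c = real k *\<^sub>R c + real i *\<^sub>R (real q *\<^sub>R c)"
      by (simp add: scaleR_add_left)
    ultimately show "poly (f k) (of_nat t) = poly (f (k + i * q)) (of_nat t)"
      using f[of t k] f[of t "k + i * q"] translate_count_shift[OF int_points_scaleR[OF q(2)], of "convex hull V" "real k *\<^sub>R c" i t]
      by (simp del: of_nat_add of_nat_mult)
  qed
  have per: "f k = f k'" if "[k = k'] (mod q)" for k k'
  proof -
    have "f k = f (k mod q)" for k using step[of "k mod q" "k div q"] by (simp only: mod_div_mult_eq)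
    with that show ?thesis unfolding cong_def by metis
  qed
  show ?thesis by (rule that[of q f]) (use q per f in blast)+
qed

lemma symmetric_ehrhart:
  fixes V :: "(real ^ 'n) set"
  assumes V: "finite V" "V \<subseteq> int_points" and c: "c \<in> rat_points"
    and sym: "\<And>v t. translate_count (convex hull V) (- v) t = translate_count (convex hull V) v t"
  shows "symmetric_quasi_polynomial (ehrhart ((\<lambda>x. c + x) ` (convex hull V)))"
proof -
  obtain q f where q: "q > 0" "real q *\<^sub>R c \<in> int_points"
    and per: "\<forall>k k'. [k = k'] (mod q) \<longrightarrow> f k = f k'"
    and f: "\<forall>k. \<forall>t>0. of_nat (translate_count (convex hull V) (real k *\<^sub>R c) t) = poly (f k :: rat poly) (of_nat t)"
    by (rule ehrhart_constituents[OF V c])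
  note per = per[rule_format] and f = f[rule_format]
  show ?thesis
  proof (rule symmetric_quasi_polynomial_periodic[OF q(1) per])
    show "ehrhart ((\<lambda>x. c + x) ` (convex hull V)) t = poly (f t) (of_nat t)" if "t > 0" for t
      using f[OF that, of t] by (simp add: ehrhart_translate)
    show "f k = f k'" if dv: "q dvd k + k'" for k k'
    proof (rule poly_eq_on_nats[of "{0<..}"])
      show "infinite {0::nat<..}" by (rule infinite_Ioi)
      obtain i where "k + k' = q * i" using dv unfolding dvd_def by blast
      then have "real k + real k' = real q * real i" by (simp flip: of_nat_add of_nat_mult)
      then have "real k' = real i * real q - real k" by (simp add: algebra_simps)
      then have "real k' *\<^sub>R c = - (real k *\<^sub>R c) + real i *\<^sub>R (real q *\<^sub>R c)"
        by (simp add: scaleR_diff_left)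
      then have "translate_count (convex hull V) (real k' *\<^sub>R c) t = translate_count (convex hull V) (real k *\<^sub>R c) t" for t
        using translate_count_shift[OF int_points_scaleR[OF q(2)], of "convex hull V" "- (real k *\<^sub>R c)" i t] sym by simp
      then show "poly (f k) (of_nat t) = poly (f k') (of_nat t)" if "t \<in> {0<..}" for t
        using f[of t k] f[of t k'] that by simp
    qed
  qed
qed

text \<open>Symmetry yields f m = f 1 for some m congruent to -1 modulo q. This is an identity of
  polynomials and may be evaluated at t = 1, although the diagonal meets f m only at arguments
  congruent to m. Since mc and -c differ by a lattice vector, the result compares -c + P with c +
  P.\<close>

lemma symmetric_ehrhartD:
  fixes V :: "(real ^ 'n) set"
  assumes V: "finite V" "V \<subseteq> int_points" and c: "c \<in> rat_points"
    and sym: "symmetric_quasi_polynomial (ehrhart ((\<lambda>x. c + x) ` (convex hull V)))"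
  shows "translate_count (convex hull V) (- c) 1 = translate_count (convex hull V) c 1"
proof -
  obtain q f where q: "q > 0" "real q *\<^sub>R c \<in> int_points"
    and per: "\<forall>k k'. [k = k'] (mod q) \<longrightarrow> f k = f k'"
    and f: "\<forall>k. \<forall>t>0. of_nat (translate_count (convex hull V) (real k *\<^sub>R c) t) = poly (f k :: rat poly) (of_nat t)"
    by (rule ehrhart_constituents[OF V c])
  note per = per[rule_format] and f = f[rule_format]
  have "\<exists>m. q dvd m + 1 \<and> f m = f 1"
    by (rule symmetric_quasi_polynomial_periodicD[OF q(1) per _ sym]) (simp_all add: ehrhart_translate f)
  then obtain m i where m: "m + 1 = q * i" "f m = f 1" by (auto elim: dvdE)
  have "real m + 1 = real q * real i" using m(1) by (simp flip: of_nat_mult of_nat_Suc)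
  then have "real m = real i * real q - 1" by (simp add: algebra_simps)
  then have "real m *\<^sub>R c = - c + real i *\<^sub>R (real q *\<^sub>R c)" by (simp add: scaleR_diff_left)
  then have "translate_count (convex hull V) (- c) 1 = translate_count (convex hull V) (real m *\<^sub>R c) 1"
    using translate_count_shift[OF int_points_scaleR[OF q(2)], of "convex hull V" "- c" i 1] by simp
  also have "\<dots> = translate_count (convex hull V) c 1"
    using f[of 1 m] f[of 1 1] m(2) by simp
  finally show ?thesis .
qed

section \<open>The Prekopa-Leindler inequality\<close>

text \<open>The sets (A + b)/2 and (a + B)/2 lie in C and have half the measures of A and B. With a
  close to Sup A and b close to Inf B they overlap only in the short interval \<open>J\<close>, so
  their measures nearly add up.\<close>

lemma midpoint_emeasure_bounded:
  fixes A B C :: "real set"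
  assumes [measurable]: "A \<in> sets borel" "B \<in> sets borel" "C \<in> sets borel"
    and ne: "A \<noteq> {}" "B \<noteq> {}" and bdd: "bounded A" "bounded B"
    and mid: "\<And>a b. a \<in> A \<Longrightarrow> b \<in> B \<Longrightarrow> (a + b) / 2 \<in> C"
  shows "emeasure lborel A + emeasure lborel B \<le> 2 * emeasure lborel C"
proof -
  have bA: "bdd_above A" and bB: "bdd_below B"
    using bdd by (auto intro: bounded_imp_bdd_above bounded_imp_bdd_below)
  have img: "{x. - c + 2 * x \<in> X} = (\<lambda>x. (x + c) / 2) ` X" for c :: real and X
  proof -
    have "x \<in> (\<lambda>x. (x + c) / 2) ` X" if "- c + 2 * x \<in> X" for x
      using that by (intro image_eqI[of _ _ "- c + 2 * x"]) auto
    moreover have "- c + 2 * ((x + c) / 2) = x" for x by (simp add: field_simps)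
    ultimately show ?thesis by auto
  qed
  have half: "emeasure lborel ((\<lambda>x. (x + c) / 2) ` X) = emeasure lborel X / 2"
    if [measurable]: "X \<in> sets borel" for X and c :: real
  proof -
    have "emeasure lborel X = emeasure (density (distr lborel borel (\<lambda>x. - c + 2 * x)) (\<lambda>_. ennreal \<bar>2\<bar>)) X"
      using lborel_real_affine[of 2 "- c"] by simp
    also have "\<dots> = 2 * emeasure lborel {x. - c + 2 * x \<in> X}"
      by (simp add: emeasure_density nn_integral_cmult emeasure_distr vimage_def)
    also have "{x. - c + 2 * x \<in> X} = (\<lambda>x. (x + c) / 2) ` X"
      by (rule img)
    finally show ?thesis
      by (simp add: ennreal_mult_divide_eq mult.commute[of "2::ennreal"])
  qed
  have halfm: "(\<lambda>x. (x + c) / 2) ` X \<in> sets borel" if "X \<in> sets borel" for X and c :: real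
  proof -
    have "(\<lambda>x. (x + c) / 2) ` X = (\<lambda>x. - c + 2 * x) -` X \<inter> space borel"
      using img[of c X] by auto
    also have "\<dots> \<in> sets borel" using that by measurable
    finally show ?thesis .
  qed
  have "emeasure lborel A + emeasure lborel B \<le> 2 * emeasure lborel C + ennreal e"
    if e: "e > 0" for e :: real
  proof -
    obtain a where a: "a \<in> A" "a > Sup A - e/2"
      using less_cSup_iff[OF ne(1) bA, of "Sup A - e/2"] e by auto
    obtain b where b: "b \<in> B" "b < Inf B + e/2"
      using cInf_less_iff[OF ne(2) bB, of "Inf B + e/2"] e by auto
    define A' where "A' = (\<lambda>x. (x + b) / 2) ` A"
    define B' where "B' = (\<lambda>y. (y + a) / 2) ` B"
    define J where "J = {(a + Inf B) / 2..(Sup A + b) / 2}"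
    have m [measurable]: "A' \<in> sets borel" "B' \<in> sets borel" "J \<in> sets borel"
      unfolding A'_def B'_def J_def by (auto intro: halfm)
    have sub: "A' \<inter> B' \<subseteq> J"
    proof
      fix z assume "z \<in> A' \<inter> B'"
      then obtain x y where "x \<in> A" "z = (x + b)/2" "y \<in> B" "z = (y + a)/2"
        unfolding A'_def B'_def by blast
      moreover have "x \<le> Sup A" "Inf B \<le> y"
        using \<open>x \<in> A\<close> \<open>y \<in> B\<close> bA bB by (auto intro: cSup_upper cInf_lower)
      ultimately show "z \<in> J" by (auto simp: J_def)
    qed
    have "emeasure lborel J \<le> ennreal (e/2)"
    proof -
      have "a \<le> Sup A" "Inf B \<le> b" using a b bA bB by (auto intro: cSup_upper cInf_lower)
      moreover have "(Sup A + b) / 2 - (a + Inf B) / 2 \<le> e / 2" using a b by (simp add: field_simps)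
      ultimately show ?thesis by (simp add: J_def ennreal_leI)
    qed
    have "emeasure lborel A' + emeasure lborel B' = emeasure lborel (A' \<union> B') + emeasure lborel (A' \<inter> B')"
      by (rule emeasure_Un_Int) auto
    also have "\<dots> \<le> emeasure lborel C + ennreal (e/2)"
    proof (rule add_mono)
      show "emeasure lborel (A' \<union> B') \<le> emeasure lborel C"
        by (rule emeasure_mono) (use mid a b in \<open>auto simp: A'_def B'_def add.commute[of _ a]\<close>)
      show "emeasure lborel (A' \<inter> B') \<le> ennreal (e/2)"
        using emeasure_mono[OF sub, of lborel] \<open>emeasure lborel J \<le> ennreal (e/2)\<close> by (auto simp: J_def)
    qed
    finally have "emeasure lborel A / 2 + emeasure lborel B / 2 \<le> emeasure lborel C + ennreal (e/2)"
      unfolding A'_def B'_def by (simp add: half)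
    then have "2 * (emeasure lborel A / 2 + emeasure lborel B / 2) \<le> 2 * (emeasure lborel C + ennreal (e/2))"
      by (rule mult_left_mono) auto
    moreover have "2 * (x / 2) = x" for x :: ennreal
      by (simp add: ennreal_times_divide ennreal_mult_divide_eq mult.commute)
    moreover have "2 * ennreal (e/2) = ennreal e"
      using e by (simp flip: ennreal_numeral ennreal_mult)
    ultimately show ?thesis by (simp add: distrib_left)
  qed
  then show ?thesis by (rule ennreal_le_epsilon)
qed

lemma midpoint_emeasure:
  fixes A B C :: "real set"
  assumes [measurable]: "A \<in> sets borel" "B \<in> sets borel" "C \<in> sets borel"
    and ne: "A \<noteq> {}" "B \<noteq> {}"
    and mid: "\<And>a b. a \<in> A \<Longrightarrow> b \<in> B \<Longrightarrow> (a + b) / 2 \<in> C"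
  shows "emeasure lborel A + emeasure lborel B \<le> 2 * emeasure lborel C"
proof -
  define T where "T X n = X \<inter> {- real n..real n}" for X :: "real set" and n
  have lim: "(\<lambda>n. emeasure lborel (T X n)) \<longlonglongrightarrow> emeasure lborel X" if [measurable]: "X \<in> sets borel" for X
  proof -
    have "(\<Union>n. T X n) = X"
      by (auto simp: T_def) (metis abs_le_iff real_arch_simple minus_le_iff)
    moreover have "(\<lambda>n. emeasure lborel (T X n)) \<longlonglongrightarrow> emeasure lborel (\<Union>n. T X n)"
      by (rule Lim_emeasure_incseq) (auto simp: T_def incseq_def)
    ultimately show ?thesis by simp
  qed
  obtain a b where ab: "a \<in> A" "b \<in> B" using ne by auto
  obtain N where N: "max \<bar>a\<bar> \<bar>b\<bar> \<le> real N" using real_arch_simple by blast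
  have "emeasure lborel (T A n) + emeasure lborel (T B n) \<le> 2 * emeasure lborel C" if "n \<ge> N" for n
  proof (rule midpoint_emeasure_bounded)
    have "a \<in> T A n" "b \<in> T B n" using ab N that by (auto simp: T_def)
    then show "T A n \<noteq> {}" "T B n \<noteq> {}" by auto
  qed (use mid in \<open>auto simp: T_def\<close>)
  then show ?thesis
    by (intro LIMSEQ_le_const2[OF tendsto_add[OF lim lim]]) auto
qed

lemma layer_cake_le_1:
  fixes f :: "real \<Rightarrow> ennreal"
  assumes [measurable]: "f \<in> borel_measurable borel" and le: "\<And>x. f x \<le> 1"
  shows "(\<integral>\<^sup>+x. f x \<partial>lborel) = (\<integral>\<^sup>+t\<in>{0<..<1}. emeasure lborel {x. ennreal t < f x} \<partial>lborel)"
proof -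
  have "f x = (\<integral>\<^sup>+t. indicator {t. 0 < t \<and> t < 1 \<and> ennreal t < f x} t \<partial>lborel)" for x
  proof -
    obtain r where r: "f x = ennreal r" "0 \<le> r" "r \<le> 1"
      using le[of x] by (cases "f x") (auto simp: top_unique)
    have "{t. 0 < t \<and> t < 1 \<and> ennreal t < f x} = {0<..<r}"
      using r by (auto simp: ennreal_less_iff)
    then show ?thesis using r by simp
  qed
  then have "(\<integral>\<^sup>+x. f x \<partial>lborel) =
     (\<integral>\<^sup>+x. (\<integral>\<^sup>+t. indicator {t. 0 < t \<and> t < 1 \<and> ennreal t < f x} t \<partial>lborel) \<partial>lborel)"
    by (intro nn_integral_cong) auto
  also have "\<dots> = (\<integral>\<^sup>+x. (\<integral>\<^sup>+t. indicator {(t,x). 0 < t \<and> t < 1 \<and> ennreal t < f x} (t,x) \<partial>lborel) \<partial>lborel)"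
    by (intro nn_integral_cong) (auto split: split_indicator)
  also have "\<dots> = (\<integral>\<^sup>+t. (\<integral>\<^sup>+x. indicator {(t,x). 0 < t \<and> t < 1 \<and> ennreal t < f x} (t,x) \<partial>lborel) \<partial>lborel)"
    by (rule lborel_pair.Fubini') measurable
  also have "\<dots> = (\<integral>\<^sup>+t\<in>{0<..<1}. emeasure lborel {x. ennreal t < f x} \<partial>lborel)"
  proof (rule nn_integral_cong)
    fix t :: real
    have "(\<integral>\<^sup>+x. indicator {(t,x). 0 < t \<and> t < 1 \<and> ennreal t < f x} (t,x) \<partial>lborel)
       = (\<integral>\<^sup>+x. indicator {0<..<1} t * indicator {x. ennreal t < f x} x \<partial>lborel)"
      by (intro nn_integral_cong) (auto split: split_indicator)
    also have "\<dots> = indicator {0<..<1} t * emeasure lborel {x. ennreal t < f x}"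
      by (subst nn_integral_cmult) auto
    finally show "(\<integral>\<^sup>+x. indicator {(t,x). 0 < t \<and> t < 1 \<and> ennreal t < f x} (t,x) \<partial>lborel)
       = emeasure lborel {x. ennreal t < f x} * indicator {0<..<1} t" by (simp add: mult.commute)
  qed
  finally show ?thesis .
qed

lemma power2_less_ennreal: "a < b" if "a ^ 2 < b ^ 2" for a b :: ennreal
  using that by (meson linorder_not_le power_mono zero_le)

text \<open>As both suprema are 1, the superlevel sets of f and g are nonempty at every level t in
  (0,1), and the one-dimensional inequality for sets applies there; integrating over t gives an
  additive inequality. Cutting h off at 1 makes the layer cake formula over these levels available
  for it.\<close>

lemma prekopa_leindler_normalized:
  fixes f g h :: "real \<Rightarrow> ennreal"
  assumes [measurable]: "f \<in> borel_measurable borel" "g \<in> borel_measurable borel" "h \<in> borel_measurable borel"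
    and f: "(SUP x. f x) = 1" and g: "(SUP x. g x) = 1"
    and le: "\<And>x y. f x * g y \<le> (h ((x + y) / 2)) ^ 2"
  shows "(\<integral>\<^sup>+x. f x \<partial>lborel) + (\<integral>\<^sup>+x. g x \<partial>lborel) \<le> 2 * (\<integral>\<^sup>+x. h x \<partial>lborel)"
proof -
  let ?m = "\<lambda>f t. emeasure lborel {x. ennreal t < f x}"
  have f1: "f x \<le> 1" "g x \<le> 1" for x
    using SUP_upper[of x UNIV f] SUP_upper[of x UNIV g] f g by auto
  define k where "k x = min (h x) 1" for x
  have [measurable]: "k \<in> borel_measurable borel" unfolding k_def by measurable
  have "?m f t + ?m g t \<le> 2 * ?m k t" if t: "0 < t" "t < 1" for t
  proof (rule midpoint_emeasure)
    have "ennreal t < 1" using t by (simp add: ennreal_less_iff flip: ennreal_1)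
    then have "\<exists>x. ennreal t < f x" "\<exists>x. ennreal t < g x"
      using f g less_SUP_iff[of "ennreal t" f UNIV] less_SUP_iff[of "ennreal t" g UNIV] by auto
    then show "{x. ennreal t < f x} \<noteq> {}" "{x. ennreal t < g x} \<noteq> {}" by auto
    fix a b assume ab: "a \<in> {x. ennreal t < f x}" "b \<in> {x. ennreal t < g x}"
    obtain p q where pq: "f a = ennreal p" "g b = ennreal q" "0 \<le> p" "0 \<le> q"
      using f1[of a] f1[of b] by (metis ennreal_cases ennreal_one_less_top leD)
    have "t < p" "t < q" using ab pq t by (auto simp: ennreal_less_iff)
    then have "t * t < p * q" using t by (intro mult_strict_mono) auto
    then have "ennreal t * ennreal t < f a * g b"
      using t pq by (simp add: ennreal_less_iff flip: ennreal_mult)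
    then have "(ennreal t)^2 < (h ((a + b) / 2))^2"
      using le[of a b] by (simp add: power2_eq_square)
    then show "(a + b) / 2 \<in> {x. ennreal t < k x}"
      using \<open>ennreal t < 1\<close> by (auto simp: k_def dest: power2_less_ennreal)
  qed measurable
  then have "(\<integral>\<^sup>+t\<in>{0<..<1}. (?m f t + ?m g t) \<partial>lborel) \<le> (\<integral>\<^sup>+t\<in>{0<..<1}. (2 * ?m k t) \<partial>lborel)"
    by (intro nn_integral_mono) (auto split: split_indicator)
  also have "(\<integral>\<^sup>+t\<in>{0<..<1}. (2 * ?m k t) \<partial>lborel) = 2 * (\<integral>\<^sup>+x. k x \<partial>lborel)"
    using layer_cake_le_1[of k] by (simp add: k_def[abs_def] mult.assoc nn_integral_cmult)
  also have "\<dots> \<le> 2 * (\<integral>\<^sup>+x. h x \<partial>lborel)"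
    by (intro mult_left_mono nn_integral_mono) (auto simp: k_def)
  also have "(\<integral>\<^sup>+t\<in>{0<..<1}. (?m f t + ?m g t) \<partial>lborel) = (\<integral>\<^sup>+x. f x \<partial>lborel) + (\<integral>\<^sup>+x. g x \<partial>lborel)"
    using layer_cake_le_1[of f] layer_cake_le_1[of g] f1 by (simp add: distrib_right nn_integral_add)
  finally show ?thesis .
qed

lemma ennreal_am_gm:
  fixes x y h :: ennreal
  assumes "x + y \<le> 2 * h"
  shows "x * y \<le> h ^ 2"
proof (cases "h = top")
  case True then show ?thesis by simp
next
  case False
  then have "2 * h \<noteq> top" by (simp add: ennreal_mult_eq_top_iff)
  then have "x \<noteq> top" "y \<noteq> top" using assms by (auto simp: top_unique)
  then obtain a b c where [simp]: "x = ennreal a" "y = ennreal b" "h = ennreal c" and pos: "0 \<le> a" "0 \<le> b" "0 \<le> c"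
    using False by (metis ennreal_cases)
  have "a + b \<le> 2 * c" using assms pos
    by (simp flip: ennreal_plus ennreal_mult ennreal_numeral)
  then have "(a + b)^2 \<le> (2 * c)^2" using pos by (intro power_mono) auto
  moreover have "4 * (a * b) \<le> (a + b)^2" using zero_le_power2[of "a - b"] by (simp add: power2_eq_square algebra_simps)
  ultimately have "a * b \<le> c^2" by (simp add: power2_eq_square)
  then show ?thesis using pos by (simp add: ennreal_power flip: ennreal_mult)
qed

text \<open>Dividing f, g and h by a, b and the geometric mean of a and b preserves the hypothesis
  and normalizes both suprema. The inequality of arithmetic and geometric means then turns the sum
  of integrals into a product.\<close>

lemma prekopa_leindler_bounded:
  fixes f g h :: "real \<Rightarrow> ennreal"
  assumes [measurable]: "f \<in> borel_measurable borel" "g \<in> borel_measurable borel" "h \<in> borel_measurable borel"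
    and f: "(SUP x. f x) = ennreal a" "a > 0" and g: "(SUP x. g x) = ennreal b" "b > 0"
    and le: "\<And>x y. f x * g y \<le> (h ((x + y) / 2)) ^ 2"
  shows "(\<integral>\<^sup>+x. f x \<partial>lborel) * (\<integral>\<^sup>+x. g x \<partial>lborel) \<le> (\<integral>\<^sup>+x. h x \<partial>lborel) ^ 2"
proof -
  define c where "c = sqrt (a * b)"
  have c: "c > 0" "c * c = a * b" using f g by (auto simp: c_def)
  have inv: "ennreal r * ennreal (1/r) = 1" if "r > 0" for r using that by (simp flip: ennreal_mult ennreal_1)
  let ?F = "\<lambda>x. ennreal (1/a) * f x" and ?G = "\<lambda>x. ennreal (1/b) * g x" and ?H = "\<lambda>x. ennreal (1/c) * h x"
  have "(\<integral>\<^sup>+x. ?F x \<partial>lborel) + (\<integral>\<^sup>+x. ?G x \<partial>lborel) \<le> 2 * (\<integral>\<^sup>+x. ?H x \<partial>lborel)"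
  proof (rule prekopa_leindler_normalized)
    show "(SUP x. ?F x) = 1" unfolding SUP_mult_left_ennreal[symmetric] using f inv[of a] by (simp add: mult.commute)
    show "(SUP x. ?G x) = 1" unfolding SUP_mult_left_ennreal[symmetric] using g inv[of b] by (simp add: mult.commute)
    fix x y
    have "?F x * ?G y = ennreal (1/a) * ennreal (1/b) * (f x * g y)" by (simp add: mult_ac)
    also have "ennreal (1/a) * ennreal (1/b) = ennreal (1/c) ^ 2"
      using f g c by (simp add: power2_eq_square flip: ennreal_mult)
    also have "\<dots> * (f x * g y) \<le> \<dots> * h ((x + y) / 2) ^ 2" by (intro mult_left_mono le) auto
    finally show "?F x * ?G y \<le> (?H ((x + y) / 2)) ^ 2" by (simp add: power_mult_distrib)
  qed measurable
  then have "(\<integral>\<^sup>+x. ?F x \<partial>lborel) * (\<integral>\<^sup>+x. ?G x \<partial>lborel) \<le> (\<integral>\<^sup>+x. ?H x \<partial>lborel) ^ 2"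
    by (rule ennreal_am_gm)
  then have "ennreal (a * b) * ((\<integral>\<^sup>+x. ?F x \<partial>lborel) * (\<integral>\<^sup>+x. ?G x \<partial>lborel)) \<le> ennreal (a * b) * (\<integral>\<^sup>+x. ?H x \<partial>lborel) ^ 2"
    by (rule mult_left_mono) auto
  moreover have "ennreal (a * b) * ((\<integral>\<^sup>+x. ?F x \<partial>lborel) * (\<integral>\<^sup>+x. ?G x \<partial>lborel))
     = (ennreal a * ennreal (1/a)) * (ennreal b * ennreal (1/b)) * ((\<integral>\<^sup>+x. f x \<partial>lborel) * (\<integral>\<^sup>+x. g x \<partial>lborel))"
    using f g by (subst (1 2) nn_integral_cmult) (simp_all add: ennreal_mult' mult_ac)
  moreover have "ennreal (a * b) * (\<integral>\<^sup>+x. ?H x \<partial>lborel) ^ 2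
     = (ennreal c * ennreal (1/c))^2 * (\<integral>\<^sup>+x. h x \<partial>lborel) ^ 2"
    using c by (subst nn_integral_cmult) (simp_all add: power_mult_distrib power2_eq_square mult_ac ennreal_mult' flip: c(2))
  ultimately show ?thesis using inv f g c by simp
qed

text \<open>Truncating f and g at n makes their suprema finite, while h may stay as it is. Zero
  integrals are split off: a nonzero integral ensures a positive supremum, and in the limit the
  product of 0 and \<infinity>, where multiplication is discontinuous, must be avoided.\<close>

lemma prekopa_leindler_1:
  fixes f g h :: "real \<Rightarrow> ennreal"
  assumes [measurable]: "f \<in> borel_measurable borel" "g \<in> borel_measurable borel" "h \<in> borel_measurable borel"
    and le: "\<And>x y. f x * g y \<le> (h ((x + y) / 2)) ^ 2"
  shows "(\<integral>\<^sup>+x. f x \<partial>lborel) * (\<integral>\<^sup>+x. g x \<partial>lborel) \<le> (\<integral>\<^sup>+x. h x \<partial>lborel) ^ 2"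
proof (cases "(\<integral>\<^sup>+x. f x \<partial>lborel) = 0 \<or> (\<integral>\<^sup>+x. g x \<partial>lborel) = 0")
  case True then show ?thesis by auto
next
  case False
  have lim: "(\<lambda>n. \<integral>\<^sup>+x. min (k x) (of_nat n) \<partial>lborel) \<longlonglongrightarrow> (\<integral>\<^sup>+x. k x \<partial>lborel)"
    if [measurable]: "k \<in> borel_measurable borel" for k :: "real \<Rightarrow> ennreal"
  proof (rule nn_integral_LIMSEQ)
    show "incseq (\<lambda>n x. min (k x) (of_nat n))"
      by (auto simp: incseq_def le_fun_def intro: min.coboundedI2)
    show "(\<lambda>n. min (k x) (of_nat n)) \<longlonglongrightarrow> k x" for x
    proof -
      have "(\<lambda>n. min (k x) (of_nat n)) \<longlonglongrightarrow> min (k x) top"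
        by (intro tendsto_min tendsto_const of_nat_tendsto_top_ennreal)
      then show ?thesis by simp
    qed
  qed measurable
  have sup: "\<exists>a>0. (SUP x. min (k x) (of_nat n)) = ennreal a"
    if "(\<integral>\<^sup>+x. min (k x) (of_nat n) \<partial>lborel) \<noteq> 0" for k :: "real \<Rightarrow> ennreal" and n
  proof -
    let ?s = "SUP x. min (k x) (of_nat n)"
    have "?s \<le> of_nat n" by (rule SUP_least) auto
    then have "?s \<noteq> top" using neq_top_trans[OF ennreal_of_nat_neq_top] by blast
    moreover have "?s \<noteq> 0"
    proof
      assume "?s = 0"
      then have "min (k x) (of_nat n) = 0" for x
        by (metis SUP_upper UNIV_I le_zero_eq)
      then have "(\<integral>\<^sup>+x. min (k x) (of_nat n) \<partial>lborel) = (\<integral>\<^sup>+x. 0 \<partial>(lborel :: real measure))" by (intro nn_integral_cong) auto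
      with that show False by simp
    qed
    ultimately show ?thesis
      by (cases ?s) (auto intro!: exI simp: order_less_le)
  qed
  have "(\<integral>\<^sup>+x. min (f x) (of_nat n) \<partial>lborel) * (\<integral>\<^sup>+x. min (g x) (of_nat n) \<partial>lborel) \<le> (\<integral>\<^sup>+x. h x \<partial>lborel) ^ 2" for n
  proof (cases "(\<integral>\<^sup>+x. min (f x) (of_nat n) \<partial>lborel) = 0 \<or> (\<integral>\<^sup>+x. min (g x) (of_nat n) \<partial>lborel) = 0")
    case True then show ?thesis by auto
  next
    case False
    then obtain a b where "a > 0" "(SUP x. min (f x) (of_nat n)) = ennreal a"
      "b > 0" "(SUP x. min (g x) (of_nat n)) = ennreal b"
      using sup by metis
    moreover have "min (f x) (of_nat n) * min (g y) (of_nat n) \<le> (h ((x + y) / 2))\<^sup>2" for x y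
      by (rule order.trans[OF mult_mono le]) auto
    ultimately show ?thesis by (intro prekopa_leindler_bounded[where a=a and b=b]) auto
  qed
  moreover have "(\<lambda>n. (\<integral>\<^sup>+x. min (f x) (of_nat n) \<partial>lborel) * (\<integral>\<^sup>+x. min (g x) (of_nat n) \<partial>lborel))
     \<longlonglongrightarrow> (\<integral>\<^sup>+x. f x \<partial>lborel) * (\<integral>\<^sup>+x. g x \<partial>lborel)"
    using False by (intro tendsto_mult_ennreal lim) auto
  ultimately show ?thesis by (intro LIMSEQ_le_const2) auto
qed

text \<open>For fixed x and y in the remaining coordinates, the one-dimensional inequality in
  coordinate i is precisely the hypothesis for the functions obtained by integrating that coordinate
  out.\<close>

lemma prekopa_leindler_PiM:
  fixes f g h :: "('i \<Rightarrow> real) \<Rightarrow> ennreal"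
  assumes "finite I"
    and "f \<in> borel_measurable (Pi\<^sub>M I (\<lambda>_. lborel))" "g \<in> borel_measurable (Pi\<^sub>M I (\<lambda>_. lborel))"
      "h \<in> borel_measurable (Pi\<^sub>M I (\<lambda>_. lborel))"
    and "\<And>x y. x \<in> extensional I \<Longrightarrow> y \<in> extensional I \<Longrightarrow> f x * g y \<le> (h (\<lambda>i\<in>I. (x i + y i) / 2)) ^ 2"
  shows "(\<integral>\<^sup>+x. f x \<partial>Pi\<^sub>M I (\<lambda>_. lborel)) * (\<integral>\<^sup>+x. g x \<partial>Pi\<^sub>M I (\<lambda>_. lborel)) \<le> (\<integral>\<^sup>+x. h x \<partial>Pi\<^sub>M I (\<lambda>_. lborel)) ^ 2"
  using assms
proof (induction I arbitrary: f g h rule: finite_induct)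
  case empty
  interpret product_sigma_finite "\<lambda>_. lborel :: real measure" by standard
  from empty.prems(4)[of "\<lambda>_. undefined" "\<lambda>_. undefined"] show ?case
    by (simp add: nn_integral_empty restrict_def)
next
  case (insert i I)
  interpret product_sigma_finite "\<lambda>_. lborel :: real measure" by standard
  note [measurable] = insert.prems(1-3)
  have upd [measurable]: "(\<lambda>(x, s). x(i := s)) \<in> (Pi\<^sub>M I (\<lambda>_. lborel) \<Otimes>\<^sub>M lborel) \<rightarrow>\<^sub>M Pi\<^sub>M (insert i I) (\<lambda>_. lborel)"
    by (rule measurable_add_dim)
  have m2: "(\<lambda>(x, s). k (x(i := s))) \<in> borel_measurable (Pi\<^sub>M I (\<lambda>_. lborel) \<Otimes>\<^sub>M lborel)"
    if "k \<in> borel_measurable (Pi\<^sub>M (insert i I) (\<lambda>_. lborel))" for k :: "('i \<Rightarrow> real) \<Rightarrow> ennreal"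
    using measurable_compose[OF upd that] by (simp add: case_prod_unfold)
  have m1: "(\<lambda>s. k (x(i := s))) \<in> borel_measurable lborel"
    if "k \<in> borel_measurable (Pi\<^sub>M (insert i I) (\<lambda>_. lborel))" "x \<in> extensional I" for k :: "('i \<Rightarrow> real) \<Rightarrow> ennreal" and x
  proof -
    have "x \<in> space (Pi\<^sub>M I (\<lambda>_. lborel))" using that by (auto simp: space_PiM PiE_def)
    from measurable_Pair2[OF m2[OF that(1)] this] show ?thesis by simp
  qed
  have m3: "(\<lambda>x. \<integral>\<^sup>+s. k (x(i := s)) \<partial>lborel) \<in> borel_measurable (Pi\<^sub>M I (\<lambda>_. lborel))"
    if "k \<in> borel_measurable (Pi\<^sub>M (insert i I) (\<lambda>_. lborel))" for k :: "('i \<Rightarrow> real) \<Rightarrow> ennreal"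
    using lborel.borel_measurable_nn_integral[OF m2[OF that]] by simp
  have "(\<integral>\<^sup>+s. f (x(i := s)) \<partial>lborel) * (\<integral>\<^sup>+s. g (y(i := s)) \<partial>lborel)
     \<le> (\<integral>\<^sup>+s. h ((\<lambda>i\<in>I. (x i + y i) / 2)(i := s)) \<partial>lborel) ^ 2"
    if xy: "x \<in> extensional I" "y \<in> extensional I" for x y
  proof (rule prekopa_leindler_1)
    show "f (x(i := s)) * g (y(i := t)) \<le> (h ((\<lambda>i\<in>I. (x i + y i) / 2)(i := (s + t) / 2)))\<^sup>2" for s t
    proof -
      have "(\<lambda>j\<in>insert i I. ((x(i := s)) j + (y(i := t)) j) / 2) = (\<lambda>i\<in>I. (x i + y i) / 2)(i := (s + t) / 2)"
        using insert.hyps by (auto simp: restrict_def)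
      moreover have "x(i := s) \<in> extensional (insert i I)" "y(i := t) \<in> extensional (insert i I)"
        using xy by (auto simp: extensional_def)
      ultimately show ?thesis using insert.prems(4)[of "x(i := s)" "y(i := t)"] by (simp only: simp_thms)
    qed
    show "(\<lambda>s. h ((\<lambda>i\<in>I. (x i + y i) / 2)(i := s))) \<in> borel_measurable borel"
      using m1[OF insert.prems(3), of "\<lambda>i\<in>I. (x i + y i) / 2"] by (simp del: fun_upd_apply)
    show "(\<lambda>s. f (x(i := s))) \<in> borel_measurable borel" "(\<lambda>s. g (y(i := s))) \<in> borel_measurable borel"
      using m1[OF insert.prems(1) xy(1)] m1[OF insert.prems(2) xy(2)] by (simp_all del: fun_upd_apply)
  qed
  note step = this
  show ?case
    unfolding product_nn_integral_insert[OF insert.hyps insert.prems(1)]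
      product_nn_integral_insert[OF insert.hyps insert.prems(2)]
      product_nn_integral_insert[OF insert.hyps insert.prems(3)]
    by (rule insert.IH[OF m3[OF insert.prems(1)] m3[OF insert.prems(2)] m3[OF insert.prems(3)] step])
qed

theorem prekopa_leindler:
  fixes f g h :: "'a::euclidean_space \<Rightarrow> ennreal"
  assumes [measurable]: "f \<in> borel_measurable borel" "g \<in> borel_measurable borel" "h \<in> borel_measurable borel"
    and le: "\<And>x y. f x * g y \<le> (h ((1/2) *\<^sub>R (x + y))) ^ 2"
  shows "(\<integral>\<^sup>+x. f x \<partial>lborel) * (\<integral>\<^sup>+x. g x \<partial>lborel) \<le> (\<integral>\<^sup>+x. h x \<partial>lborel) ^ 2"
proof -
  define T :: "('a \<Rightarrow> real) \<Rightarrow> 'a" where "T c = (\<Sum>b\<in>Basis. c b *\<^sub>R b)" for c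
  have T [measurable]: "T \<in> Pi\<^sub>M Basis (\<lambda>_. lborel) \<rightarrow>\<^sub>M borel"
    unfolding T_def by measurable
  have L: "(lborel :: 'a measure) = distr (Pi\<^sub>M Basis (\<lambda>_. lborel)) borel T"
    unfolding T_def by (rule lborel_eq)
  have eq: "(\<integral>\<^sup>+x. k x \<partial>lborel) = (\<integral>\<^sup>+c. k (T c) \<partial>Pi\<^sub>M Basis (\<lambda>_. lborel))"
    if [measurable]: "k \<in> borel_measurable borel" for k :: "'a \<Rightarrow> ennreal"
    by (subst L, rule nn_integral_distr[OF T]) (use that in simp)
  have "(\<integral>\<^sup>+c. f (T c) \<partial>Pi\<^sub>M Basis (\<lambda>_. lborel)) * (\<integral>\<^sup>+c. g (T c) \<partial>Pi\<^sub>M Basis (\<lambda>_. lborel))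
     \<le> (\<integral>\<^sup>+c. h (T c) \<partial>Pi\<^sub>M Basis (\<lambda>_. lborel)) ^ 2"
  proof (rule prekopa_leindler_PiM)
    fix x y :: "'a \<Rightarrow> real"
    have "T (\<lambda>i\<in>Basis. (x i + y i) / 2) = (1/2) *\<^sub>R (T x + T y)"
      by (simp add: T_def scaleR_add_left scaleR_add_right scaleR_sum_right add_divide_distrib sum.distrib)
    then show "f (T x) * g (T y) \<le> (h (T (\<lambda>i\<in>Basis. (x i + y i) / 2)))\<^sup>2" using le by metis
  qed auto
  then show ?thesis by (simp only: eq[OF assms(1)] eq[OF assms(2)] eq[OF assms(3)])
qed

section \<open>The equality case of the Brunn-Minkowski inequality\<close>

text \<open>
  If \<open>\<alpha>\<close> and \<open>\<beta>\<close> are the quantile functions of \<open>\<mu>\<close> and \<open>\<nu>\<close>, then \<open>(\<alpha> + \<beta>) / 2\<close> has distribution \<open>\<rho>\<close>, so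
  the last hypothesis is the equality case of the Cauchy-Schwarz inequality for \<open>exp (\<alpha>/2)\<close> and
  \<open>exp (\<beta>/2)\<close>. It forces \<open>\<beta> - \<alpha>\<close> to be constant.
\<close>

lemma midpoint_distribution_rigid:
  fixes \<mu> \<nu> \<rho> :: "real measure"
  assumes "real_distribution \<mu>" "real_distribution \<nu>" "real_distribution \<rho>"
    and atomless: "\<And>x. measure \<mu> {x} = 0" "\<And>x. measure \<nu> {x} = 0"
    and mid: "\<And>s t. cdf \<mu> s = cdf \<nu> t \<Longrightarrow> cdf \<rho> ((s + t) / 2) = cdf \<mu> s"
    and int: "integrable \<mu> exp" "integrable \<nu> exp" "integrable \<rho> exp"
    and le: "(\<integral>x. exp x \<partial>\<mu>) * (\<integral>x. exp x \<partial>\<nu>) \<le> (\<integral>x. exp x \<partial>\<rho>) ^ 2"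
  shows "\<exists>c. \<nu> = distr \<mu> borel (\<lambda>x. x + c)"
proof -
  interpret \<mu>: cdf_distribution \<mu> unfolding cdf_distribution_def by fact
  interpret \<nu>: cdf_distribution \<nu> unfolding cdf_distribution_def by fact
  interpret \<rho>: real_distribution \<rho> by fact
  define \<Omega> where "\<Omega> = (restrict_space lborel {0<..<1} :: real measure)"
  interpret \<Omega>: prob_space \<Omega>
    by (auto simp add: \<Omega>_def emeasure_restrict_space space_restrict_space intro!: prob_spaceI)
  define \<alpha> where "\<alpha> p = Inf {x. p \<le> cdf \<mu> x}" for p
  define \<beta> where "\<beta> p = Inf {x. p \<le> cdf \<nu> x}" for p
  have sp: "space \<Omega> = {0<..<1}" by (simp add: \<Omega>_def space_restrict_space)
  have meas: "(borel_measurable \<Omega> :: (real \<Rightarrow> real) set) = borel_measurable (restrict_space borel {0<..<1})"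
    unfolding \<Omega>_def by (intro measurable_cong_sets sets_restrict_space_cong) auto
  have [measurable]: "\<alpha> \<in> borel_measurable \<Omega>" "\<beta> \<in> borel_measurable \<Omega>"
    unfolding \<alpha>_def \<beta>_def meas by (rule \<mu>.measurable_CI \<nu>.measurable_CI)+
  have d\<alpha>: "distr \<Omega> borel \<alpha> = \<mu>" and d\<beta>: "distr \<Omega> borel \<beta> = \<nu>"
    unfolding \<Omega>_def \<alpha>_def \<beta>_def by (rule \<mu>.distr_I_eq_M \<nu>.distr_I_eq_M)+
  \<comment> \<open>Without atoms the distribution function is continuous, so at the quantile it
    takes the value p itself and not merely some value above p.\<close>
  have quantile: "cdf M (Inf {x. p \<le> cdf M x}) = p"
    if M: "real_distribution M" "\<And>x. measure M {x} = 0" and p: "0 < p" "p < 1" for M p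
  proof -
    interpret M: cdf_distribution M unfolding cdf_distribution_def by fact
    let ?q = "Inf {x. p \<le> cdf M x}"
    have q: "p \<le> cdf M x \<longleftrightarrow> ?q \<le> x" for x using M.pseudoinverse[OF p] .
    have "isCont (cdf M) ?q" using M(2) by (simp add: M.isCont_cdf)
    then have lim: "(cdf M \<longlongrightarrow> cdf M ?q) (at_left ?q)"
      unfolding isCont_def by (rule filterlim_at_split[THEN iffD1, THEN conjunct1])
    have "cdf M ?q \<le> p"
    proof (rule tendsto_upperbound[OF lim])
      show "\<forall>\<^sub>F x in at_left ?q. cdf M x \<le> p"
      proof (rule eventually_at_leftI[of "?q - 1"])
        fix x assume "x \<in> {?q - 1<..<?q}"
        then show "cdf M x \<le> p" using q[of x] by auto
      qed simp
    qed simp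
    then show ?thesis using q[of ?q] by simp
  qed
  define \<eta> where "\<eta> p = (\<alpha> p + \<beta> p) / 2" for p
  have [measurable]: "\<eta> \<in> borel_measurable \<Omega>" unfolding \<eta>_def by measurable
  have \<eta>: "cdf \<rho> (\<eta> p) = p" if "0 < p" "p < 1" for p
  proof -
    have "cdf \<mu> (\<alpha> p) = p" "cdf \<nu> (\<beta> p) = p" unfolding \<alpha>_def \<beta>_def using that assms(1,2,4,5) quantile by blast+
    then show ?thesis using mid[of "\<alpha> p" "\<beta> p"] by (simp add: \<eta>_def)
  qed
  \<comment> \<open>Since \<open>cdf \<rho>\<close> inverts \<eta>, the set of all p with \<eta> p
    \<le> x lies between the open and the closed interval from 0 to \<open>cdf \<rho> x\<close>, and
    so has that length.\<close>
  have d\<eta>: "distr \<Omega> borel \<eta> = \<rho>"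
  proof (rule cdf_unique)
    show "real_distribution (distr \<Omega> borel \<eta>)" by (rule \<Omega>.real_distribution_distr) measurable
    show "cdf (distr \<Omega> borel \<eta>) = cdf \<rho>"
    proof
      fix x
      let ?r = "cdf \<rho> x"
      have r: "0 \<le> ?r" "?r \<le> 1" using \<rho>.cdf_nonneg \<rho>.cdf_bounded_prob by auto
      have "cdf (distr \<Omega> borel \<eta>) x = measure \<Omega> {p \<in> space \<Omega>. \<eta> p \<le> x}"
        by (subst cdf_def, subst measure_distr) (auto intro!: arg_cong2[where f = measure])
      also have "\<dots> = measure lborel {p \<in> {0<..<1}. \<eta> p \<le> x}"
        by (simp only: sp, simp only: \<Omega>_def, rule measure_restrict_space) auto
      finally have eq: "cdf (distr \<Omega> borel \<eta>) x = measure lborel {p \<in> {0<..<1}. \<eta> p \<le> x}" .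
      have sets: "{p \<in> {0<..<1}. \<eta> p \<le> x} \<in> sets lborel"
      proof -
        have "{p \<in> space \<Omega>. \<eta> p \<le> x} \<in> sets \<Omega>" by measurable
        then show ?thesis unfolding sp by (auto simp: \<Omega>_def sets_restrict_space_iff)
      qed
      have fin: "{p \<in> {0<..<1}. \<eta> p \<le> x} \<in> fmeasurable lborel"
        by (rule fmeasurableI2[OF fmeasurable_compact[OF compact_Icc[of 0 1]]]) (use sets in auto)
      have sub1: "{0<..<?r} \<subseteq> {p \<in> {0<..<1}. \<eta> p \<le> x}"
      proof
        fix p assume "p \<in> {0<..<?r}"
        then have p: "0 < p" "p < 1" "p < ?r" using r by auto
        then have "cdf \<rho> (\<eta> p) < cdf \<rho> x" using \<eta> by simp
        then have "\<eta> p \<le> x" using \<rho>.cdf_nondecreasing[of x "\<eta> p"] by linarith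
        then show "p \<in> {p \<in> {0<..<1}. \<eta> p \<le> x}" using p by simp
      qed
      have sub2: "{p \<in> {0<..<1}. \<eta> p \<le> x} \<subseteq> {0..?r}"
        using \<eta> \<rho>.cdf_nondecreasing by fastforce
      have "measure lborel {0<..<?r} \<le> measure lborel {p \<in> {0<..<1}. \<eta> p \<le> x}"
        by (rule measure_mono_fmeasurable[OF sub1 _ fin]) auto
      moreover have "measure lborel {p \<in> {0<..<1}. \<eta> p \<le> x} \<le> measure lborel {0..?r}"
        by (rule measure_mono_fmeasurable[OF sub2 sets]) (rule fmeasurable_compact[OF compact_Icc])
      ultimately show "cdf (distr \<Omega> borel \<eta>) x = ?r" using eq r by simp
    qed
  qed fact
  let ?a = "\<integral>x. exp x \<partial>\<mu>" and ?b = "\<integral>x. exp x \<partial>\<nu>" and ?c = "\<integral>x. exp x \<partial>\<rho>"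
  have a: "integrable \<Omega> (\<lambda>p. exp (\<alpha> p))" "(\<integral>p. exp (\<alpha> p) \<partial>\<Omega>) = ?a"
    using int(1) by (simp_all add: d\<alpha>[symmetric] integrable_distr_eq integral_distr)
  have b: "integrable \<Omega> (\<lambda>p. exp (\<beta> p))" "(\<integral>p. exp (\<beta> p) \<partial>\<Omega>) = ?b"
    using int(2) by (simp_all add: d\<beta>[symmetric] integrable_distr_eq integral_distr)
  have c: "integrable \<Omega> (\<lambda>p. exp (\<eta> p))" "(\<integral>p. exp (\<eta> p) \<partial>\<Omega>) = ?c"
    using int(3) by (simp_all add: d\<eta>[symmetric] integrable_distr_eq integral_distr)
  have pos: "0 < (\<integral>x. exp x \<partial>M)" if "real_distribution M" "integrable M exp" for M :: "real measure"
  proof -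
    interpret M: real_distribution M by fact
    show ?thesis
      using that(2) M.not_empty M.emeasure_space_1 integral_nonneg_eq_0_iff_AE[OF that(2)]
      by (auto simp: order_less_le)
  qed
  have ap: "0 < ?a" and bp: "0 < ?b" and cp: "0 < ?c" using assms by (auto intro!: pos)
  \<comment> \<open>The weights are those for which the square below has integral
    \<open>2 * (?a * ?b) - 2 * sqrt (?a * ?b) * ?c\<close>. This is not positive by hypothesis, so
    the square vanishes almost everywhere, and the ratio of exp (\<beta>/2) to exp (\<alpha>/2) is
    constant.\<close>
  define F where "F p = ?b * exp (\<alpha> p) + ?a * exp (\<beta> p) - 2 * sqrt (?a * ?b) * exp (\<eta> p)" for p
  have F: "F p = (sqrt ?b * exp (\<alpha> p / 2) - sqrt ?a * exp (\<beta> p / 2)) ^ 2" for p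
  proof -
    have "exp (\<eta> p) = exp (\<alpha> p / 2) * exp (\<beta> p / 2)" by (simp add: \<eta>_def add_divide_distrib exp_add)
    moreover have "exp (\<alpha> p) = exp (\<alpha> p / 2) ^ 2" "exp (\<beta> p) = exp (\<beta> p / 2) ^ 2" by (simp_all flip: exp_double)
    ultimately show ?thesis using ap bp by (simp add: F_def power2_diff power_mult_distrib real_sqrt_mult)
  qed
  have intF: "integrable \<Omega> F" unfolding F_def using a b c by auto
  have "(\<integral>p. F p \<partial>\<Omega>) = 2 * (?a * ?b) - 2 * sqrt (?a * ?b) * ?c"
    unfolding F_def using a b c by simp
  also have "\<dots> \<le> 0"
  proof -
    have "sqrt (?a * ?b) \<le> ?c" using le cp by (simp add: real_le_lsqrt)
    then have "sqrt (?a * ?b) * sqrt (?a * ?b) \<le> sqrt (?a * ?b) * ?c" using ap bp by (intro mult_left_mono) auto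
    then show ?thesis using ap bp by simp
  qed
  finally have "(\<integral>p. F p \<partial>\<Omega>) \<le> 0" .
  moreover have F0: "0 \<le> F p" for p unfolding F by simp
  then have "0 \<le> (\<integral>p. F p \<partial>\<Omega>)" by (intro Bochner_Integration.integral_nonneg)
  ultimately have "(\<integral>p. F p \<partial>\<Omega>) = 0" by linarith
  then have "AE p in \<Omega>. F p = 0" using integral_nonneg_eq_0_iff_AE[OF intF] F0 by simp
  moreover define d where "d = ln ?b - ln ?a"
  have "\<beta> p = \<alpha> p + d" if "F p = 0" for p
  proof -
    have "sqrt ?b * exp (\<alpha> p / 2) = sqrt ?a * exp (\<beta> p / 2)" using that F by simp
    then have "ln (sqrt ?b * exp (\<alpha> p / 2)) = ln (sqrt ?a * exp (\<beta> p / 2))" by simp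
    then show ?thesis using ap bp by (simp add: ln_mult ln_sqrt d_def)
  qed
  ultimately have AE: "AE p in \<Omega>. \<beta> p = \<alpha> p + d" by (auto elim!: eventually_mono)
  have "\<nu> = distr \<Omega> borel (\<lambda>p. \<alpha> p + d)"
    unfolding d\<beta>[symmetric] by (rule distr_cong_AE) (use AE in auto)
  also have "\<dots> = distr (distr \<Omega> borel \<alpha>) borel (\<lambda>x. x + d)"
    by (subst distr_distr) (auto simp: comp_def)
  finally show ?thesis unfolding d\<alpha> by blast
qed

lemma brunn_minkowski_midpoint:
  fixes A B M :: "'a::euclidean_space set"
  assumes [measurable]: "A \<in> sets borel" "B \<in> sets borel" "M \<in> sets borel"
    and mid: "\<And>x y. x \<in> A \<Longrightarrow> y \<in> B \<Longrightarrow> (1/2) *\<^sub>R (x + y) \<in> M"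
  shows "emeasure lborel A * emeasure lborel B \<le> emeasure lborel M ^ 2"
proof -
  have "(\<integral>\<^sup>+x. indicator A x \<partial>lborel) * (\<integral>\<^sup>+x. indicator B x \<partial>lborel) \<le> (\<integral>\<^sup>+x. indicator M x \<partial>lborel) ^ 2"
    by (rule prekopa_leindler) (auto split: split_indicator dest: mid)
  then show ?thesis by simp
qed

section \<open>Projections of the uniform distribution on a compact set to a line\<close>

definition projected_uniform :: "'a::euclidean_space set \<Rightarrow> 'a \<Rightarrow> real measure" where
  "projected_uniform X u = distr (uniform_measure lborel X) borel (\<lambda>x. u \<bullet> x)"

context
  fixes X :: "'a::euclidean_space set"
  assumes X: "compact X" "measure lborel X > 0"
begin

lemma emeasure_compact_pos: "emeasure lborel X \<noteq> 0" "emeasure lborel X \<noteq> \<infinity>"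
  using X emeasure_compact_finite[OF X(1)] by (auto simp: measure_def)

lemma sets_compact_borel [measurable]: "X \<in> sets borel"
  using X by (simp add: compact_imp_closed)

lemma prob_space_uniform: "prob_space (uniform_measure lborel X)"
  by (rule prob_space_uniform_measure) (use emeasure_compact_pos in auto)

lemma real_distribution_projected: "real_distribution (projected_uniform X u)"
  unfolding projected_uniform_def
  by (intro prob_space.real_distribution_distr prob_space_uniform) simp

lemma measure_projected:
  assumes [measurable]: "S \<in> sets borel"
  shows "measure (projected_uniform X u) S = measure lborel (X \<inter> {x. u \<bullet> x \<in> S}) / measure lborel X"
proof -
  have "measure (projected_uniform X u) S = measure (uniform_measure lborel X) {x. u \<bullet> x \<in> S}"
    unfolding projected_uniform_def by (subst measure_distr) (auto simp: vimage_def)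
  also have "\<dots> = measure lborel (X \<inter> {x. u \<bullet> x \<in> S}) / measure lborel X"
    by (rule measure_uniform_measure) (use emeasure_compact_pos in \<open>auto\<close>)
  finally show ?thesis .
qed

lemma projected_atomless:
  assumes "u \<noteq> 0" shows "measure (projected_uniform X u) {y} = 0"
proof -
  have "negligible (X \<inter> {x. u \<bullet> x = y})"
    using negligible_hyperplane[of u y] assms by (meson negligible_Int inf_le2 negligible_subset)
  then have "emeasure lebesgue (X \<inter> {x. u \<bullet> x = y}) = 0"
    by (simp add: negligible_iff_null_sets null_setsD1)
  then have "measure lborel (X \<inter> {x. u \<bullet> x = y}) = 0"
    by (simp add: measure_def)
  then show ?thesis by (simp add: measure_projected)
qed

lemma uniform_integrable:
  fixes f :: "'a \<Rightarrow> 'b::euclidean_space"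
  assumes [measurable]: "f \<in> borel_measurable borel" and "continuous_on X f"
  shows "integrable (uniform_measure lborel X) f"
proof -
  interpret prob_space "uniform_measure lborel X" by (rule prob_space_uniform)
  have "bounded (f ` X)" using X assms by (intro compact_imp_bounded compact_continuous_image)
  then obtain K where K: "\<And>x. x \<in> X \<Longrightarrow> norm (f x) \<le> K" unfolding bounded_iff by auto
  show ?thesis
    by (rule integrable_const_bound[of _ K]) (auto intro!: AE_uniform_measureI K)
qed

lemma projected_integrable:
  fixes f :: "real \<Rightarrow> real"
  assumes "continuous_on UNIV f"
  shows "integrable (projected_uniform X u) f"
proof -
  have [measurable]: "f \<in> borel_measurable borel" using assms by (rule borel_measurable_continuous_onI)
  have "continuous_on X (\<lambda>x. f (u \<bullet> x))"
    by (rule continuous_on_compose2[OF assms]) (auto intro!: continuous_intros)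
  then show ?thesis
    unfolding projected_uniform_def by (subst integrable_distr_eq) (auto intro!: uniform_integrable)
qed

lemma nn_integral_projected:
  fixes f :: "real \<Rightarrow> real"
  assumes "continuous_on UNIV f" and pos: "\<And>x. 0 \<le> f x"
  shows "(\<integral>\<^sup>+x. ennreal (f (u \<bullet> x)) * indicator X x \<partial>lborel) = ennreal (measure lborel X * (\<integral>y. f y \<partial>projected_uniform X u))"
proof -
  have [measurable]: "f \<in> borel_measurable borel" using assms(1) by (rule borel_measurable_continuous_onI)
  have "ennreal (\<integral>y. f y \<partial>projected_uniform X u) = (\<integral>\<^sup>+y. ennreal (f y) \<partial>projected_uniform X u)"
    using projected_integrable[OF assms(1)] pos by (simp add: nn_integral_eq_integral)
  also have "\<dots> = (\<integral>\<^sup>+x. ennreal (f (u \<bullet> x)) \<partial>uniform_measure lborel X)"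
    unfolding projected_uniform_def by (subst nn_integral_distr) auto
  also have "\<dots> = (\<integral>\<^sup>+x. ennreal (f (u \<bullet> x)) * indicator X x \<partial>lborel) / emeasure lborel X"
    by (rule nn_integral_uniform_measure) auto
  finally have "ennreal (\<integral>y. f y \<partial>projected_uniform X u) * emeasure lborel X
      = (\<integral>\<^sup>+x. ennreal (f (u \<bullet> x)) * indicator X x \<partial>lborel) * (emeasure lborel X / emeasure lborel X)"
    by (simp add: ennreal_divide_times)
  also have "emeasure lborel X / emeasure lborel X = 1"
    using emeasure_compact_pos by (intro ennreal_divide_self) (auto simp: less_top)
  finally show ?thesis
    using emeasure_compact_pos(2) by (simp add: emeasure_eq_ennreal_measure ennreal_mult' mult.commute)
qed

lemma projected_mean:
  "(\<integral>y. y \<partial>projected_uniform X u) = u \<bullet> (\<integral>x. x \<partial>uniform_measure lborel X)"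
proof -
  have "(\<integral>y. y \<partial>projected_uniform X u) = (\<integral>x. u \<bullet> x \<partial>uniform_measure lborel X)"
    unfolding projected_uniform_def by (subst integral_distr) auto
  also have "\<dots> = u \<bullet> (\<integral>x. x \<partial>uniform_measure lborel X)"
    by (rule integral_inner_right) (auto intro!: uniform_integrable continuous_intros)
  finally show ?thesis .
qed

end

text \<open>
  Each projection of the uniform distribution on \<open>B\<close> to a line is a translate of that on \<open>A\<close>. The
  translations are given by the difference \<open>c\<close> of the barycentres, so no half-space can separate a point of
  \<open>A + c\<close> from \<open>B\<close>.
\<close>

theorem brunn_minkowski_equality:
  fixes A B M :: "'a::euclidean_space set"
  assumes A: "compact A" "convex A" and B: "compact B" "convex B" and M: "compact M"
    and mid: "\<And>x y. x \<in> A \<Longrightarrow> y \<in> B \<Longrightarrow> (1/2) *\<^sub>R (x + y) \<in> M"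
    and pos: "measure lborel A > 0"
    and eq: "measure lborel B = measure lborel A" "measure lborel M = measure lborel A"
  shows "\<exists>c. B = (\<lambda>x. x + c) ` A"
proof -
  have posB: "measure lborel B > 0" and posM: "measure lborel M > 0" using pos eq by auto
  note [measurable] = sets_compact_borel[OF A(1) pos] sets_compact_borel[OF B(1) posB] sets_compact_borel[OF M posM]
  define V where "V = measure lborel A"
  have V: "V > 0" "measure lborel A = V" "measure lborel B = V" "measure lborel M = V" using pos eq by (auto simp: V_def)
  define gA where "gA = (\<integral>x. x \<partial>uniform_measure lborel A)"
  define gB where "gB = (\<integral>x. x \<partial>uniform_measure lborel B)"
  define c where "c = gB - gA"
  have fmA: "A \<in> fmeasurable lborel" and fmB: "B \<in> fmeasurable lborel" and fmM: "M \<in> fmeasurable lborel"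
    using A B M by (auto intro: fmeasurable_compact)
  have em: "emeasure lborel X = ennreal (measure lborel X)" if "X \<in> fmeasurable lborel" for X :: "'a set"
    using that by (simp add: emeasure_eq_measure2)
  have cuts: "measure lborel (A \<inter> {x. u \<bullet> x \<in> I}) \<le> measure lborel (M \<inter> {x. u \<bullet> x \<in> K})"
    if same: "measure lborel (A \<inter> {x. u \<bullet> x \<in> I}) = measure lborel (B \<inter> {x. u \<bullet> x \<in> J})"
      and IJK: "\<And>s t. s \<in> I \<Longrightarrow> t \<in> J \<Longrightarrow> (s + t) / 2 \<in> K"
      and [measurable]: "I \<in> sets borel" "J \<in> sets borel" "K \<in> sets borel"
    for u and I J K :: "real set"
  proof -
    have f: "A \<inter> {x. u \<bullet> x \<in> I} \<in> fmeasurable lborel" "B \<inter> {x. u \<bullet> x \<in> J} \<in> fmeasurable lborel"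
      "M \<inter> {x. u \<bullet> x \<in> K} \<in> fmeasurable lborel"
      by (rule fmeasurable_Int_fmeasurable[OF fmA] fmeasurable_Int_fmeasurable[OF fmB] fmeasurable_Int_fmeasurable[OF fmM]; simp)+
    have "emeasure lborel (A \<inter> {x. u \<bullet> x \<in> I}) * emeasure lborel (B \<inter> {x. u \<bullet> x \<in> J}) \<le> emeasure lborel (M \<inter> {x. u \<bullet> x \<in> K}) ^ 2"
    proof (rule brunn_minkowski_midpoint)
      fix x y assume "x \<in> A \<inter> {x. u \<bullet> x \<in> I}" "y \<in> B \<inter> {x. u \<bullet> x \<in> J}"
      then show "(1/2) *\<^sub>R (x + y) \<in> M \<inter> {x. u \<bullet> x \<in> K}"
        using mid[of x y] IJK[of "u \<bullet> x" "u \<bullet> y"] by (simp add: inner_add_right)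
    qed measurable
    then have "measure lborel (A \<inter> {x. u \<bullet> x \<in> I}) ^ 2 \<le> measure lborel (M \<inter> {x. u \<bullet> x \<in> K}) ^ 2"
      unfolding em[OF f(1)] em[OF f(2)] em[OF f(3)] same[symmetric]
      by (simp add: power2_eq_square flip: ennreal_mult)
    then show ?thesis by (rule power2_le_imp_le) simp
  qed
  have split: "measure lborel (X \<inter> {x. u \<bullet> x \<in> {..s}}) + measure lborel (X \<inter> {x. u \<bullet> x \<in> {s<..}}) = measure lborel X"
    if "X \<in> fmeasurable lborel" for X :: "'a set" and u s
  proof -
    have "X = (X \<inter> {x. u \<bullet> x \<in> {..s}}) \<union> (X \<inter> {x. u \<bullet> x \<in> {s<..}})" by auto
    moreover have "measure lborel ((X \<inter> {x. u \<bullet> x \<in> {..s}}) \<union> (X \<inter> {x. u \<bullet> x \<in> {s<..}}))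
       = measure lborel (X \<inter> {x. u \<bullet> x \<in> {..s}}) + measure lborel (X \<inter> {x. u \<bullet> x \<in> {s<..}})"
    proof (rule measure_Union)
      have "X \<inter> {x. u \<bullet> x \<in> {..s}} \<in> fmeasurable lborel" "X \<inter> {x. u \<bullet> x \<in> {s<..}} \<in> fmeasurable lborel"
        by (rule fmeasurable_Int_fmeasurable[OF that]; simp)+
      then show "emeasure lborel (X \<inter> {x. u \<bullet> x \<in> {..s}}) \<noteq> \<infinity>" "emeasure lborel (X \<inter> {x. u \<bullet> x \<in> {s<..}}) \<noteq> \<infinity>"
        "X \<inter> {x. u \<bullet> x \<in> {..s}} \<in> sets lborel" "X \<inter> {x. u \<bullet> x \<in> {s<..}} \<in> sets lborel"
        by (auto simp: fmeasurable_def)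
    qed auto
    ultimately show ?thesis by simp
  qed
  have shift: "projected_uniform B u = distr (projected_uniform A u) borel (\<lambda>y. y + u \<bullet> c)" if u: "u \<noteq> 0" for u
  proof -
    let ?A = "projected_uniform A u" and ?B = "projected_uniform B u" and ?M = "projected_uniform M u"
    have "\<exists>d. ?B = distr ?A borel (\<lambda>y. y + d)"
    proof (rule midpoint_distribution_rigid)
      show "real_distribution ?A" "real_distribution ?B" "real_distribution ?M"
        using real_distribution_projected A B M pos posB posM by auto
      show "measure ?A {x} = 0" "measure ?B {x} = 0" for x
        using projected_atomless[OF A(1) pos u] projected_atomless[OF B(1) posB u] by auto
      have ec: "continuous_on UNIV (exp :: real \<Rightarrow> real)" by (rule continuous_on_exp[OF continuous_on_id])
      show "integrable ?A exp" "integrable ?B exp" "integrable ?M exp"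
        by (rule projected_integrable[OF A(1) pos ec] projected_integrable[OF B(1) posB ec] projected_integrable[OF M posM ec])+
      have "(\<integral>\<^sup>+x. ennreal (exp (u \<bullet> x)) * indicator A x \<partial>lborel) * (\<integral>\<^sup>+x. ennreal (exp (u \<bullet> x)) * indicator B x \<partial>lborel)
         \<le> (\<integral>\<^sup>+x. ennreal (exp (u \<bullet> x)) * indicator M x \<partial>lborel) ^ 2"
      \<comment> \<open>The weight exp (u \<bullet> x) is log-affine, so on A and B the hypothesis
        of the Prekopa-Leindler inequality holds with equality. After division by the volumes the
        conclusion is the last assumption of \<open>midpoint_distribution_rigid\<close>.\<close>
      proof (rule prekopa_leindler)
        fix x y
        have "exp (u \<bullet> x) * exp (u \<bullet> y) = exp (u \<bullet> ((1/2) *\<^sub>R (x + y))) ^ 2"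
          by (simp add: inner_add_right flip: exp_add exp_double)
        then show "ennreal (exp (u \<bullet> x)) * indicator A x * (ennreal (exp (u \<bullet> y)) * indicator B y)
           \<le> (ennreal (exp (u \<bullet> ((1/2) *\<^sub>R (x + y)))) * indicator M ((1/2) *\<^sub>R (x + y))) ^ 2"
          using mid[of x y] by (auto split: split_indicator simp: ennreal_power simp flip: ennreal_mult)
      qed measurable
      then have "ennreal (V * (\<integral>y. exp y \<partial>?A)) * ennreal (V * (\<integral>y. exp y \<partial>?B)) \<le> ennreal (V * (\<integral>y. exp y \<partial>?M)) ^ 2"
        using nn_integral_projected[OF A(1) pos ec] nn_integral_projected[OF B(1) posB ec] nn_integral_projected[OF M posM ec]
        by (simp add: V)
      then have "(V * (\<integral>y. exp y \<partial>?A)) * (V * (\<integral>y. exp y \<partial>?B)) \<le> (V * (\<integral>y. exp y \<partial>?M)) ^ 2"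
        using V by (simp add: ennreal_power flip: ennreal_mult)
      then have "V^2 * ((\<integral>y. exp y \<partial>?A) * (\<integral>y. exp y \<partial>?B)) \<le> V^2 * (\<integral>y. exp y \<partial>?M) ^ 2"
        by (simp add: power2_eq_square mult_ac)
      then show "(\<integral>y. exp y \<partial>?A) * (\<integral>y. exp y \<partial>?B) \<le> (\<integral>y. exp y \<partial>?M) ^ 2"
        using V by simp
      fix s t assume "cdf ?A s = cdf ?B t"
      then have st: "measure lborel (A \<inter> {x. u \<bullet> x \<in> {..s}}) = measure lborel (B \<inter> {x. u \<bullet> x \<in> {..t}})"
        using V unfolding cdf_def by (simp add: measure_projected A B pos posB)
      have "measure lborel (A \<inter> {x. u \<bullet> x \<in> {..s}}) \<le> measure lborel (M \<inter> {x. u \<bullet> x \<in> {..(s + t)/2}})"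
        by (rule cuts[OF st]) auto
      moreover have "measure lborel (A \<inter> {x. u \<bullet> x \<in> {s<..}}) \<le> measure lborel (M \<inter> {x. u \<bullet> x \<in> {(s + t)/2<..}})"
      proof (rule cuts)
        show "measure lborel (A \<inter> {x. u \<bullet> x \<in> {s<..}}) = measure lborel (B \<inter> {x. u \<bullet> x \<in> {t<..}})"
          using split[OF fmA, of u s] split[OF fmB, of u t] st V by linarith
      qed auto
      \<comment> \<open>The parts of M below and above the midpoint level are at least as large as
        the corresponding parts of A, and the totals agree; hence both inequalities are
        equalities.\<close>
      ultimately have "measure lborel (M \<inter> {x. u \<bullet> x \<in> {..(s + t)/2}}) = measure lborel (A \<inter> {x. u \<bullet> x \<in> {..s}})"
        using split[OF fmA, of u s] split[OF fmM, of u "(s + t)/2"] V by linarith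
      then show "cdf ?M ((s + t) / 2) = cdf ?A s"
        unfolding cdf_def by (simp only: measure_projected[OF A(1) pos] measure_projected[OF M posM] atMost_borel V)
    qed
    then obtain d where d: "?B = distr ?A borel (\<lambda>y. y + d)" by blast
    interpret A: real_distribution ?A by (rule real_distribution_projected[OF A(1) pos])
    \<comment> \<open>So far d depends on u in an unknown way. Comparing the means shows that it is
      linear in u, with the same vector c for all directions.\<close>
    have "u \<bullet> gB = (\<integral>y. y \<partial>?B)" by (simp add: gB_def projected_mean[OF B(1) posB])
    also have "\<dots> = (\<integral>y. y + d \<partial>?A)" unfolding d by (subst integral_distr) auto
    also have "\<dots> = (\<integral>y. y \<partial>?A) + d"
      using projected_integrable[OF A(1) pos continuous_on_id] A.prob_space by (subst Bochner_Integration.integral_add) auto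
    also have "\<dots> = u \<bullet> gA + d" by (simp add: gA_def projected_mean[OF A(1) pos])
    finally have "d = u \<bullet> c" by (simp add: c_def inner_diff_right)
    with d show ?thesis by simp
  qed
  have meas_shift: "measure lborel (B \<inter> {x. u \<bullet> x \<in> {s + u \<bullet> c<..}}) = measure lborel (A \<inter> {x. u \<bullet> x \<in> {s<..}})" if "u \<noteq> 0" for u s
  proof -
    have "measure (projected_uniform B u) {s + u \<bullet> c<..} = measure (projected_uniform A u) {s<..}"
    proof -
      interpret A: real_distribution "projected_uniform A u" by (rule real_distribution_projected[OF A(1) pos])
      have "(\<lambda>y. y + u \<bullet> c) -` {s + u \<bullet> c<..} = {s<..}" by auto
      then show ?thesis unfolding shift[OF that] by (subst measure_distr) auto
    qed
    then show ?thesis using V by (simp add: measure_projected A B pos posB)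
  qed
  \<comment> \<open>The point x may lie on the boundary of X, but a convex body is the closure of
    its interior, so the open half-space around x also contains interior points.\<close>
  have halfspace_pos: "measure lborel (X \<inter> {x. u \<bullet> x \<in> {s<..}}) > 0"
    if X: "compact X" "convex X" "measure lborel X > 0" and x: "x \<in> X" "u \<bullet> x > s" for X u s and x :: 'a
  proof -
    have "\<not> negligible X"
    proof
      assume "negligible X"
      then have "emeasure lebesgue X = 0" by (simp add: negligible_iff_null_sets null_setsD1)
      then have "measure lborel X = 0" using sets_compact_borel[OF X(1,3)] by (simp add: measure_def)
      with X(3) show False by simp
    qed
    then have "interior X \<noteq> {}" using negligible_convex_interior[OF X(2)] by simp
    then have "closure (interior X) = X"
      using convex_closure_interior[OF X(2)] compact_imp_closed[OF X(1)] by simp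
    then have "x \<in> closure (interior X)" using x by simp
    moreover have o: "open {x. u \<bullet> x > s}" by (simp add: open_halfspace_gt)
    ultimately have ne: "interior X \<inter> {x. u \<bullet> x > s} \<noteq> {}"
      using x(2) open_Int_closure_eq_empty[OF o, of "interior X"] by auto
    have fm: "X \<inter> {x. u \<bullet> x \<in> {s<..}} \<in> fmeasurable lborel"
      using X(1) by (intro fmeasurable_Int_fmeasurable fmeasurable_compact) auto
    have "open (interior X \<inter> {x. u \<bullet> x > s})" using o by auto
    then have "\<not> negligible (interior X \<inter> {x. u \<bullet> x > s})" using ne open_not_negligible by blast
    then have nn: "\<not> negligible (X \<inter> {x. u \<bullet> x \<in> {s<..}})"
      using negligible_subset[of "X \<inter> {x. u \<bullet> x \<in> {s<..}}" "interior X \<inter> {x. u \<bullet> x > s}"] interior_subset[of X] by auto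
    have "measure lborel (X \<inter> {x. u \<bullet> x \<in> {s<..}}) \<noteq> 0"
    proof
      assume "measure lborel (X \<inter> {x. u \<bullet> x \<in> {s<..}}) = 0"
      then have "X \<inter> {x. u \<bullet> x \<in> {s<..}} \<in> null_sets lborel"
        using emeasure_eq_measure2[OF fm] fmeasurableD[OF fm] by (intro null_setsI) auto
      then show False using nn unfolding negligible_iff_null_sets by (meson null_sets_completionI)
    qed
    then show ?thesis by (simp add: order_less_le)
  qed
  have empty0: "measure lborel (X \<inter> {x. u \<bullet> x \<in> {s<..}}) = 0" if "\<forall>x\<in>X. u \<bullet> x \<le> s" for X :: "'a set" and u s
  proof -
    have "X \<inter> {x. u \<bullet> x \<in> {s<..}} = {}" using that by auto
    then show ?thesis by simp
  qed
  have sep: "\<exists>u s. u \<noteq> 0 \<and> (\<forall>x\<in>X. u \<bullet> x \<le> s) \<and> u \<bullet> z > s" if X: "compact X" "convex X" "z \<notin> X" "X \<noteq> {}" for X and z :: 'a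
  proof -
    obtain a b where ab: "a \<bullet> z < b" "\<forall>x\<in>X. b < a \<bullet> x"
      using separating_hyperplane_closed_point[OF X(2) compact_imp_closed[OF X(1)] X(3)] by blast
    then have "a \<noteq> 0" using X(4) by fastforce
    then show ?thesis using ab by (intro exI[of _ "- a"] exI[of _ "- b"]) (auto intro: less_imp_le)
  qed
  have ne: "A \<noteq> {}" "B \<noteq> {}" using pos posB by auto
  have "x + c \<in> B" if x: "x \<in> A" for x
  proof (rule ccontr)
    assume "x + c \<notin> B"
    then obtain u s where us: "u \<noteq> 0" "\<forall>x\<in>B. u \<bullet> x \<le> s" "u \<bullet> (x + c) > s" using sep[OF B] ne by blast
    then have "measure lborel (A \<inter> {x. u \<bullet> x \<in> {s - u \<bullet> c<..}}) > 0"
      using A pos x by (intro halfspace_pos[of _ x]) (auto simp: inner_add_right)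
    then show False using meas_shift[OF us(1), of "s - u \<bullet> c"] empty0[OF us(2)] by simp
  qed
  moreover have "y - c \<in> A" if y: "y \<in> B" for y
  proof (rule ccontr)
    assume "y - c \<notin> A"
    then obtain u s where us: "u \<noteq> 0" "\<forall>x\<in>A. u \<bullet> x \<le> s" "u \<bullet> (y - c) > s" using sep[OF A] ne by blast
    then have "measure lborel (B \<inter> {x. u \<bullet> x \<in> {s + u \<bullet> c<..}}) > 0"
      using B posB y by (intro halfspace_pos[of _ y]) (auto simp: inner_diff_right)
    then show False using meas_shift[OF us(1), of s] empty0[OF us(2)] by simp
  qed
  ultimately have "B = (\<lambda>x. x + c) ` A" by (auto simp: image_iff) (metis diff_add_cancel)
  then show ?thesis by blast
qed

section \<open>Polytopes with equal opposite facets\<close>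

lemma ex_dual_vector:
  fixes u w :: "'a::real_inner"
  assumes "\<And>k. w \<noteq> k *\<^sub>R u"
  shows "\<exists>q. u \<bullet> q = 0 \<and> w \<bullet> q = 1"
proof -
  \<comment> \<open>For u = 0 division by zero gives k = 0, and q = w is then trivially orthogonal
    to u.\<close>
  define k where "k = (w \<bullet> u) / (u \<bullet> u)"
  define q where "q = w - k *\<^sub>R u"
  have "q \<noteq> 0" using assms[of k] by (simp add: q_def)
  have uq: "u \<bullet> q = 0" by (cases "u = 0") (simp_all add: q_def k_def inner_diff_right inner_commute)
  have "w \<bullet> q = q \<bullet> q + k * (u \<bullet> q)" by (simp add: q_def inner_diff_left inner_diff_right algebra_simps)
  then have "w \<bullet> ((1 / (q \<bullet> q)) *\<^sub>R q) = 1" using \<open>q \<noteq> 0\<close> uq by simp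
  moreover have "u \<bullet> ((1 / (q \<bullet> q)) *\<^sub>R q) = 0" using uq by simp
  ultimately show ?thesis by blast
qed

text \<open>
  About \<open>1/\<delta>\<^sup>2\<close> disjoint translates of the intersection of two slabs of width \<open>2\<delta>\<close> fit into a
  fixed ball.
\<close>

lemma double_slab_measure:
  fixes u w :: "'a::euclidean_space"
  assumes u: "u \<noteq> 0" and npar: "\<And>k. w \<noteq> k *\<^sub>R u"
  shows "\<exists>C\<ge>0. \<forall>a b \<delta>. 0 < \<delta> \<longrightarrow>
    measure lebesgue {x \<in> cball 0 R. \<bar>u \<bullet> x - a\<bar> \<le> \<delta> \<and> \<bar>w \<bullet> x - b\<bar> \<le> \<delta>} \<le> C * \<delta>\<^sup>2"
proof -
  obtain q where q: "u \<bullet> q = 0" "w \<bullet> q = 1" using ex_dual_vector[OF npar] by blast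
  have "u \<noteq> k *\<^sub>R w" for k
  proof
    assume k: "u = k *\<^sub>R w"
    then have "w = (1/k) *\<^sub>R u" using u by (cases "k = 0") auto
    then show False using npar by blast
  qed
  then obtain p where p: "w \<bullet> p = 0" "u \<bullet> p = 1" using ex_dual_vector by blast
  define B where "B = cball (0 :: 'a) (R + 3 * (norm p + norm q))"
  have "measure lebesgue {x \<in> cball 0 R. \<bar>u \<bullet> x - a\<bar> \<le> \<delta> \<and> \<bar>w \<bullet> x - b\<bar> \<le> \<delta>} \<le> measure lebesgue B * \<delta>\<^sup>2"
    if \<delta>: "0 < \<delta>" for a b \<delta>
  proof -
    let ?S = "{x \<in> cball 0 R. \<bar>u \<bullet> x - a\<bar> \<le> \<delta> \<and> \<bar>w \<bullet> x - b\<bar> \<le> \<delta>}"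
    have "closed {x. \<bar>u \<bullet> x - a\<bar> \<le> \<delta> \<and> \<bar>w \<bullet> x - b\<bar> \<le> \<delta>}"
      by (intro closed_Collect_conj closed_Collect_le continuous_intros)
    then have "compact (cball 0 R \<inter> {x. \<bar>u \<bullet> x - a\<bar> \<le> \<delta> \<and> \<bar>w \<bullet> x - b\<bar> \<le> \<delta>})" by (intro compact_Int_closed) auto
    then have S: "?S \<in> lmeasurable" by (intro lmeasurable_compact) (simp add: Collect_conj_eq2 Int_def)
    define K where "K = nat \<lfloor>1 / \<delta>\<rfloor>"
    have K: "real K \<le> 1 / \<delta>" "1 / \<delta> \<le> real K + 1" using \<delta> unfolding K_def by (simp_all add: of_nat_nat)
    \<comment> \<open>The grid has step 3 \<delta> while the slabs have width 2 \<delta>, which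
      makes the translates disjoint. Indices up to \<open>K\<close>, about 1/\<delta>, give at most
      3 times each dual vector; this explains the radius of \<open>B\<close>.\<close>
    define v where "v = (\<lambda>(i, j). (3 * \<delta> * real i) *\<^sub>R p + (3 * \<delta> * real j) *\<^sub>R q)"
    define I where "I = {0..K} \<times> {0..K}"
    have disj: "i = i' \<and> j = j'" if "x + v (i, j) = x' + v (i', j')" "x \<in> ?S" "x' \<in> ?S" for x x' i j i' j'
    proof -
      have "u \<bullet> (x + v (i, j)) = u \<bullet> (x' + v (i', j'))" "w \<bullet> (x + v (i, j)) = w \<bullet> (x' + v (i', j'))"
        using that(1) by simp_all
      then have "u \<bullet> x + 3 * \<delta> * real i = u \<bullet> x' + 3 * \<delta> * real i'" "w \<bullet> x + 3 * \<delta> * real j = w \<bullet> x' + 3 * \<delta> * real j'"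
        by (simp_all add: v_def inner_add_right p q)
      moreover have "\<bar>u \<bullet> x - u \<bullet> x'\<bar> \<le> 2 * \<delta>" "\<bar>w \<bullet> x - w \<bullet> x'\<bar> \<le> 2 * \<delta>" using that by auto
      ultimately have "\<bar>(3 * \<delta>) * (real i - real i')\<bar> \<le> 2 * \<delta>" "\<bar>(3 * \<delta>) * (real j - real j')\<bar> \<le> 2 * \<delta>"
        by (simp_all add: algebra_simps abs_le_iff)
      moreover have "\<bar>y\<bar> < 1" if "\<bar>(3 * \<delta>) * y\<bar> \<le> 2 * \<delta>" for y
      proof -
        have "(3 * \<delta>) * \<bar>y\<bar> < (3 * \<delta>) * 1" using that \<delta> by (simp add: abs_mult)
        then show ?thesis using \<delta> by (subst (asm) mult_less_cancel_left_pos) auto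
      qed
      ultimately have "\<bar>real i - real i'\<bar> < 1" "\<bar>real j - real j'\<bar> < 1" by blast+
      then show ?thesis by auto
    qed
    let ?T = "\<lambda>ij. (+) (v ij) ` ?S"
    have "measure lebesgue (\<Union>ij\<in>I. ?T ij) = (\<Sum>ij\<in>I. measure lebesgue (?T ij))"
    proof (rule measure_UNION')
      show "pairwise (\<lambda>x y. disjnt (?T x) (?T y)) I"
      proof (rule pairwiseI)
        fix x y assume "x \<in> I" "y \<in> I" "x \<noteq> y"
        obtain i j i' j' where xy: "x = (i, j)" "y = (i', j')" by (metis surj_pair)
        show "disjnt (?T x) (?T y)"
        proof (rule ccontr)
          assume "\<not> disjnt (?T x) (?T y)"
          then obtain s s' where "s \<in> ?S" "s' \<in> ?S" "v x + s = v y + s'" by (auto simp: disjnt_def)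
          then show False using disj[of s i j s' i' j'] \<open>x \<noteq> y\<close> xy by (simp add: add.commute)
        qed
      qed
    qed (use S in \<open>auto simp: I_def intro: measurable_translation\<close>)
    also have "\<dots> = (real K + 1)\<^sup>2 * measure lebesgue ?S"
      by (simp add: measure_translation I_def power2_eq_square ring_distribs)
    finally have "(real K + 1)\<^sup>2 * measure lebesgue ?S = measure lebesgue (\<Union>ij\<in>I. ?T ij)" by simp
    also have "\<dots> \<le> measure lebesgue B"
    proof (rule measure_mono_fmeasurable)
      show "(\<Union>ij\<in>I. ?T ij) \<subseteq> B"
      proof clarify
        fix i j and x :: 'a assume ij: "(i, j) \<in> I" and x: "x \<in> cball 0 R"
        have "3 * \<delta> * real n \<le> 3" if "n \<le> K" for n
        proof -
          have "real n \<le> 1 / \<delta>" using that K(1) by linarith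
          then show ?thesis using \<delta> by (simp add: field_simps)
        qed
        then have d: "3 * \<delta> * real i \<le> 3" "3 * \<delta> * real j \<le> 3" using ij by (auto simp: I_def)
        have "norm ((3 * \<delta> * real i) *\<^sub>R p) \<le> 3 * norm p" "norm ((3 * \<delta> * real j) *\<^sub>R q) \<le> 3 * norm q"
          using mult_right_mono[OF d(1), of "norm p"] mult_right_mono[OF d(2), of "norm q"] \<delta> by simp_all
        then have "norm (v (i, j)) \<le> 3 * norm p + 3 * norm q"
          unfolding v_def prod.case using norm_triangle_ineq by (rule order.trans[OF _ add_mono, rotated])
        then show "v (i, j) + x \<in> B" using x norm_triangle_ineq[of "v (i, j)" x] by (simp add: B_def)
      qed
      show "(\<Union>ij\<in>I. ?T ij) \<in> sets lebesgue"
        by (rule sets.finite_UN) (use S in \<open>auto simp: I_def intro!: fmeasurableD measurable_translation\<close>)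
    qed (simp add: B_def lmeasurable_cball)
    finally have *: "(real K + 1)\<^sup>2 * measure lebesgue ?S \<le> measure lebesgue B" .
    have "(1 / \<delta>)\<^sup>2 \<le> (real K + 1)\<^sup>2" using K \<delta> by (intro power_mono) auto
    then have "(1 / \<delta>)\<^sup>2 * measure lebesgue ?S \<le> measure lebesgue B"
      using * by (meson measure_nonneg mult_right_mono order.trans)
    then show ?thesis using \<delta> by (simp add: field_simps power2_eq_square)
  qed
  then show ?thesis by (intro exI[of _ "measure lebesgue B"]) auto
qed

text \<open>A Bonferroni inequality. The double sum runs over ordered pairs and so counts each
  intersection twice, which only weakens the bound.\<close>

lemma measure_UNION_ge:
  assumes "finite I" "\<And>i. i \<in> I \<Longrightarrow> A i \<in> fmeasurable M"
  shows "(\<Sum>i\<in>I. measure M (A i)) \<le> measure M (\<Union>i\<in>I. A i) + (\<Sum>i\<in>I. \<Sum>j\<in>I - {i}. measure M (A i \<inter> A j))"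
  using assms
proof (induction I rule: finite_induct)
  case (insert k I)
  let ?U = "\<Union>i\<in>I. A i"
  have m: "A k \<in> fmeasurable M" "?U \<in> fmeasurable M" "\<And>i. i \<in> I \<Longrightarrow> A i \<in> fmeasurable M"
    using insert by (auto intro: fmeasurable.finite_UN)
  have "measure M (\<Union>i\<in>insert k I. A i) = measure M (A k) + measure M ?U - measure M (A k \<inter> ?U)"
    unfolding UN_insert by (rule measure_Un3) (rule m)+
  moreover have "measure M (A k \<inter> ?U) \<le> (\<Sum>j\<in>I. measure M (A k \<inter> A j))"
  proof -
    have "measure M (\<Union>j\<in>I. A k \<inter> A j) \<le> (\<Sum>j\<in>I. measure M (A k \<inter> A j))"
      by (rule measure_UNION_le[OF insert.hyps(1)]) (use m in \<open>auto intro!: sets.Int fmeasurableD\<close>)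
    moreover have "A k \<inter> ?U = (\<Union>j\<in>I. A k \<inter> A j)" by blast
    ultimately show ?thesis by (simp only:)
  qed
  moreover have "(\<Sum>i\<in>I. \<Sum>j\<in>I - {i}. measure M (A i \<inter> A j)) \<le> (\<Sum>i\<in>I. \<Sum>j\<in>insert k I - {i}. measure M (A i \<inter> A j))"
    by (intro sum_mono sum_mono2) (use insert.hyps(1) in auto)
  moreover have "(\<Sum>i\<in>I. measure M (A i)) \<le> measure M ?U + (\<Sum>i\<in>I. \<Sum>j\<in>I - {i}. measure M (A i \<inter> A j))"
    by (rule insert.IH) (rule m(3))
  moreover
  have k: "insert k I - {k} = I" using insert.hyps(2) by auto
  have "(\<Sum>i\<in>insert k I. \<Sum>j\<in>insert k I - {i}. measure M (A i \<inter> A j))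
     = (\<Sum>j\<in>I. measure M (A k \<inter> A j)) + (\<Sum>i\<in>I. \<Sum>j\<in>insert k I - {i}. measure M (A i \<inter> A j))"
    by (subst sum.insert[OF insert.hyps]) (simp only: k)
  moreover have "(\<Sum>i\<in>insert k I. measure M (A i)) = measure M (A k) + (\<Sum>i\<in>I. measure M (A i))"
    by (rule sum.insert[OF insert.hyps])
  ultimately show ?case by linarith
qed simp

lemma measure_Diff_Int:
  assumes "A \<in> fmeasurable M" "B \<in> sets M"
  shows "measure M A = measure M (A - B) + measure M (A \<inter> B)"
proof -
  have "A - B \<in> fmeasurable M" "A \<inter> B \<in> fmeasurable M"
    using assms by (auto intro: fmeasurable_Diff fmeasurable_Int_fmeasurable)
  then have "measure M ((A - B) \<union> (A \<inter> B)) = measure M (A - B) + measure M (A \<inter> B)"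
    by (intro measure_Union) (auto simp: fmeasurable_def)
  then show ?thesis by (simp add: Un_Diff_Int)
qed

lemma measure_lebesgue_compact: "compact S \<Longrightarrow> measure lebesgue S = measure lborel S"
  by (rule measure_completion) (simp add: compact_imp_closed)

lemma lborel_distr_uminus_euclidean: "distr lborel borel uminus = (lborel :: 'a::euclidean_space measure)"
  by (subst lborel_affine[of "-1" 0]) (auto simp: density_1 one_ennreal_def[symmetric])

lemma measure_lborel_uminus:
  fixes S :: "'a::euclidean_space set"
  assumes [measurable]: "S \<in> sets borel"
  shows "measure lborel (uminus ` S) = measure lborel S"
proof -
  have "measure lborel S = measure (distr lborel borel uminus) S" by (simp only: lborel_distr_uminus_euclidean)
  also have "\<dots> = measure lborel (uminus -` S)" by (subst measure_distr) auto
  also have "uminus -` S = uminus ` S" by (auto simp: image_iff) (metis minus_minus)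
  finally show ?thesis by simp
qed

lemma measure_hyperplane_section:
  fixes u :: "'a::euclidean_space"
  assumes "u \<noteq> 0" and "S \<subseteq> {x. u \<bullet> x = b}"
  shows "measure lebesgue S = 0"
proof -
  have "negligible S" using negligible_hyperplane[of u b] assms negligible_subset by blast
  then show ?thesis by (rule negligible_imp_measure0)
qed

text \<open>In the application N consists of the unit facet normals and their negatives, and h is
  the support function. The negatives are included because P is compared with -P; in such a
  direction P may end in a lower-dimensional face, whose slab then has volume of smaller order than
  s.\<close>

locale slab_polytope =
  fixes P :: "(real ^ 'n) set" and N :: "(real ^ 'n) set" and h :: "real ^ 'n \<Rightarrow> real" and R :: real
  assumes finN: "finite N" and unit: "u \<in> N \<Longrightarrow> norm u = 1" and neg: "u \<in> N \<Longrightarrow> - u \<in> N"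
    and P_eq: "P = {x. \<forall>u\<in>N. u \<bullet> x \<le> h u}" and P_sub: "P \<subseteq> cball 0 R" and R: "R \<ge> 0"
    and width: "u \<in> N \<Longrightarrow> 0 < h u + h (- u)"
begin

lemma not_parallel:
  assumes "u \<in> N" "w \<in> N" "w \<noteq> u" "w \<noteq> - u"
  shows "w \<noteq> k *\<^sub>R u"
proof
  assume w: "w = k *\<^sub>R u"
  then have "\<bar>k\<bar> = 1" using unit[OF assms(1)] unit[OF assms(2)] by simp
  then have "k = 1 \<or> k = -1" by linarith
  then show False using w assms by auto
qed

lemma double_slabs:
  obtains C where "C \<ge> 0"
    "\<And>u w a b \<delta>. \<lbrakk>u \<in> N; w \<in> N; w \<noteq> u; w \<noteq> - u; 0 < \<delta>\<rbrakk> \<Longrightarrow>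
      measure lebesgue {x \<in> cball 0 r. \<bar>u \<bullet> x - a\<bar> \<le> \<delta> \<and> \<bar>w \<bullet> x - b\<bar> \<le> \<delta>} \<le> C * \<delta>\<^sup>2"
proof -
  let ?Q = "\<lambda>C u w. C \<ge> 0 \<and> (\<forall>a b \<delta>. 0 < \<delta> \<longrightarrow>
    measure lebesgue {x \<in> cball 0 r. \<bar>u \<bullet> x - a\<bar> \<le> \<delta> \<and> \<bar>w \<bullet> x - b\<bar> \<le> \<delta>} \<le> C * \<delta>\<^sup>2)"
  have "\<exists>C. ?Q C u w" if "u \<in> N" "w \<in> N" "w \<noteq> u" "w \<noteq> - u" for u w
  proof -
    have "u \<noteq> 0" using unit[OF that(1)] by auto
    from double_slab_measure[OF this not_parallel[OF that]] show ?thesis by blast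
  qed
  then have "\<forall>u w. \<exists>C. u \<in> N \<and> w \<in> N \<and> w \<noteq> u \<and> w \<noteq> - u \<longrightarrow> ?Q C u w" by blast
  then obtain C where C: "\<forall>u w. u \<in> N \<and> w \<in> N \<and> w \<noteq> u \<and> w \<noteq> - u \<longrightarrow> ?Q (C u w) u w"
    unfolding choice_iff by blast
  \<comment> \<open>Choice controls \<open>C u w\<close> only for admissible pairs; the maximum with
    0 keeps the other values from spoiling the sum as an upper bound.\<close>
  define C' where "C' = (\<Sum>u\<in>N. \<Sum>w\<in>N. max 0 (C u w))"
  have le: "C u w \<le> C'" if "u \<in> N" "w \<in> N" for u w
  proof -
    have "C u w \<le> max 0 (C u w)" by simp
    also have "\<dots> \<le> (\<Sum>w\<in>N. max 0 (C u w))"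
      by (rule member_le_sum[OF that(2)]) (use finN in auto)
    also have "\<dots> \<le> C'" unfolding C'_def
      by (rule member_le_sum[OF that(1)]) (use finN in \<open>auto intro!: sum_nonneg\<close>)
    finally show ?thesis .
  qed
  have C'0: "C' \<ge> 0" unfolding C'_def by (intro sum_nonneg) auto
  show ?thesis
  proof (rule that[OF C'0])
    fix u w a b \<delta> assume *: "u \<in> N" "w \<in> N" "w \<noteq> u" "w \<noteq> - u" "0 < (\<delta> :: real)"
    have "measure lebesgue {x \<in> cball 0 r. \<bar>u \<bullet> x - a\<bar> \<le> \<delta> \<and> \<bar>w \<bullet> x - b\<bar> \<le> \<delta>} \<le> C u w * \<delta>\<^sup>2"
      using C * by blast
    also have "\<dots> \<le> C' * \<delta>\<^sup>2" using le[OF *(1,2)] by (intro mult_right_mono) auto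
    finally show "measure lebesgue {x \<in> cball 0 r. \<bar>u \<bullet> x - a\<bar> \<le> \<delta> \<and> \<bar>w \<bullet> x - b\<bar> \<le> \<delta>} \<le> C' * \<delta>\<^sup>2" .
  qed
qed

lemma compact_P: "compact P"
proof -
  have "P = (\<Inter>u\<in>N. {x. u \<bullet> x \<le> h u})" unfolding P_eq by auto
  then have "closed P" by (simp add: closed_INT closed_halfspace_le)
  then show ?thesis using P_sub bounded_subset[OF bounded_cball] compact_eq_bounded_closed by blast
qed

lemma convex_P: "convex P"
proof -
  have "P = (\<Inter>u\<in>N. {x. u \<bullet> x \<le> h u})" unfolding P_eq by auto
  then show ?thesis by (simp add: convex_INT convex_halfspace_le)
qed

text \<open>X lies near a hyperplane with normal u and exceeds each constraint of P by at most cs.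
  The translation by y repairs the constraints for u and -u. What still lies outside P violates some
  other constraint w, hence is close to two hyperplanes with non-parallel normals, and such a double
  slab has volume O(s^2). Its half-width 2cs is cs for X plus cs for the translation.\<close>

lemma shift_into_P:
  assumes c: "c > 0"
  obtains C where "C \<ge> 0"
    "\<And>u a s X y. \<lbrakk>u \<in> N; 0 < s; s \<le> 1; X \<in> lmeasurable; X \<subseteq> cball 0 R; norm y \<le> c * s;
      \<And>x. x \<in> X \<Longrightarrow> \<bar>u \<bullet> x - a\<bar> \<le> c * s;
      \<And>x w. x \<in> X \<Longrightarrow> w \<in> N \<Longrightarrow> w \<bullet> x \<le> h w + c * s;
      \<And>x w. x \<in> X \<Longrightarrow> w \<in> N \<Longrightarrow> w = u \<or> w = - u \<Longrightarrow> w \<bullet> (x - y) \<le> h w\<rbrakk> \<Longrightarrow>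
      measure lebesgue X \<le> measure lebesgue (P \<inter> (\<lambda>x. x - y) ` X) + C * s\<^sup>2"
proof -
  obtain C where C: "C \<ge> 0"
    "\<And>u w a b \<delta>. \<lbrakk>u \<in> N; w \<in> N; w \<noteq> u; w \<noteq> - u; 0 < \<delta>\<rbrakk> \<Longrightarrow>
      measure lebesgue {x \<in> cball 0 (R + c). \<bar>u \<bullet> x - a\<bar> \<le> \<delta> \<and> \<bar>w \<bullet> x - b\<bar> \<le> \<delta>} \<le> C * \<delta>\<^sup>2"
    by (rule double_slabs) blast
  define C' where "C' = real (card N) * (C * (2 * c)\<^sup>2)"
  have C'0: "C' \<ge> 0" using C by (simp add: C'_def)
  show ?thesis
  proof (rule that[OF C'0])
    fix u a s X y
    assume u: "u \<in> N" and s: "0 < s" "s \<le> 1" and X: "X \<in> lmeasurable" "X \<subseteq> cball 0 R" and y: "norm y \<le> c * s"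
      and ua: "\<And>x. x \<in> X \<Longrightarrow> \<bar>u \<bullet> x - a\<bar> \<le> c * s"
      and hw: "\<And>x w. x \<in> X \<Longrightarrow> w \<in> N \<Longrightarrow> w \<bullet> x \<le> h w + c * s"
      and par: "\<And>x w. x \<in> X \<Longrightarrow> w \<in> N \<Longrightarrow> w = u \<or> w = - u \<Longrightarrow> w \<bullet> (x - y) \<le> h w"
    let ?Y = "(\<lambda>x. x - y) ` X"
    have Y: "?Y \<in> lmeasurable" "measure lebesgue ?Y = measure lebesgue X"
      using measurable_translation[OF X(1), of "- y"] measure_translation[of "- y" X]
      by (simp_all add: image_def)
    let ?D = "\<lambda>w. {x \<in> cball 0 (R + c). \<bar>u \<bullet> x - a\<bar> \<le> 2 * c * s \<and> \<bar>w \<bullet> x - h w\<bar> \<le> 2 * c * s}"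
    have D: "?D w \<in> lmeasurable" for w
    proof -
      have "closed {x. \<bar>u \<bullet> x - a\<bar> \<le> 2 * c * s \<and> \<bar>w \<bullet> x - h w\<bar> \<le> 2 * c * s}"
        by (intro closed_Collect_conj closed_Collect_le continuous_intros)
      then have "compact (cball 0 (R + c) \<inter> {x. \<bar>u \<bullet> x - a\<bar> \<le> 2 * c * s \<and> \<bar>w \<bullet> x - h w\<bar> \<le> 2 * c * s})"
        by (intro compact_Int_closed) auto
      then show ?thesis by (intro lmeasurable_compact) (simp add: Collect_conj_eq2 Int_def)
    qed
    have wy: "\<bar>w \<bullet> y\<bar> \<le> c * s" if "w \<in> N" for w
      using Cauchy_Schwarz_ineq2[of w y] unit[OF that] y by simp
    have sub: "?Y \<subseteq> (P \<inter> ?Y) \<union> (\<Union>w\<in>N - {u, - u}. ?D w)"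
    proof
      fix z assume z: "z \<in> ?Y"
      then obtain x where x: "x \<in> X" "z = x - y" by auto
      show "z \<in> (P \<inter> ?Y) \<union> (\<Union>w\<in>N - {u, - u}. ?D w)"
      proof (cases "z \<in> P")
        case False
        then obtain w where w: "w \<in> N" "w \<bullet> z > h w" unfolding P_eq by (auto simp: not_le)
        have "w \<noteq> u" "w \<noteq> - u" using par[OF x(1) w(1)] w(2) x(2) by auto
        moreover have "norm z \<le> R + c"
        proof -
          have "norm z \<le> norm x + norm y" unfolding x(2) by (rule norm_triangle_ineq4)
          moreover have "norm x \<le> R" using x X by auto
          moreover have "c * s \<le> c" using c s by (simp add: mult_left_le)
          ultimately show ?thesis using y by linarith
        qed
        moreover have "\<bar>u \<bullet> z - a\<bar> \<le> 2 * c * s"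
          using ua[OF x(1)] wy[OF u] unfolding x(2) inner_diff_right by linarith
        moreover have "\<bar>w \<bullet> z - h w\<bar> \<le> 2 * c * s"
          using hw[OF x(1) w(1)] wy[OF w(1)] w(2) unfolding x(2) inner_diff_right by linarith
        ultimately have "z \<in> ?D w" "w \<in> N - {u, - u}" using w(1) by (simp_all only: mem_Collect_eq mem_cball_0) auto
        then show ?thesis by blast
      qed (use z in auto)
    qed
    have PY: "P \<inter> ?Y \<in> lmeasurable" using Y(1) compact_P by (simp add: fmeasurable.Int lmeasurable_compact)
    have UD: "(\<Union>w\<in>N - {u, - u}. ?D w) \<in> lmeasurable" using finN D by (intro fmeasurable.finite_UN) auto
    have "measure lebesgue ?Y \<le> measure lebesgue ((P \<inter> ?Y) \<union> (\<Union>w\<in>N - {u, - u}. ?D w))"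
      by (rule measure_mono_fmeasurable[OF sub]) (use Y PY UD in auto)
    also have "\<dots> \<le> measure lebesgue (P \<inter> ?Y) + measure lebesgue (\<Union>w\<in>N - {u, - u}. ?D w)"
      by (rule measure_Un_le) (use PY UD in auto)
    also have "measure lebesgue (\<Union>w\<in>N - {u, - u}. ?D w) \<le> (\<Sum>w\<in>N - {u, - u}. measure lebesgue (?D w))"
      by (rule measure_UNION_le) (use finN D in auto)
    also have "\<dots> \<le> (\<Sum>w\<in>N - {u, - u}. C * (2 * c * s)\<^sup>2)"
      by (rule sum_mono) (use C(2)[OF u] c s in auto)
    also have "\<dots> = real (card (N - {u, - u})) * (C * (2 * c * s)\<^sup>2)" by simp
    also have "\<dots> \<le> real (card N) * (C * (2 * c * s)\<^sup>2)"
      using C finN by (intro mult_right_mono) (auto intro!: card_mono)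
    also have "\<dots> = C' * s\<^sup>2" by (simp add: C'_def power_mult_distrib)
    finally show "measure lebesgue X \<le> measure lebesgue (P \<inter> ?Y) + C' * s\<^sup>2" using Y by simp
  qed
qed

definition slab :: "real ^ 'n \<Rightarrow> real \<Rightarrow> real" where
  "slab u s = measure lebesgue (P \<inter> {x. h u - s \<le> u \<bullet> x})"

lemma compact_P_Int: "closed S \<Longrightarrow> compact (P \<inter> S)"
  using compact_P by (rule compact_Int_closed)

lemma P_le: "x \<in> P \<Longrightarrow> u \<in> N \<Longrightarrow> u \<bullet> x \<le> h u"
  by (simp add: P_eq)

lemma nonzero: "u \<in> N \<Longrightarrow> u \<noteq> 0"
  using unit by force

text \<open>
  At the integer levels strictly between the two extreme ones, the slabs on either side agree up to
  \<open>O(s\<^sup>2)\<close>, because translating one onto the other changes only what lies close to a further facet.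
\<close>

lemma slab_parity:
  assumes u: "u \<in> N" and \<kappa>: "\<kappa> > 0"
    and ab: "\<kappa> * h u = of_int b" "\<kappa> * h (- u) = - of_int a"
    and vol: "\<And>\<delta>. 0 < \<delta> \<Longrightarrow> \<delta> < 1 \<Longrightarrow>
      measure lebesgue (P \<inter> {x. \<exists>j::int. of_int j - \<delta> \<le> \<kappa> * (u \<bullet> x) \<and> \<kappa> * (u \<bullet> x) \<le> of_int j}) =
      measure lebesgue (P \<inter> {x. \<exists>j::int. of_int j \<le> \<kappa> * (u \<bullet> x) \<and> \<kappa> * (u \<bullet> x) \<le> of_int j + \<delta>})"
  shows "\<exists>C. \<forall>\<^sub>F s in at_right 0. slab u s \<le> slab (- u) s + C * s\<^sup>2"
proof -
  obtain C where C: "C \<ge> 0"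
    "\<And>u a s X y. \<lbrakk>u \<in> N; 0 < s; s \<le> 1; X \<in> lmeasurable; X \<subseteq> cball 0 R; norm y \<le> 1 * s;
      \<And>x. x \<in> X \<Longrightarrow> \<bar>u \<bullet> x - a\<bar> \<le> 1 * s;
      \<And>x w. x \<in> X \<Longrightarrow> w \<in> N \<Longrightarrow> w \<bullet> x \<le> h w + 1 * s;
      \<And>x w. x \<in> X \<Longrightarrow> w \<in> N \<Longrightarrow> w = u \<or> w = - u \<Longrightarrow> w \<bullet> (x - y) \<le> h w\<rbrakk> \<Longrightarrow>
      measure lebesgue X \<le> measure lebesgue (P \<inter> (\<lambda>x. x - y) ` X) + C * s\<^sup>2"
    by (rule shift_into_P[of 1]) auto
  have range: "of_int a \<le> \<kappa> * (u \<bullet> x)" "\<kappa> * (u \<bullet> x) \<le> of_int b" if "x \<in> P" for x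
  proof -
    have "\<kappa> * (u \<bullet> x) \<le> \<kappa> * h u" "\<kappa> * (- u \<bullet> x) \<le> \<kappa> * h (- u)"
      using P_le[OF that u] P_le[OF that neg[OF u]] \<kappa> by (intro mult_left_mono; simp)+
    then show "of_int a \<le> \<kappa> * (u \<bullet> x)" "\<kappa> * (u \<bullet> x) \<le> of_int b" using ab by auto
  qed
  have "real_of_int b - real_of_int a = \<kappa> * (h u + h (- u))" using ab by (simp add: algebra_simps)
  then have "real_of_int a < real_of_int b" using width[OF u] \<kappa> by (metis diff_gt_0_iff_gt mult_pos_pos)
  then have less: "a < b" by simp
  have main: "slab u s \<le> slab (- u) s + (real (card {a + 1..b - 1}) * C) * s\<^sup>2"
    if s: "0 < s" "s < 1" "\<kappa> * s < 1" for s
  proof -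
    define \<delta> where "\<delta> = \<kappa> * s"
    have \<delta>: "0 < \<delta>" "\<delta> < 1" using \<kappa> s by (auto simp: \<delta>_def)
    define Vm where "Vm j = P \<inter> {x. of_int j - \<delta> \<le> \<kappa> * (u \<bullet> x) \<and> \<kappa> * (u \<bullet> x) \<le> of_int j}" for j :: int
    define Vp where "Vp j = P \<inter> {x. of_int j \<le> \<kappa> * (u \<bullet> x) \<and> \<kappa> * (u \<bullet> x) \<le> of_int j + \<delta>}" for j :: int
    have m: "Vm j \<in> lmeasurable" "Vp j \<in> lmeasurable" for j
      unfolding Vm_def Vp_def
      by (intro lmeasurable_compact compact_P_Int closed_Collect_conj closed_Collect_le continuous_intros)+
    have Sm: "P \<inter> {x. \<exists>j::int. of_int j - \<delta> \<le> \<kappa> * (u \<bullet> x) \<and> \<kappa> * (u \<bullet> x) \<le> of_int j} = (\<Union>j\<in>{a..b}. Vm j)"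
    proof (intro equalityI subsetI)
      fix x assume "x \<in> P \<inter> {x. \<exists>j::int. of_int j - \<delta> \<le> \<kappa> * (u \<bullet> x) \<and> \<kappa> * (u \<bullet> x) \<le> of_int j}"
      then obtain j :: int where j: "x \<in> P" "of_int j - \<delta> \<le> \<kappa> * (u \<bullet> x)" "\<kappa> * (u \<bullet> x) \<le> of_int j" by auto
      then have "real_of_int a \<le> of_int j" "real_of_int j < of_int b + 1" using range[OF j(1)] \<delta> by linarith+
      then have "j \<in> {a..b}" by auto
      then show "x \<in> (\<Union>j\<in>{a..b}. Vm j)" using j by (auto simp: Vm_def)
    qed (auto simp: Vm_def)
    have Sp: "P \<inter> {x. \<exists>j::int. of_int j \<le> \<kappa> * (u \<bullet> x) \<and> \<kappa> * (u \<bullet> x) \<le> of_int j + \<delta>} = (\<Union>j\<in>{a..b}. Vp j)"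
    proof (intro equalityI subsetI)
      fix x assume "x \<in> P \<inter> {x. \<exists>j::int. of_int j \<le> \<kappa> * (u \<bullet> x) \<and> \<kappa> * (u \<bullet> x) \<le> of_int j + \<delta>}"
      then obtain j :: int where j: "x \<in> P" "of_int j \<le> \<kappa> * (u \<bullet> x)" "\<kappa> * (u \<bullet> x) \<le> of_int j + \<delta>" by auto
      then have "real_of_int a < of_int j + 1" "real_of_int j \<le> of_int b" using range[OF j(1)] \<delta> by linarith+
      then have "j \<in> {a..b}" by auto
      then show "x \<in> (\<Union>j\<in>{a..b}. Vp j)" using j by (auto simp: Vp_def)
    qed (auto simp: Vp_def)
    \<comment> \<open>Level a is left out on this side: \<open>Vm a\<close> lies in the hyperplane
      where u \<bullet> x is minimal, and dropping it is harmless for a lower bound. The other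
      pieces are disjoint because \<delta> < 1.\<close>
    have "(\<Sum>j\<in>{a+1..b}. measure lebesgue (Vm j)) = measure lebesgue (\<Union>j\<in>{a+1..b}. Vm j)"
    proof (rule measure_UNION'[symmetric])
      show "pairwise (\<lambda>i j. disjnt (Vm i) (Vm j)) {a+1..b}"
      proof (rule pairwiseI)
        fix i j :: int assume "i \<noteq> j"
        show "disjnt (Vm i) (Vm j)"
        proof (rule ccontr)
          assume "\<not> disjnt (Vm i) (Vm j)"
          then obtain x where "x \<in> Vm i" "x \<in> Vm j" by (auto simp: disjnt_def)
          then have "\<bar>real_of_int i - of_int j\<bar> < 1" using \<delta> by (simp add: Vm_def)
          then show False using \<open>i \<noteq> j\<close> by linarith
        qed
      qed
    qed (use m in auto)
    also have "\<dots> \<le> measure lebesgue (\<Union>j\<in>{a..b}. Vm j)"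
    proof (rule measure_mono_fmeasurable)
      show "(\<Union>j\<in>{a+1..b}. Vm j) \<subseteq> (\<Union>j\<in>{a..b}. Vm j)" by (rule UN_mono) auto
    qed (use m in \<open>auto intro!: sets.finite_UN fmeasurable.finite_UN\<close>)
    also have "\<dots> = measure lebesgue (\<Union>j\<in>{a..b}. Vp j)" using vol[OF \<delta>] unfolding Sm Sp .
    also have "\<dots> \<le> (\<Sum>j\<in>{a..b}. measure lebesgue (Vp j))"
      by (rule measure_UNION_le) (use m in auto)
    finally have le: "(\<Sum>j\<in>{a+1..b}. measure lebesgue (Vm j)) \<le> (\<Sum>j\<in>{a..b}. measure lebesgue (Vp j))" .
    have "measure lebesgue (Vp b) = 0"
    proof (rule measure_hyperplane_section[OF nonzero[OF u]])
      show "Vp b \<subseteq> {x. u \<bullet> x = of_int b / \<kappa>}"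
        using range(2) \<kappa> by (force simp: Vp_def field_simps)
    qed
    moreover have "slab u s = measure lebesgue (Vm b)"
    proof -
      have "P \<inter> {x. h u - s \<le> u \<bullet> x} = Vm b"
      proof -
        have "h u - s \<le> u \<bullet> x \<longleftrightarrow> of_int b - \<delta> \<le> \<kappa> * (u \<bullet> x)" for x
          using mult_le_cancel_left_pos[OF \<kappa>, of "h u - s" "u \<bullet> x"] ab by (simp add: \<delta>_def right_diff_distrib)
        then show ?thesis using range by (auto simp: Vm_def)
      qed
      then show ?thesis by (simp add: slab_def)
    qed
    moreover have "slab (- u) s = measure lebesgue (Vp a)"
    proof -
      have "P \<inter> {x. h (- u) - s \<le> - u \<bullet> x} = Vp a"
      proof -
        have "h (- u) - s \<le> - u \<bullet> x \<longleftrightarrow> \<kappa> * (u \<bullet> x) \<le> of_int a + \<delta>" for x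
          using mult_le_cancel_left_pos[OF \<kappa>, of "h (- u) - s" "- u \<bullet> x"] ab by (auto simp: \<delta>_def right_diff_distrib)
        then show ?thesis using range by (auto simp: Vp_def)
      qed
      then show ?thesis by (simp add: slab_def)
    qed
    moreover have "{a + 1..b} = insert b {a + 1..b - 1}" "{a..b} = insert b (insert a {a + 1..b - 1})"
      using less by auto
    ultimately have le2: "slab u s + (\<Sum>j\<in>{a+1..b-1}. measure lebesgue (Vm j))
       \<le> slab (- u) s + (\<Sum>j\<in>{a+1..b-1}. measure lebesgue (Vp j))"
      using le less by simp
    have "measure lebesgue (Vp j) \<le> measure lebesgue (Vm j) + C * s\<^sup>2" if j: "j \<in> {a+1..b-1}" for j
    proof -
      have x: "x \<in> P" "of_int j \<le> \<kappa> * (u \<bullet> x)" "\<kappa> * (u \<bullet> x) \<le> of_int j + \<kappa> * s" if "x \<in> Vp j" for x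
        using that by (auto simp: Vp_def \<delta>_def)
      have "measure lebesgue (Vp j) \<le> measure lebesgue (P \<inter> (\<lambda>x. x - s *\<^sub>R u) ` Vp j) + C * s\<^sup>2"
      proof (rule C(2)[OF u, where a = "of_int j / \<kappa>"])
        show "Vp j \<subseteq> cball 0 R" using P_sub by (auto simp: Vp_def)
        show "norm (s *\<^sub>R u) \<le> 1 * s" using unit[OF u] s by simp
        show "w \<bullet> x \<le> h w + 1 * s" if "x \<in> Vp j" "w \<in> N" for x w using P_le[OF x(1) that(2)] that s by force
        fix x assume xV: "x \<in> Vp j"
        have "\<kappa> * (of_int j / \<kappa>) \<le> \<kappa> * (u \<bullet> x)" "\<kappa> * (u \<bullet> x) \<le> \<kappa> * (of_int j / \<kappa> + s)"
          using x[OF xV] \<kappa> by (simp_all add: distrib_left)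
        then show "\<bar>u \<bullet> x - of_int j / \<kappa>\<bar> \<le> 1 * s"
          using \<kappa> by (simp only: mult_le_cancel_left_pos)
        show "w \<bullet> (x - s *\<^sub>R u) \<le> h w" if "w \<in> N" "w = u \<or> w = - u" for w
          using that(2)
        proof
          assume "w = u"
          then show ?thesis using P_le[OF x(1)[OF xV] u] unit[OF u] s by (simp add: inner_diff_right dot_square_norm)
        next
          assume w: "w = - u"
          \<comment> \<open>Level j is at least one unit above the lowest level a, and the
            translation moves by \<kappa> s < 1 units, so the constraint for -u survives.\<close>
          have "real_of_int a + 1 \<le> of_int j" using j by simp
          then have "\<kappa> * (- h (- u)) + \<kappa> * s \<le> \<kappa> * (u \<bullet> x)" using x(2)[OF xV] ab s by simp
          then have "\<kappa> * (- h (- u) + s) \<le> \<kappa> * (u \<bullet> x)" by (simp add: distrib_left right_diff_distrib)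
          then have "- h (- u) + s \<le> u \<bullet> x" using \<kappa> by (simp only: mult_le_cancel_left_pos)
          then show ?thesis using unit[OF u] w by (simp add: inner_diff_right dot_square_norm)
        qed
      qed (use m s in auto)
      also have "measure lebesgue (P \<inter> (\<lambda>x. x - s *\<^sub>R u) ` Vp j) \<le> measure lebesgue (Vm j)"
      proof (rule measure_mono_fmeasurable)
        show "P \<inter> (\<lambda>x. x - s *\<^sub>R u) ` Vp j \<subseteq> Vm j"
        proof
          fix z assume "z \<in> P \<inter> (\<lambda>x. x - s *\<^sub>R u) ` Vp j"
          then obtain x where z: "z \<in> P" "z = x - s *\<^sub>R u" "x \<in> Vp j" by auto
          have "u \<bullet> z = u \<bullet> x - s" using unit[OF u] by (simp add: z(2) inner_diff_right dot_square_norm)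
          then have "\<kappa> * (u \<bullet> z) = \<kappa> * (u \<bullet> x) - \<delta>" by (simp add: \<delta>_def right_diff_distrib)
          then show "z \<in> Vm j" using z by (auto simp: Vm_def Vp_def)
        qed
        have "(\<lambda>x. x - s *\<^sub>R u) ` Vp j \<in> lmeasurable"
          using measurable_translation[OF m(2)[of j], of "- (s *\<^sub>R u)"] by (simp add: image_def)
        from fmeasurable.Int[OF lmeasurable_compact[OF compact_P] this]
        show "P \<inter> (\<lambda>x. x - s *\<^sub>R u) ` Vp j \<in> sets lebesgue" by (rule fmeasurableD)
      qed (rule m)
      finally show ?thesis by simp
    qed
    then have "(\<Sum>j\<in>{a+1..b-1}. measure lebesgue (Vp j)) \<le> (\<Sum>j\<in>{a+1..b-1}. measure lebesgue (Vm j) + C * s\<^sup>2)"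
      by (rule sum_mono)
    with le2 show ?thesis by (simp add: sum.distrib)
  qed
  have "\<forall>\<^sub>F s in at_right 0. slab u s \<le> slab (- u) s + (real (card {a + 1..b - 1}) * C) * s\<^sup>2"
    unfolding eventually_at_right_field
    using main \<kappa> by (intro exI[of _ "min 1 (1/\<kappa>)"]) (auto simp: field_simps)
  then show ?thesis by blast
qed

section \<open>Volume of the Minkowski combinations (1-s)P + s(-P) for small s\<close>

definition mixed :: "real \<Rightarrow> (real ^ 'n) set" where
  "mixed s = {(1 - s) *\<^sub>R x - s *\<^sub>R y | x y. x \<in> P \<and> y \<in> P}"

lemma compact_mixed: "compact (mixed s)"
proof -
  have "mixed s = {a + b | a b. a \<in> (\<lambda>x. (1 - s) *\<^sub>R x) ` P \<and> b \<in> (\<lambda>x. (- s) *\<^sub>R x) ` P}"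
    unfolding mixed_def by auto (metis (no_types, lifting) image_eqI scaleR_minus_left uminus_add_conv_diff add.commute)+
  then show ?thesis
    using compact_sums[OF compact_scaling[OF compact_P, of "1 - s"] compact_scaling[OF compact_P, of "- s"]] by (simp only:)
qed

text \<open>\<open>\<beta> u\<close> is the rate at which the constraint u moves from h u towards h
  (-u), and it is odd in u. The combination lies in the polytope \<open>K\<close> with the moved
  constraints. A direction u with \<beta> u > 0 gains at most a slab of depth s \<beta> u, up to
  O(s^2), and its opposite loses a slab of the same depth. By the hypothesis the gain at u does not
  exceed the loss at -u by more than O(s^2).\<close>

lemma measure_mixed_le:
  assumes parity: "\<And>u. u \<in> N \<Longrightarrow> \<exists>C. \<forall>\<^sub>F s in at_right 0. slab u s \<le> slab (- u) s + C * s\<^sup>2"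
  shows "\<exists>C. \<forall>\<^sub>F s in at_right 0. measure lebesgue (mixed s) \<le> measure lebesgue P + C * s\<^sup>2"
proof -
  define \<beta> where "\<beta> u = h (- u) - h u" for u
  have \<beta>_neg: "\<beta> (- u) = - \<beta> u" for u by (simp add: \<beta>_def)
  \<comment> \<open>c bounds every rate, so that all constraints move by at most cs; the summand 1
    keeps it positive.\<close>
  define c where "c = 1 + (\<Sum>u\<in>N. \<bar>\<beta> u\<bar>)"
  have c: "c > 0" by (auto simp: c_def intro!: add_pos_nonneg sum_nonneg)
  have \<beta>_c: "\<bar>\<beta> u\<bar> \<le> c" if "u \<in> N" for u
    using member_le_sum[OF that, of "\<lambda>u. \<bar>\<beta> u\<bar>"] finN by (simp add: c_def)
  define Np where "Np = {u \<in> N. \<beta> u > 0}"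
  define Nm where "Nm = {u \<in> N. \<beta> u < 0}"
  have finNp: "finite Np" and finNm: "finite Nm" using finN by (auto simp: Np_def Nm_def)
  obtain C1 where C1: "C1 \<ge> 0"
    "\<And>u a s X y. \<lbrakk>u \<in> N; 0 < s; s \<le> 1; X \<in> lmeasurable; X \<subseteq> cball 0 R; norm y \<le> c * s;
      \<And>x. x \<in> X \<Longrightarrow> \<bar>u \<bullet> x - a\<bar> \<le> c * s;
      \<And>x w. x \<in> X \<Longrightarrow> w \<in> N \<Longrightarrow> w \<bullet> x \<le> h w + c * s;
      \<And>x w. x \<in> X \<Longrightarrow> w \<in> N \<Longrightarrow> w = u \<or> w = - u \<Longrightarrow> w \<bullet> (x - y) \<le> h w\<rbrakk> \<Longrightarrow>
      measure lebesgue X \<le> measure lebesgue (P \<inter> (\<lambda>x. x - y) ` X) + C1 * s\<^sup>2"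
    by (rule shift_into_P[OF c]) blast
  obtain C2 where C2: "C2 \<ge> 0"
    "\<And>u w a b \<delta>. \<lbrakk>u \<in> N; w \<in> N; w \<noteq> u; w \<noteq> - u; 0 < \<delta>\<rbrakk> \<Longrightarrow>
      measure lebesgue {x \<in> cball 0 R. \<bar>u \<bullet> x - a\<bar> \<le> \<delta> \<and> \<bar>w \<bullet> x - b\<bar> \<le> \<delta>} \<le> C2 * \<delta>\<^sup>2"
    by (rule double_slabs) blast
  have "\<forall>u. \<exists>C. u \<in> N \<longrightarrow> (\<forall>\<^sub>F s in at_right 0. slab u s \<le> slab (- u) s + C * s\<^sup>2)"
    using parity by blast
  then obtain Cp where Cp: "\<And>u. u \<in> N \<Longrightarrow> (\<forall>\<^sub>F s in at_right 0. slab u s \<le> slab (- u) s + Cp u * s\<^sup>2)"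
    unfolding choice_iff by blast
  \<comment> \<open>The comparison of slabs is used at depth s \<beta> u, which rescales its range
    of validity. The second condition says that this depth does not exceed the width of P; it keeps
    the constraint for -u intact when the gained layer is moved back.\<close>
  have ev: "\<forall>\<^sub>F s in at_right 0. \<forall>u\<in>Np. slab u (s * \<beta> u) \<le> slab (- u) (s * \<beta> u) + Cp u * (s * \<beta> u)\<^sup>2 \<and> s * \<beta> u \<le> h u + h (- u)"
  proof (intro eventually_ball_finite[OF finNp] ballI eventually_conj)
    fix u assume u: "u \<in> Np"
    then have uN: "u \<in> N" "\<beta> u > 0" by (auto simp: Np_def)
    obtain b where b: "b > 0" "\<And>s. 0 < s \<Longrightarrow> s < b \<Longrightarrow> slab u s \<le> slab (- u) s + Cp u * s\<^sup>2"
      using Cp[OF uN(1)] unfolding eventually_at_right_field by auto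
    show "\<forall>\<^sub>F s in at_right 0. slab u (s * \<beta> u) \<le> slab (- u) (s * \<beta> u) + Cp u * (s * \<beta> u)\<^sup>2"
      unfolding eventually_at_right_field
      using b uN by (intro exI[of _ "b / \<beta> u"]) (auto simp: pos_less_divide_eq)
    show "\<forall>\<^sub>F s in at_right 0. s * \<beta> u \<le> h u + h (- u)"
      unfolding eventually_at_right_field
      using width[OF uN(1)] uN by (intro exI[of _ "(h u + h (- u)) / \<beta> u"]) (auto simp: pos_less_divide_eq)
  qed
  have ev1: "\<forall>\<^sub>F s :: real in at_right 0. 0 < s \<and> s < 1"
    unfolding eventually_at_right_field by (intro exI[of _ 1]) auto
  define C where "C = (\<Sum>u\<in>Np. Cp u * (\<beta> u)\<^sup>2 + C1) + (\<Sum>u\<in>Nm. \<Sum>w\<in>Nm - {u}. C2 * c\<^sup>2)"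
  have main: "measure lebesgue (mixed s) \<le> measure lebesgue P + C * s\<^sup>2"
    if s: "0 < s" "s < 1"
      and par: "\<And>u. u \<in> Np \<Longrightarrow> slab u (s * \<beta> u) \<le> slab (- u) (s * \<beta> u) + Cp u * (s * \<beta> u)\<^sup>2"
      and wid: "\<And>u. u \<in> Np \<Longrightarrow> s * \<beta> u \<le> h u + h (- u)" for s
  proof -
    have s\<beta>: "s * \<beta> u \<le> c * s" "- (s * \<beta> u) \<le> c * s" if "u \<in> N" for u
    proof -
      have "s * \<bar>\<beta> u\<bar> \<le> s * c" using \<beta>_c[OF that] s by (intro mult_left_mono) auto
      moreover have "\<bar>s * \<beta> u\<bar> = s * \<bar>\<beta> u\<bar>" using s by (simp add: abs_mult)
      ultimately show "s * \<beta> u \<le> c * s" "- (s * \<beta> u) \<le> c * s" by (simp_all add: mult.commute abs_le_iff)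
    qed
    define K where "K = cball 0 R \<inter> (\<Inter>u\<in>N. {z. u \<bullet> z \<le> h u + s * \<beta> u})"
    have cK: "compact K" unfolding K_def by (intro compact_Int_closed closed_INT ballI closed_halfspace_le) auto
    have Kle: "u \<bullet> z \<le> h u + s * \<beta> u" if "z \<in> K" "u \<in> N" for z u using that by (auto simp: K_def)
    have "mixed s \<subseteq> K"
    proof
      fix z assume "z \<in> mixed s"
      then obtain x y where xy: "x \<in> P" "y \<in> P" and z: "z = (1 - s) *\<^sub>R x - s *\<^sub>R y" by (auto simp: mixed_def)
      have "norm x \<le> R" "norm y \<le> R" using xy P_sub by auto
      then have "(1 - s) * norm x \<le> (1 - s) * R" "s * norm y \<le> s * R" using s by (auto intro!: mult_left_mono)
      moreover have "norm z \<le> (1 - s) * norm x + s * norm y"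
        unfolding z using norm_triangle_ineq4[of "(1 - s) *\<^sub>R x" "s *\<^sub>R y"] s by simp
      moreover have "(1 - s) * R + s * R = R" by (simp add: algebra_simps)
      ultimately have "norm z \<le> R" by linarith
      moreover have "u \<bullet> z \<le> h u + s * \<beta> u" if u: "u \<in> N" for u
      proof -
        have "(1 - s) * (u \<bullet> x) \<le> (1 - s) * h u" "s * (- u \<bullet> y) \<le> s * h (- u)"
          using P_le[OF xy(1) u] P_le[OF xy(2) neg[OF u]] s by (intro mult_left_mono; simp)+
        then show ?thesis by (simp add: z inner_diff_right \<beta>_def algebra_simps)
      qed
      ultimately show "z \<in> K" by (auto simp: K_def)
    qed
    then have step1: "measure lebesgue (mixed s) \<le> measure lebesgue K"
      by (rule measure_mono_fmeasurable) (use cK compact_mixed in \<open>auto intro: lmeasurable_compact fmeasurableD\<close>)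
    have mP: "P \<in> lmeasurable" and mK: "K \<in> lmeasurable" using compact_P cK by (auto intro: lmeasurable_compact)
    define G where "G u = K \<inter> {z. h u \<le> u \<bullet> z}" for u
    have mG: "G u \<in> lmeasurable" for u
      unfolding G_def by (intro lmeasurable_compact compact_Int_closed cK closed_halfspace_ge)
    define L where "L u = P \<inter> {x. h u + s * \<beta> u < u \<bullet> x}" for u
    have mL: "L u \<in> lmeasurable" for u
    proof -
      have "L u = P - (P \<inter> {x. u \<bullet> x \<le> h u + s * \<beta> u})" by (auto simp: L_def)
      then show ?thesis
        using mP lmeasurable_compact[OF compact_P_Int[OF closed_halfspace_le]] by (simp add: fmeasurable.Diff)
    qed
    have gain: "measure lebesgue (G u) \<le> slab u (s * \<beta> u) + C1 * s\<^sup>2" if u: "u \<in> Np" for u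
    proof -
      have uN: "u \<in> N" "0 < \<beta> u" using u by (auto simp: Np_def)
      let ?y = "(s * \<beta> u) *\<^sub>R u"
      have uu: "u \<bullet> u = 1" using unit[OF uN(1)] by (simp add: dot_square_norm)
      have "measure lebesgue (G u) \<le> measure lebesgue (P \<inter> (\<lambda>x. x - ?y) ` G u) + C1 * s\<^sup>2"
      proof (rule C1(2)[OF uN(1), where a = "h u"])
        show "norm ?y \<le> c * s" using unit[OF uN(1)] s\<beta>[OF uN(1)] uN(2) s by (simp add: abs_mult)
        show "\<bar>u \<bullet> x - h u\<bar> \<le> c * s" if "x \<in> G u" for x
          using that Kle[of x u] s\<beta>[OF uN(1)] uN(1) by (auto simp: G_def)
        show "w \<bullet> x \<le> h w + c * s" if "x \<in> G u" "w \<in> N" for x w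
          using that Kle[of x w] s\<beta>[OF that(2)] by (auto simp: G_def)
        show "w \<bullet> (x - ?y) \<le> h w" if "x \<in> G u" "w \<in> N" "w = u \<or> w = - u" for x w
          using that(3)
        proof
          assume "w = u"
          then show ?thesis using Kle[of x u] that(1) uN(1) uu by (auto simp: G_def inner_diff_right)
        next
          assume w: "w = - u"
          have "h u \<le> u \<bullet> x" using that(1) by (simp add: G_def)
          then show ?thesis using wid[OF u] uu by (simp add: w inner_diff_right)
        qed
      qed (use s mG in \<open>auto simp: G_def K_def\<close>)
      also have "measure lebesgue (P \<inter> (\<lambda>x. x - ?y) ` G u) \<le> slab u (s * \<beta> u)"
        unfolding slab_def
      proof (rule measure_mono_fmeasurable)
        show "P \<inter> (\<lambda>x. x - ?y) ` G u \<subseteq> P \<inter> {x. h u - s * \<beta> u \<le> u \<bullet> x}"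
          using uu by (auto simp: G_def inner_diff_right)
        have "(\<lambda>x. x - ?y) ` G u \<in> lmeasurable"
          using measurable_translation[OF mG[of u], of "- ?y"] by (simp add: image_def)
        from fmeasurable.Int[OF mP this] show "P \<inter> (\<lambda>x. x - ?y) ` G u \<in> sets lebesgue" by (rule fmeasurableD)
        show "P \<inter> {x. h u - s * \<beta> u \<le> u \<bullet> x} \<in> lmeasurable"
          by (intro lmeasurable_compact compact_P_Int closed_halfspace_ge)
      qed
      finally show ?thesis by simp
    qed
    have loss: "measure lebesgue (L u) = slab u (- (s * \<beta> u))" if u: "u \<in> N" for u
    proof -
      \<comment> \<open>In the use made of this \<beta> u < 0, so the depth of the slab is positive.
        \<open>L u\<close> is open on the side facing \<open>K\<close> in order to be disjoint from
        \<open>K\<close>; closing it adds only a hyperplane section.\<close>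
      have "P \<inter> {x. h u - - (s * \<beta> u) \<le> u \<bullet> x} = L u \<union> (P \<inter> {x. u \<bullet> x = h u + s * \<beta> u})"
        by (auto simp: L_def)
      moreover have "measure lebesgue (L u \<union> (P \<inter> {x. u \<bullet> x = h u + s * \<beta> u})) = measure lebesgue (L u)"
      proof (rule measure_Un_null_set)
        show "L u \<in> sets lebesgue" using mL by (rule fmeasurableD)
        have "negligible (P \<inter> {x. u \<bullet> x = h u + s * \<beta> u})"
          using negligible_hyperplane[of u "h u + s * \<beta> u"] nonzero[OF u] negligible_subset[OF _ Int_lower2] by blast
        then show "P \<inter> {x. u \<bullet> x = h u + s * \<beta> u} \<in> null_sets lebesgue" by (simp add: negligible_iff_null_sets)
      qed
      ultimately show ?thesis by (simp add: slab_def)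
    qed
    have KP: "K - P \<subseteq> (\<Union>u\<in>Np. G u)"
    proof
      fix x assume x: "x \<in> K - P"
      then obtain u where u: "u \<in> N" "h u < u \<bullet> x" unfolding P_eq by (auto simp: not_le)
      then have "0 < s * \<beta> u" using Kle[of x u] x by auto
      then have "u \<in> Np" using u s by (auto simp: Np_def zero_less_mult_iff)
      moreover have "x \<in> G u" using u x by (simp add: G_def)
      ultimately show "x \<in> (\<Union>u\<in>Np. G u)" by blast
    qed
    have PK: "(\<Union>u\<in>Nm. L u) \<subseteq> P - K"
    proof clarify
      fix u x assume "u \<in> Nm" "x \<in> L u"
      then show "x \<in> P - K" using Kle[of x u] by (auto simp: L_def Nm_def)
    qed
    have UG: "(\<Union>u\<in>Np. G u) \<in> lmeasurable" and UL: "(\<Union>u\<in>Nm. L u) \<in> lmeasurable"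
      using finNp finNm mG mL by (auto intro: fmeasurable.finite_UN)
    have "measure lebesgue (K - P) \<le> measure lebesgue (\<Union>u\<in>Np. G u)"
      by (rule measure_mono_fmeasurable[OF KP]) (use UG mK mP in \<open>auto intro: fmeasurableD\<close>)
    also have "\<dots> \<le> (\<Sum>u\<in>Np. measure lebesgue (G u))"
      by (rule measure_UNION_le[OF finNp]) (use mG in \<open>auto intro: fmeasurableD\<close>)
    also have "\<dots> \<le> (\<Sum>u\<in>Np. slab u (s * \<beta> u) + C1 * s\<^sup>2)" by (rule sum_mono) (rule gain)
    also have "\<dots> \<le> (\<Sum>u\<in>Np. slab (- u) (s * \<beta> u) + (Cp u * (\<beta> u)\<^sup>2 + C1) * s\<^sup>2)"
    proof (rule sum_mono)
      fix u assume "u \<in> Np"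
      then show "slab u (s * \<beta> u) + C1 * s\<^sup>2 \<le> slab (- u) (s * \<beta> u) + (Cp u * (\<beta> u)\<^sup>2 + C1) * s\<^sup>2"
        using par[of u] by (simp add: power_mult_distrib algebra_simps)
    qed
    also have "\<dots> = (\<Sum>u\<in>Np. slab (- u) (s * \<beta> u)) + (\<Sum>u\<in>Np. Cp u * (\<beta> u)\<^sup>2 + C1) * s\<^sup>2"
      by (subst sum.distrib) (simp only: sum_distrib_right)
    also have "(\<Sum>u\<in>Np. slab (- u) (s * \<beta> u)) = (\<Sum>u\<in>Nm. slab u (- (s * \<beta> u)))"
    proof (rule sum.reindex_bij_witness[of _ uminus uminus])
      show "- u \<in> Nm" if "u \<in> Np" for u using that neg[of u] by (auto simp: Np_def Nm_def \<beta>_neg)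
      show "- u \<in> Np" if "u \<in> Nm" for u using that neg[of u] by (auto simp: Np_def Nm_def \<beta>_neg)
    qed (auto simp: \<beta>_neg)
    also have "\<dots> = (\<Sum>u\<in>Nm. measure lebesgue (L u))" by (intro sum.cong) (auto simp: loss Nm_def)
    also have "\<dots> \<le> measure lebesgue (\<Union>u\<in>Nm. L u) + (\<Sum>u\<in>Nm. \<Sum>w\<in>Nm - {u}. measure lebesgue (L u \<inter> L w))"
      by (rule measure_UNION_ge[OF finNm]) (rule mL)
    also have "(\<Sum>u\<in>Nm. \<Sum>w\<in>Nm - {u}. measure lebesgue (L u \<inter> L w)) \<le> (\<Sum>u\<in>Nm. \<Sum>w\<in>Nm - {u}. C2 * c\<^sup>2 * s\<^sup>2)"
    proof (intro sum_mono)
      fix u w assume uw: "u \<in> Nm" "w \<in> Nm - {u}"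
      then have N: "u \<in> N" "w \<in> N" "w \<noteq> u" by (auto simp: Nm_def)
      \<comment> \<open>Opposite directions cannot both lose, as \<beta> is odd. So the two slabs
        are not parallel and meet in volume O(s^2).\<close>
      have "w \<noteq> - u" using uw \<beta>_neg[of u] by (auto simp: Nm_def)
      let ?D = "{x \<in> cball 0 R. \<bar>u \<bullet> x - h u\<bar> \<le> c * s \<and> \<bar>w \<bullet> x - h w\<bar> \<le> c * s}"
      have "closed {x. \<bar>u \<bullet> x - h u\<bar> \<le> c * s \<and> \<bar>w \<bullet> x - h w\<bar> \<le> c * s}"
        by (intro closed_Collect_conj closed_Collect_le continuous_intros)
      then have "compact (cball 0 R \<inter> {x. \<bar>u \<bullet> x - h u\<bar> \<le> c * s \<and> \<bar>w \<bullet> x - h w\<bar> \<le> c * s})"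
        by (intro compact_Int_closed) auto
      then have mD: "?D \<in> lmeasurable" by (intro lmeasurable_compact) (simp add: Collect_conj_eq2 Int_def)
      have "measure lebesgue (L u \<inter> L w) \<le> measure lebesgue ?D"
      proof (rule measure_mono_fmeasurable)
        show "L u \<inter> L w \<subseteq> ?D"
        proof
          fix x assume x: "x \<in> L u \<inter> L w"
          then have xP: "x \<in> P" by (simp add: L_def)
          have "h u + s * \<beta> u < u \<bullet> x" "h w + s * \<beta> w < w \<bullet> x" using x by (auto simp: L_def)
          then have "\<bar>u \<bullet> x - h u\<bar> \<le> c * s" "\<bar>w \<bullet> x - h w\<bar> \<le> c * s"
            using P_le[OF xP N(1)] P_le[OF xP N(2)] s\<beta>[OF N(1)] s\<beta>[OF N(2)] by linarith+
          then show "x \<in> ?D" using xP P_sub by auto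
        qed
      qed (use mL mD in \<open>auto intro!: fmeasurableD fmeasurable.Int\<close>)
      also have "\<dots> \<le> C2 * (c * s)\<^sup>2" by (rule C2(2)[OF N \<open>w \<noteq> - u\<close>]) (use c s in simp)
      finally show "measure lebesgue (L u \<inter> L w) \<le> C2 * c\<^sup>2 * s\<^sup>2" by (simp add: power_mult_distrib mult.assoc)
    qed
    also have "measure lebesgue (\<Union>u\<in>Nm. L u) \<le> measure lebesgue (P - K)"
      by (rule measure_mono_fmeasurable[OF PK]) (use UL mK mP in \<open>auto intro: fmeasurableD\<close>)
    finally have "measure lebesgue (K - P) \<le> measure lebesgue (P - K) + C * s\<^sup>2"
      by (simp add: C_def sum_distrib_right algebra_simps)
    moreover have "measure lebesgue K = measure lebesgue (K - P) + measure lebesgue (K \<inter> P)"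
      "measure lebesgue P = measure lebesgue (P - K) + measure lebesgue (P \<inter> K)"
      using measure_Diff_Int[OF mK fmeasurableD[OF mP]] measure_Diff_Int[OF mP fmeasurableD[OF mK]] by auto
    moreover have "P \<inter> K = K \<inter> P" by auto
    ultimately show ?thesis using step1 by simp
  qed
  have "\<forall>\<^sub>F s in at_right 0. measure lebesgue (mixed s) \<le> measure lebesgue P + C * s\<^sup>2"
    using ev ev1
  proof eventually_elim
    case (elim s)
    then show ?case by (intro main) auto
  qed
  then show ?thesis by blast
qed

text \<open>Log-concavity is used only at dyadic points. Midpoints of P and \<open>mixed s\<close>
  lie in \<open>mixed (s / 2)\<close>, which gives q n \<le> (q (n+1))^2 for the volume ratios q n
  at s = 2^(-n-1), hence ln (q 0) \<le> 2^n ln (q n). The right-hand side is at most of order 2^n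
  4^(-n) and tends to 0, whereas q 0 \<ge> 1 by the Brunn-Minkowski inequality for P and -P. So
  equality holds for P and -P.\<close>

theorem centrally_symmetric_if_parity:
  assumes parity: "\<And>u. u \<in> N \<Longrightarrow> \<exists>C. \<forall>\<^sub>F s in at_right 0. slab u s \<le> slab (- u) s + C * s\<^sup>2"
    and pos: "measure lebesgue P > 0"
  shows "centrally_symmetric P"
proof -
  define V where "V = measure lebesgue P"
  define W where "W s = measure lebesgue (mixed s)" for s
  have bm: "measure lebesgue A * measure lebesgue B \<le> (measure lebesgue M)\<^sup>2"
    if "compact A" "compact B" "compact M" and mid: "\<And>x y. x \<in> A \<Longrightarrow> y \<in> B \<Longrightarrow> (1/2) *\<^sub>R (x + y) \<in> M" for A B M :: "(real ^ 'n) set"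
  proof -
    have e: "emeasure lborel X = ennreal (measure lborel X)" if "compact X" for X :: "(real ^ 'n) set"
      using fmeasurable_compact[OF that] by (simp add: emeasure_eq_measure2)
    have "emeasure lborel A * emeasure lborel B \<le> emeasure lborel M ^ 2"
      by (rule brunn_minkowski_midpoint) (use that in \<open>auto simp: compact_imp_closed\<close>)
    then show ?thesis
      using that(1-3) by (simp add: e measure_lebesgue_compact ennreal_power flip: ennreal_mult)
  qed
  have V0: "V > 0" using pos by (simp add: V_def)
  have step: "V * W s \<le> (W (s / 2))\<^sup>2" if s: "0 < s" "s < 1" for s
    unfolding V_def W_def
  proof (rule bm[OF compact_P compact_mixed compact_mixed])
    fix x z assume x: "x \<in> P" and "z \<in> mixed s"
    then obtain p q where pq: "p \<in> P" "q \<in> P" "z = (1 - s) *\<^sub>R p - s *\<^sub>R q" by (auto simp: mixed_def)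
    \<comment> \<open>The weight that makes (x + (1-s)p)/2 equal to 1 - s/2 times a convex
      combination of x and p.\<close>
    define t where "t = (1 - s) / (2 - s)"
    have t: "0 \<le> t" "t \<le> 1" "(1 - s / 2) * t = (1 - s) / 2" "(1 - s / 2) * (1 - t) = 1 / 2"
      using s by (auto simp: t_def field_simps)
    have "(1 - t) *\<^sub>R x + t *\<^sub>R p \<in> P" using convexD[OF convex_P x pq(1), of "1 - t" t] t by simp
    moreover have "(1/2) *\<^sub>R (x + z) = (1 - s / 2) *\<^sub>R ((1 - t) *\<^sub>R x + t *\<^sub>R p) - (s / 2) *\<^sub>R q"
    proof -
      have "(1 - s / 2) *\<^sub>R ((1 - t) *\<^sub>R x + t *\<^sub>R p) = (1 / 2) *\<^sub>R x + ((1 - s) / 2) *\<^sub>R p"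
        by (simp only: scaleR_add_right scaleR_scaleR t)
      then show ?thesis unfolding pq(3) by (simp add: scaleR_add_right scaleR_diff_right)
    qed
    ultimately show "(1/2) *\<^sub>R (x + z) \<in> mixed (s / 2)" using pq(2) unfolding mixed_def by blast
  qed
  have minusP: "compact (uminus ` P)" "convex (uminus ` P)" "measure lebesgue (uminus ` P) = V"
    using compact_P convex_P measure_lborel_uminus[of P]
    by (auto simp: V_def compact_negations convex_negations measure_lebesgue_compact compact_imp_closed)
  have mid: "(1/2) *\<^sub>R (x + y) \<in> mixed (1/2)" if x: "x \<in> P" and y: "y \<in> uminus ` P" for x y
  proof -
    obtain z where z: "z \<in> P" "y = - z" using y by auto
    have "(1/2) *\<^sub>R (x + y) = (1 - 1/2) *\<^sub>R x - (1/2) *\<^sub>R z" by (simp add: z scaleR_diff_right)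
    then show ?thesis using x z unfolding mixed_def by blast
  qed
  have half: "V * V \<le> (W (1 / 2))\<^sup>2"
  proof -
    have "measure lebesgue P * measure lebesgue (uminus ` P) \<le> (W (1 / 2))\<^sup>2"
      unfolding W_def
      by (rule bm[OF compact_P minusP(1) compact_mixed]) (rule mid)
    then show ?thesis using minusP by (simp add: V_def)
  qed
  define q where "q n = W ((1/2) ^ Suc n) / V" for n
  have qstep: "q n \<le> (q (Suc n))\<^sup>2" for n
  proof -
    have "(1/2 :: real) ^ Suc n < 1" by (rule power_Suc_less_one) auto
    then have "V * W ((1/2) ^ Suc n) \<le> (W ((1/2) ^ Suc (Suc n)))\<^sup>2" using step[of "(1/2) ^ Suc n"] by simp
    then show ?thesis using V0 by (simp add: q_def power_divide field_simps power2_eq_square)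
  qed
  have W0: "W s \<ge> 0" for s by (simp add: W_def)
  have q0: "q 0 \<ge> 1"
  proof -
    have "V \<le> W (1/2)"
      by (rule power2_le_imp_le) (use half W0 in \<open>simp_all add: power2_eq_square\<close>)
    then show ?thesis using V0 by (simp add: q_def)
  qed
  have lnq: "q n > 0 \<and> ln (q 0) * (1/2) ^ n \<le> ln (q n)" for n
  proof (induction n)
    case (Suc n)
    have "q (Suc n) \<ge> 0" using W0 V0 by (simp add: q_def)
    moreover have "(q (Suc n))\<^sup>2 > 0" using qstep[of n] Suc by linarith
    ultimately have p: "q (Suc n) > 0" by (simp add: order_less_le)
    have "ln (q n) \<le> ln ((q (Suc n))\<^sup>2)" using qstep[of n] Suc by (subst ln_le_cancel_iff) (auto intro: less_le_trans)
    also have "\<dots> = 2 * ln (q (Suc n))" using p by (simp add: ln_realpow)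
    finally show ?case using p Suc by simp
  qed (use q0 in simp)
  obtain C where C: "\<forall>\<^sub>F s in at_right 0. W s \<le> V + C * s\<^sup>2"
    using measure_mixed_le[OF parity] unfolding W_def V_def by blast
  have lim: "filterlim (\<lambda>n. (1/2 :: real) ^ Suc n) (at_right 0) sequentially"
    by (intro tendsto_imp_filterlim_at_right LIMSEQ_power_zero[THEN LIMSEQ_Suc]) auto
  have "\<forall>\<^sub>F n in sequentially. ln (q 0) \<le> (C / V / 4) * (1/2) ^ n"
    using filterlim_iff[THEN iffD1, rule_format, OF lim C]
  proof eventually_elim
    case (elim n)
    define e :: real where "e = (1/2) ^ n"
    have e: "e > 0" "(1/2) ^ Suc n = e / 2" by (simp_all add: e_def)
    have "q n \<le> 1 + (C / V) * (e / 2)\<^sup>2" using elim V0 unfolding q_def e(2) by (simp add: field_simps)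
    moreover have "1 + ln (q 0) * e \<le> exp (ln (q 0) * e)" by (rule exp_ge_add_one_self)
    moreover have "exp (ln (q 0) * e) \<le> exp (ln (q n))" using lnq[of n] by (simp only: exp_le_cancel_iff e_def)
    moreover have "exp (ln (q n)) = q n" using lnq[of n] by simp
    ultimately have "ln (q 0) * e \<le> (C / V) * (e / 2)\<^sup>2" by linarith
    also have "\<dots> = ((C / V / 4) * e) * e" by (simp add: power2_eq_square)
    finally show ?case using e(1) by (simp only: mult_le_cancel_right_pos e_def[symmetric])
  qed
  moreover have "(\<lambda>n. (C / V / 4) * (1/2) ^ n) \<longlonglongrightarrow> (C / V / 4) * 0"
    by (intro tendsto_intros LIMSEQ_power_zero) auto
  ultimately have "ln (q 0) \<le> (C / V / 4) * 0" by (intro tendsto_lowerbound) auto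
  then have "ln (q 0) \<le> 0" by simp
  then have "q 0 = 1" using q0 by simp
  then have W12: "W (1/2) = V" using V0 by (simp add: q_def)
  have "\<exists>c. uminus ` P = (\<lambda>x. x + c) ` P"
  proof (rule brunn_minkowski_equality[OF compact_P convex_P minusP(1,2) compact_mixed])
    show "(1/2) *\<^sub>R (x + y) \<in> mixed (1/2)" if "x \<in> P" "y \<in> uminus ` P" for x y using mid that by blast
    show "measure lborel P > 0" "measure lborel (uminus ` P) = measure lborel P" "measure lborel (mixed (1/2)) = measure lborel P"
      using V0 W12 minusP by (simp_all add: V_def W_def measure_lebesgue_compact compact_P compact_mixed)
  qed
  then obtain c where c: "uminus ` P = (\<lambda>x. x + c) ` P" by blast
  have "P = (\<lambda>x. - c + x) ` uminus ` P" unfolding c by (simp add: image_image)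
  then show ?thesis unfolding centrally_symmetric_def by blast
qed

end

section \<open>Unfolding the lattice point count\<close>

lemma rat_points_dense:
  fixes x :: "real ^ 'n"
  assumes "e > 0"
  shows "\<exists>y\<in>rat_points. dist x y < e"
proof -
  define d where "d = e / real CARD('n)"
  have d: "d > 0" using assms by (simp add: d_def)
  have "\<forall>i. \<exists>q\<in>\<rat>. x $ i < q \<and> q < x $ i + d" using d Rats_dense_in_real[of "x $ _"] by fastforce
  then obtain q where q: "\<And>i. q i \<in> \<rat>" "\<And>i. x $ i < q i" "\<And>i. q i < x $ i + d" by metis
  define y where "y = (\<chi> i. q i)"
  have "dist x y \<le> (\<Sum>i\<in>UNIV. \<bar>(x - y) $ i\<bar>)" unfolding dist_norm by (rule norm_le_l1_cart)
  also have "\<dots> < (\<Sum>i\<in>(UNIV :: 'n set). d)"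
  proof (rule sum_strict_mono)
    show "\<bar>(x - y) $ i\<bar> < d" for i using q(2)[of i] q(3)[of i] by (simp add: y_def)
  qed auto
  also have "\<dots> = e" by (simp add: d_def)
  finally have "dist x y < e" .
  then show ?thesis using q by (intro bexI[of _ y]) (auto simp: rat_points_def y_def)
qed

lemma countable_int_points: "countable (int_points :: (real ^ 'n) set)"
proof -
  have "int_points \<subseteq> (\<Union>n::nat. int_points \<inter> cball (0 :: real ^ 'n) (real n))"
  proof
    fix x :: "real ^ 'n" assume "x \<in> int_points"
    moreover obtain n where "norm x \<le> real n" using real_arch_simple by blast
    ultimately show "x \<in> (\<Union>n::nat. int_points \<inter> cball 0 (real n))" by (intro UN_I[of n]) auto
  qed
  moreover have "countable (\<Union>n::nat. int_points \<inter> cball (0 :: real ^ 'n) (real n))"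
    by (rule countable_UN) (auto intro: countable_finite finite_int_points_bounded)
  ultimately show ?thesis by (rule countable_subset)
qed

lemma translate_count_1: "translate_count P v (Suc 0) = card {z \<in> int_points. z - v \<in> P}"
  by (simp add: translate_count_def)

lemma finite_translate:
  assumes "bounded P"
  shows "finite {z \<in> int_points. z - v \<in> P}"
proof -
  have "bounded ((\<lambda>x. v + x) ` P)" using assms by (rule bounded_translation)
  then have "finite (int_points \<inter> (\<lambda>x. v + x) ` P)" by (rule finite_int_points_bounded)
  moreover have "{z \<in> int_points. z - v \<in> P} \<subseteq> int_points \<inter> (\<lambda>x. v + x) ` P"
    by (auto simp: image_iff) (metis add_diff_cancel_left' diff_add_cancel add.commute)
  ultimately show ?thesis by (rule finite_subset[rotated])
qed

text \<open>
  Off the countably many translates of the boundary of \<open>P\<close>, the count is locally constant, so it is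
  determined by its values at the rational points.
\<close>

lemma translate_count_locally_constant:
  fixes P :: "(real ^ 'n) set"
  assumes P: "compact P" and gen: "\<And>z. z \<in> int_points \<Longrightarrow> z - v \<notin> frontier P"
  shows "\<exists>e>0. \<forall>v'. dist v v' < e \<longrightarrow> translate_count P v' 1 = translate_count P v 1"
proof -
  obtain B where B: "\<And>x. x \<in> P \<Longrightarrow> norm x \<le> B" using compact_imp_bounded[OF P] unfolding bounded_iff by auto
  define Z where "Z = int_points \<inter> cball v (B + 1)"
  have finZ: "finite Z" unfolding Z_def by (intro finite_int_points_bounded) auto
  have "\<exists>e>0. \<forall>v'. dist v v' < e \<longrightarrow> (z - v' \<in> P \<longleftrightarrow> z - v \<in> P)" if z: "z \<in> Z" for z
  proof -
    have "z - v \<notin> frontier P" using gen z by (simp add: Z_def)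
    then have "z - v \<in> interior P \<or> z - v \<in> - P"
      using P by (auto simp: frontier_def compact_imp_closed)
    then have "\<exists>S. open S \<and> z - v \<in> S \<and> (S \<subseteq> P \<or> S \<subseteq> - P)"
      using open_interior interior_subset compact_imp_closed[OF P] open_Compl by (metis order_refl)
    then obtain S e where S: "S \<subseteq> P \<or> S \<subseteq> - P" and e: "e > 0" "ball (z - v) e \<subseteq> S"
      by (metis open_contains_ball)
    have "z - v' \<in> P \<longleftrightarrow> z - v \<in> P" if "dist v v' < e" for v'
    proof -
      have "z - v' \<in> ball (z - v) e" using that by (simp add: dist_norm norm_minus_commute)
      moreover have "z - v \<in> ball (z - v) e" using e by simp
      ultimately show ?thesis using S e(2) by blast
    qed
    then show ?thesis using e by blast
  qed
  then obtain e where e: "\<And>z. z \<in> Z \<Longrightarrow> e z > 0" "\<And>z v'. z \<in> Z \<Longrightarrow> dist v v' < e z \<Longrightarrow> (z - v' \<in> P \<longleftrightarrow> z - v \<in> P)"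
    by metis
  define d where "d = Min (insert 1 (e ` Z))"
  have d: "d > 0" "d \<le> 1" "\<And>z. z \<in> Z \<Longrightarrow> d \<le> e z" using finZ e by (auto simp: d_def)
  have "translate_count P v' 1 = translate_count P v 1" if v': "dist v v' < d" for v'
  proof -
    have inZ: "z \<in> Z" if "z \<in> int_points" "z - w \<in> P" "dist v w \<le> 1" for z w
    proof -
      have "dist v z \<le> dist v w + dist w z" by (rule dist_triangle)
      moreover have "dist w z \<le> B" using B[OF that(2)] by (simp add: dist_norm norm_minus_commute)
      ultimately show ?thesis using that by (simp add: Z_def)
    qed
    have "{z \<in> int_points. z - v' \<in> P} = {z \<in> int_points. z - v \<in> P}"
    proof (intro Collect_cong conj_cong refl)
      fix z assume z: "z \<in> (int_points :: (real ^ 'n) set)"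
      show "z - v' \<in> P \<longleftrightarrow> z - v \<in> P"
      proof (cases "z \<in> Z")
        case True
        then show ?thesis using e(2)[OF True, of v'] d(3)[OF True] v' by linarith
      next
        case False
        then show ?thesis using inZ[OF z, of v] inZ[OF z, of v'] v' d by auto
      qed
    qed
    then show ?thesis by (simp add: translate_count_1)
  qed
  then show ?thesis using d(1) by blast
qed

lemma translate_count_symmetric_AE:
  fixes P :: "(real ^ 'n) set"
  assumes P: "compact P" "convex P"
    and sym: "\<And>c. c \<in> rat_points \<Longrightarrow> translate_count P (- c) 1 = translate_count P c 1"
  shows "AE v in lebesgue. translate_count P (- v) 1 = translate_count P v 1"
proof -
  \<comment> \<open>The first family consists of those v for which a lattice point lies on the
    boundary of v + P, the second of those for which this happens to -v + P.\<close>
  define F where "F = (\<Union>z\<in>int_points. (\<lambda>x. z + - x) ` frontier P) \<union> (\<Union>z\<in>int_points. (\<lambda>x. - z + x) ` frontier P)"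
  have nf: "negligible (frontier P)" using P by (simp add: negligible_convex_frontier)
  have nn: "negligible ((\<lambda>x. - x) ` frontier P)"
    by (rule negligible_differentiable_image_negligible[OF _ nf]) (auto intro: derivative_intros)
  have "negligible F" unfolding F_def
  proof (intro negligible_Un negligible_countable_Union)
    show "countable ((\<lambda>z. (\<lambda>x. z + - x) ` frontier P) ` int_points)" "countable ((\<lambda>z. (\<lambda>x. - z + x) ` frontier P) ` int_points)"
      by (intro countable_image countable_int_points)+
    show "negligible S" if S: "S \<in> (\<lambda>z. (\<lambda>x. z + - x) ` frontier P) ` int_points" for S
    proof -
      obtain z where "S = (\<lambda>x. z + - x) ` frontier P" using S by blast
      then have "S = (+) z ` (\<lambda>x. - x) ` frontier P" by (simp only: image_image)
      then show ?thesis using negligible_translation[OF nn] by simp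
    qed
    show "negligible S" if S: "S \<in> (\<lambda>z. (\<lambda>x. - z + x) ` frontier P) ` int_points" for S
    proof -
      obtain z where z: "S = (+) (- z) ` frontier P" using S by blast
      show ?thesis unfolding z by (rule negligible_translation[OF nf])
    qed
  qed
  moreover have "translate_count P (- v) 1 = translate_count P v 1" if v: "v \<notin> F" for v
  proof -
    have g1: "z - v \<notin> frontier P" if "z \<in> int_points" for z
    proof
      assume "z - v \<in> frontier P"
      then have "v \<in> (\<lambda>x. z + - x) ` frontier P" by (intro image_eqI[of _ _ "z - v"]) auto
      then show False using v that by (auto simp: F_def)
    qed
    have g2: "z - - v \<notin> frontier P" if "z \<in> int_points" for z
    proof
      assume "z - - v \<in> frontier P"
      then have "v \<in> (\<lambda>x. - z + x) ` frontier P" by (intro image_eqI[of _ _ "z - - v"]) auto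
      then show False using v that unfolding F_def by blast
    qed
    obtain e1 where e1: "e1 > 0" "\<And>v'. dist v v' < e1 \<Longrightarrow> translate_count P v' 1 = translate_count P v 1"
      using translate_count_locally_constant[OF P(1) g1] by blast
    obtain e2 where e2: "e2 > 0" "\<And>v'. dist (- v) v' < e2 \<Longrightarrow> translate_count P v' 1 = translate_count P (- v) 1"
      using translate_count_locally_constant[OF P(1) g2] by blast
    obtain c where c: "c \<in> rat_points" "dist v c < min e1 e2" using rat_points_dense[of "min e1 e2" v] e1 e2 by auto
    have "dist (- v) (- c) < e2" using c by (simp add: dist_norm norm_minus_commute)
    then show ?thesis using e1(2)[of c] e2(2)[of "- c"] sym[OF c(1)] c(2) by simp
  qed
  ultimately show ?thesis
    by (intro AE_I'[of F]) (auto simp: negligible_iff_null_sets)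
qed

definition unit_cube :: "(real ^ 'n) set" where
  "unit_cube = {x. \<forall>i. 0 \<le> x $ i \<and> x $ i < 1}"

lemma unit_cube_unique: "\<exists>!z. z \<in> int_points \<and> x - z \<in> unit_cube" for x :: "real ^ 'n"
proof (rule ex_ex1I)
  define z where "z = (\<chi> i. real_of_int \<lfloor>x $ i\<rfloor>)"
  have "z \<in> int_points" "x - z \<in> unit_cube"
    by (auto simp: z_def int_points_def unit_cube_def) linarith
  then show "\<exists>z. z \<in> int_points \<and> x - z \<in> unit_cube" by blast
next
  fix z z' assume z: "z \<in> int_points \<and> x - z \<in> unit_cube" "z' \<in> int_points \<and> x - z' \<in> unit_cube"
  have "z $ i = z' $ i" for i
  proof -
    have "z $ i - z' $ i \<in> \<int>" using z by (auto simp: int_points_def)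
    moreover have "0 \<le> x $ i - z $ i" "x $ i - z $ i < 1" "0 \<le> x $ i - z' $ i" "x $ i - z' $ i < 1"
      using z by (auto simp: unit_cube_def)
    then have "\<bar>z $ i - z' $ i\<bar> < 1" by linarith
    ultimately show ?thesis by (metis Ints_nonzero_abs_less1 right_minus_eq)
  qed
  then show "z = z'" by (simp add: vec_eq_iff)
qed

text \<open>Cutting \<open>P\<close> along the lattice translates of the unit cube.\<close>

lemma measure_periodic_unfold:
  fixes P S :: "(real ^ 'n) set"
  assumes P: "compact P" and S [measurable]: "S \<in> sets borel"
    and per: "\<And>x z. z \<in> int_points \<Longrightarrow> x + z \<in> S \<longleftrightarrow> x \<in> S"
  shows "emeasure lborel (P \<inter> S) = (\<integral>\<^sup>+x. of_nat (translate_count P (- x) 1) * indicator (S \<inter> unit_cube) x \<partial>lborel)"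
proof -
  have [measurable]: "P \<in> sets borel" using P by (simp add: compact_imp_closed)
  have [measurable]: "(unit_cube :: (real ^ 'n) set) \<in> sets borel"
    unfolding unit_cube_def by measurable
  obtain B where B: "\<And>x. x \<in> P \<Longrightarrow> norm x \<le> B" using compact_imp_bounded[OF P] unfolding bounded_iff by auto
  have cube: "norm x \<le> real CARD('n)" if "x \<in> unit_cube" for x :: "real ^ 'n"
  proof -
    have "norm x \<le> (\<Sum>i\<in>UNIV. \<bar>x $ i\<bar>)" by (rule norm_le_l1_cart)
    also have "\<dots> \<le> (\<Sum>i\<in>(UNIV :: 'n set). 1)" using that by (intro sum_mono) (auto simp: unit_cube_def intro: less_imp_le)
    finally show ?thesis by simp
  qed
  \<comment> \<open>Only these finitely many lattice vectors can carry a point of the cube into P,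
    so all sums over the lattice become finite.\<close>
  define Z where "Z = int_points \<inter> cball (0 :: real ^ 'n) (B + real CARD('n))"
  have finZ: "finite Z" unfolding Z_def by (intro finite_int_points_bounded) auto
  have inZ: "z \<in> Z" if "z \<in> int_points" "x + z \<in> P" "x \<in> unit_cube" for x z
  proof -
    have "norm z \<le> norm (x + z) + norm x" using norm_triangle_ineq4[of "x + z" x] by simp
    then show ?thesis using B[OF that(2)] cube[OF that(3)] that(1) by (simp add: Z_def)
  qed
  have split: "indicator (P \<inter> S) x = (\<Sum>z\<in>Z. indicator (P \<inter> S) x * indicator unit_cube (x - z) :: ennreal)" for x
  proof (cases "x \<in> P \<inter> S")
    case True
    obtain z where z: "z \<in> int_points" "x - z \<in> unit_cube" and u: "\<And>z'. z' \<in> int_points \<Longrightarrow> x - z' \<in> unit_cube \<Longrightarrow> z' = z"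
      using unit_cube_unique[of x] by metis
    have "z \<in> Z" using inZ[of z "x - z"] z True by simp
    have "(\<Sum>z\<in>Z. indicator (P \<inter> S) x * indicator unit_cube (x - z) :: ennreal) = (\<Sum>z'\<in>{z}. indicator (P \<inter> S) x * indicator unit_cube (x - z'))"
      by (rule sum.mono_neutral_right) (use finZ \<open>z \<in> Z\<close> u in \<open>auto simp: Z_def split: split_indicator\<close>)
    then show ?thesis using True z by simp
  qed simp
  have "emeasure lborel (P \<inter> S) = (\<integral>\<^sup>+x. (\<Sum>z\<in>Z. indicator (P \<inter> S) x * indicator unit_cube (x - z)) \<partial>lborel)"
    using split by (simp flip: nn_integral_indicator)
  also have "\<dots> = (\<Sum>z\<in>Z. \<integral>\<^sup>+x. indicator (P \<inter> S) x * indicator unit_cube (x - z) \<partial>lborel)"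
    by (rule nn_integral_sum) measurable
  also have "\<dots> = (\<Sum>z\<in>Z. \<integral>\<^sup>+x. indicator P (x + z) * indicator (S \<inter> unit_cube) x \<partial>lborel)"
  proof (rule sum.cong[OF refl])
    fix z assume "z \<in> Z"
    then have z: "z \<in> int_points" by (simp add: Z_def)
    have "(\<integral>\<^sup>+x. indicator (P \<inter> S) x * indicator unit_cube (x - z) \<partial>lborel)
       = (\<integral>\<^sup>+x. indicator (P \<inter> S) x * indicator unit_cube (x - z) \<partial>distr lborel borel ((+) z))"
      by (simp only: lborel_distr_plus)
    also have "\<dots> = (\<integral>\<^sup>+x. indicator (P \<inter> S) (z + x) * indicator unit_cube (z + x - z) \<partial>lborel)"
      by (subst nn_integral_distr) auto
    also have "\<dots> = (\<integral>\<^sup>+x. indicator P (x + z) * indicator (S \<inter> unit_cube) x \<partial>lborel)"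
      by (rule nn_integral_cong) (auto simp: add.commute per[OF z] split: split_indicator)
    finally show "(\<integral>\<^sup>+x. indicator (P \<inter> S) x * indicator unit_cube (x - z) \<partial>lborel)
       = (\<integral>\<^sup>+x. indicator P (x + z) * indicator (S \<inter> unit_cube) x \<partial>lborel)" .
  qed
  also have "\<dots> = (\<integral>\<^sup>+x. (\<Sum>z\<in>Z. indicator P (x + z) * indicator (S \<inter> unit_cube) x) \<partial>lborel)"
    by (rule nn_integral_sum[symmetric]) measurable
  also have "\<dots> = (\<integral>\<^sup>+x. of_nat (translate_count P (- x) 1) * indicator (S \<inter> unit_cube) x \<partial>lborel)"
  proof (rule nn_integral_cong)
    fix x :: "real ^ 'n"
    show "(\<Sum>z\<in>Z. indicator P (x + z) * indicator (S \<inter> unit_cube) x) = of_nat (translate_count P (- x) 1) * (indicator (S \<inter> unit_cube) x :: ennreal)"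
    proof (cases "x \<in> S \<inter> unit_cube")
      case True
      then have "{z \<in> int_points. z - - x \<in> P} = {z \<in> Z. x + z \<in> P}"
        using inZ by (auto simp: Z_def add.commute)
      then have "of_nat (translate_count P (- x) 1) = (\<Sum>z\<in>{z \<in> Z. x + z \<in> P}. 1 :: ennreal)"
        by (simp add: translate_count_1)
      also have "\<dots> = (\<Sum>z\<in>Z. indicator P (x + z))"
        using finZ by (simp add: sum.inter_filter indicator_def Int_def)
      finally show ?thesis using True by simp
    qed simp
  qed
  finally show ?thesis .
qed

text \<open>Unfolding turns both volumes into integrals over the unit cube. Reflecting P amounts to
  changing the sign of the translation, so the weights are the counts for -x and for x, which agree
  almost everywhere.\<close>

lemma measure_periodic_symmetric:
  fixes P S :: "(real ^ 'n) set"
  assumes P: "compact P" "convex P"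
    and sym: "\<And>c. c \<in> rat_points \<Longrightarrow> translate_count P (- c) 1 = translate_count P c 1"
    and S [measurable]: "S \<in> sets borel" and per: "\<And>x z. z \<in> int_points \<Longrightarrow> x + z \<in> S \<longleftrightarrow> x \<in> S"
  shows "emeasure lborel (P \<inter> S) = emeasure lborel (uminus ` P \<inter> S)"
proof -
  have cm: "compact (uminus ` P)" using P by (simp add: compact_negations)
  have tm: "translate_count (uminus ` P) (- x) 1 = translate_count P x 1" for x
  proof -
    have um: "uminus ` S = {z. - z \<in> S}" for S :: "(real ^ 'n) set"
    proof (intro equalityI subsetI)
      show "z \<in> uminus ` S" if "z \<in> {z. - z \<in> S}" for z
        using that by (intro image_eqI[of _ _ "- z"]) auto
    qed auto
    have "- (z - - x) = - z - x" for z by simp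
    then have "{z \<in> int_points. z - - x \<in> uminus ` P} = uminus ` {z \<in> int_points. z - x \<in> P}"
      unfolding um by (simp add: int_points_minus_iff del: minus_diff_eq)
    then have "bij_betw uminus {z \<in> int_points. z - x \<in> P} {z \<in> int_points. z - - x \<in> uminus ` P}"
      by (simp add: bij_betw_def inj_on_def)
    from bij_betw_same_card[OF this] show ?thesis by (simp add: translate_count_1)
  qed
  have AEl: "AE v in lborel. translate_count P (- v) 1 = translate_count P v 1"
    using translate_count_symmetric_AE[OF P sym] by (simp add: AE_completion_iff)
  have "emeasure lborel (P \<inter> S) = (\<integral>\<^sup>+x. of_nat (translate_count P (- x) 1) * indicator (S \<inter> unit_cube) x \<partial>lborel)"
    by (rule measure_periodic_unfold[OF P(1) S per])
  also have "\<dots> = (\<integral>\<^sup>+x. of_nat (translate_count (uminus ` P) (- x) 1) * indicator (S \<inter> unit_cube) x \<partial>lborel)"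
    by (rule nn_integral_cong_AE) (use AEl in \<open>auto simp: tm[simplified] elim!: eventually_mono\<close>)
  also have "\<dots> = emeasure lborel (uminus ` P \<inter> S)"
    by (rule measure_periodic_unfold[OF cm S per, symmetric])
  finally show ?thesis .
qed

section \<open>From lattice point counts to central symmetry\<close>

text \<open>\<psi> extends a -> 1 to a functional on the reals as a vector space over the rationals.
  It takes the place of elimination: applied to real data that satisfy linear relations with
  rational coefficients, it yields rational data satisfying the same relations.\<close>

lemma ex_rat_functional:
  fixes a :: real
  assumes "a \<noteq> 0"
  obtains \<psi> :: "real \<Rightarrow> real" where "\<And>x. \<psi> x \<in> \<rat>" "\<And>x y. \<psi> (x + y) = \<psi> x + \<psi> y"
    "\<And>q x. q \<in> \<rat> \<Longrightarrow> \<psi> (q * x) = q * \<psi> x" "\<psi> a = 1"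
proof -
  interpret vector_space_pair "\<lambda>(q::rat) (r::real). of_rat q * r" "(*) :: rat \<Rightarrow> rat \<Rightarrow> rat"
    by unfold_locales (simp_all add: algebra_simps of_rat_add of_rat_mult)
  have "vs1.independent {a}"
    using assms by (simp add: vs1.independent_insert)
  from linear_independent_extend[OF this, of "\<lambda>_. 1"]
  obtain g where g: "Vector_Spaces.linear (\<lambda>(q::rat) (r::real). of_rat q * r) ((*) :: rat \<Rightarrow> rat \<Rightarrow> rat) g" "g a = 1" by auto
  interpret g: Vector_Spaces.linear "\<lambda>(q::rat) (r::real). of_rat q * r" "(*) :: rat \<Rightarrow> rat \<Rightarrow> rat" g by (rule g(1))
  show ?thesis
  proof (rule that[of "\<lambda>x. of_rat (g x)"])
    show "of_rat (g (x + y)) = (of_rat (g x) + of_rat (g y) :: real)" for x y by (simp add: g.add of_rat_add)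
    show "of_rat (g (q * x)) = (q * of_rat (g x) :: real)" if q: "q \<in> \<rat>" for q x
    proof -
      obtain r where "q = of_rat r" using q by (elim Rats_cases)
      then show ?thesis using g.scale[of r x] by (simp add: of_rat_mult)
    qed
  qed (use g(2) in auto)
qed

lemma rat_functional_sum:
  fixes \<psi> :: "real \<Rightarrow> real"
  assumes "\<And>x y. \<psi> (x + y) = \<psi> x + \<psi> y"
  shows "\<psi> (\<Sum>i\<in>I. f i) = (\<Sum>i\<in>I. \<psi> (f i))"
proof -
  have "\<psi> 0 = 0" using assms[of 0 0] by simp
  then show ?thesis by (induction I rule: infinite_finite_induct) (simp_all add: assms)
qed

text \<open>Applying \<psi> to the coordinates of u gives a rational vector w whose inner product
  with a lattice point x is \<psi> (u \<bullet> x). Hence w \<bullet> x is constant on T, and as T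
  spans a hyperplane, w is a multiple of u. It is nonzero because \<psi> sends a nonzero coordinate
  of u to 1.\<close>

lemma rational_normal:
  fixes u :: "real ^ 'n" and T :: "(real ^ 'n) set"
  assumes u: "u \<noteq> 0" and T: "T \<subseteq> int_points" "T \<subseteq> {x. u \<bullet> x = b}" and dim: "aff_dim T = int (CARD('n)) - 1"
  shows "\<exists>\<kappa>>0. \<kappa> *\<^sub>R u \<in> int_points"
proof -
  obtain i where i: "u $ i \<noteq> 0" using u by (auto simp: vec_eq_iff)
  obtain \<psi> where \<psi>: "\<And>x. \<psi> x \<in> \<rat>" "\<And>x y. \<psi> (x + y) = \<psi> x + \<psi> y" "\<And>q x. q \<in> \<rat> \<Longrightarrow> \<psi> (q * x) = q * \<psi> x" "\<psi> (u $ i) = 1"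
    using ex_rat_functional[OF i] by blast
  define w where "w = (\<chi> j. \<psi> (u $ j))"
  have w: "w \<in> rat_points" "w \<noteq> 0" using \<psi> by (auto simp: w_def rat_points_def vec_eq_iff intro!: exI[of _ i])
  have wx: "w \<bullet> x = \<psi> (u \<bullet> x)" if "x \<in> int_points" for x
  proof -
    have "u \<bullet> x = (\<Sum>j\<in>UNIV. x $ j * u $ j)" by (simp add: inner_vec_def mult.commute)
    then have "\<psi> (u \<bullet> x) = (\<Sum>j\<in>UNIV. \<psi> (x $ j * u $ j))" by (simp add: rat_functional_sum[OF \<psi>(2)])
    also have "\<dots> = (\<Sum>j\<in>UNIV. x $ j * \<psi> (u $ j))"
      using that Ints_subset_Rats by (intro sum.cong refl \<psi>(3)) (auto simp: int_points_def)
    finally show ?thesis by (simp add: w_def inner_vec_def mult.commute)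
  qed
  have hyp: "affine hull T = {x. v \<bullet> x = c}" if "v \<noteq> 0" "T \<subseteq> {x. v \<bullet> x = c}" for v c
  proof (rule affine_dim_equal)
    show "affine hull T \<noteq> {}"
    proof -
      have "CARD('n) > 0" by simp
      then have "aff_dim T \<noteq> -1" using dim by linarith
      then show ?thesis by (auto simp: aff_dim_empty)
    qed
    show "affine hull T \<subseteq> {x. v \<bullet> x = c}" using that(2) by (intro hull_minimal affine_hyperplane)
    show "aff_dim (affine hull T) = aff_dim {x. v \<bullet> x = c}" using that(1) dim by simp
  qed (simp_all add: affine_hyperplane)
  have "T \<subseteq> {x. w \<bullet> x = \<psi> b}" using T wx by auto
  then have eq: "{x. u \<bullet> x = b} = {x. w \<bullet> x = \<psi> b}" using hyp[OF u T(2)] hyp[OF w(2)] by simp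
  have "\<exists>k. w = k *\<^sub>R u"
  proof (rule ccontr)
    assume "\<nexists>k. w = k *\<^sub>R u"
    then obtain q where q: "u \<bullet> q = 0" "w \<bullet> q = 1" using ex_dual_vector[of w u] by blast
    define x where "x = (b / (u \<bullet> u)) *\<^sub>R u"
    have "u \<bullet> x = b" "u \<bullet> (x + q) = b" using u q by (simp_all add: x_def inner_add_right)
    then have "w \<bullet> x = \<psi> b" "w \<bullet> (x + q) = \<psi> b" using eq by blast+
    then show False using q by (simp add: inner_add_right)
  qed
  then obtain k where k: "w = k *\<^sub>R u" by blast
  then have k0: "k \<noteq> 0" using w by auto
  obtain d :: nat where d: "d > 0" "real d *\<^sub>R w \<in> int_points" by (rule rat_points_denominator[OF w(1)])
  have "(real d * \<bar>k\<bar>) *\<^sub>R u \<in> int_points"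
  proof (cases "k > 0")
    case True then show ?thesis using d k by simp
  next
    case False
    then have "(real d * \<bar>k\<bar>) *\<^sub>R u = - (real d *\<^sub>R w)" using k by simp
    then show ?thesis using int_points_minus[OF d(2)] by simp
  qed
  then show ?thesis using d k0 by (intro exI[of _ "real d * \<bar>k\<bar>"]) auto
qed

lemma rational_slab_description:
  fixes V :: "(real ^ 'n) set"
  assumes V: "finite V" "V \<subseteq> int_points" and int: "interior (convex hull V) \<noteq> {}"
  obtains N R where "slab_polytope (convex hull V) N (\<lambda>u. Max ((\<lambda>v. u \<bullet> v) ` V)) R"
    "\<And>u. u \<in> N \<Longrightarrow> \<exists>\<kappa>>0. \<kappa> *\<^sub>R u \<in> int_points"
proof -
  let ?P = "convex hull V"
  let ?h = "\<lambda>u. Max ((\<lambda>v. u \<bullet> v) ` V)"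
  have ne: "V \<noteq> {}" using int by auto
  have affP: "affine hull ?P = UNIV" by (rule affine_hull_nonempty_interior[OF int])
  have h: "u \<bullet> x \<le> ?h u" if "x \<in> ?P" for u x
  proof -
    have "?P \<subseteq> {x. u \<bullet> x \<le> ?h u}"
      by (rule hull_minimal) (use V in \<open>auto intro: Max_ge convex_halfspace_le\<close>)
    then show ?thesis using that by auto
  qed
  have h_att: "\<exists>v\<in>V. ?h u = u \<bullet> v" for u
  proof -
    have "?h u \<in> (\<lambda>v. u \<bullet> v) ` V" by (rule Max_in) (use V ne in auto)
    then show ?thesis by blast
  qed
  have "polytope ?P" using V by (auto simp: polytope_def)
  then have "polyhedron ?P" by (rule polytope_imp_polyhedron)
  \<comment> \<open>Minimality of F ensures that each half-space cuts out a facet. A facet is the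
    hull of some of the lattice points in V, which span its hyperplane and so make the normal
    rational up to scaling.\<close>
  then obtain F where F: "finite F" "?P = affine hull ?P \<inter> \<Inter>F" "\<forall>f\<in>F. \<exists>a b. a \<noteq> 0 \<and> f = {x. a \<bullet> x \<le> b}"
      "\<And>F'. F' \<subset> F \<Longrightarrow> ?P \<subset> affine hull ?P \<inter> \<Inter>F'"
    unfolding polyhedron_Int_affine_minimal by blast
  obtain a b where ab: "\<And>f. f \<in> F \<Longrightarrow> a f \<noteq> 0 \<and> f = {x. a f \<bullet> x \<le> b f}" using F(3) by metis
  have PF: "?P = \<Inter>F" using F(2) by (simp only: affP Int_UNIV_left)
  define N where "N = (\<lambda>f. a f /\<^sub>R norm (a f)) ` F \<union> (\<lambda>f. - (a f /\<^sub>R norm (a f))) ` F"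
  obtain R where R: "\<And>x. x \<in> ?P \<Longrightarrow> norm x \<le> R"
    using compact_imp_bounded[OF finite_imp_compact_convex_hull[OF V(1)]] unfolding bounded_iff by blast
  have rat: "\<exists>\<kappa>>0. \<kappa> *\<^sub>R (a f /\<^sub>R norm (a f)) \<in> int_points" if f: "f \<in> F" for f
  proof -
    let ?c = "?P \<inter> {x. a f \<bullet> x = b f}"
    have "?c facet_of ?P"
      using facet_of_polyhedron_explicit[OF F(1,2) ab F(4)] f by blast
    then have face: "?c face_of ?P" and dim: "aff_dim ?c = aff_dim ?P - 1" by (auto simp: facet_of_def)
    obtain T where T: "T \<subseteq> V" "?c = convex hull T"
      using face_of_convex_hull_subset[OF finite_imp_compact[OF V(1)] face] by metis
    have "aff_dim ?P = int (CARD('n))"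
      using aff_dim_nonempty_interior[OF int] by simp
    then have "aff_dim T = int (CARD('n)) - 1" using dim T(2) by (metis aff_dim_convex_hull)
    moreover have "T \<subseteq> {x. a f \<bullet> x = b f}" using T(2) hull_subset[of T convex] by blast
    ultimately obtain \<kappa> where \<kappa>: "\<kappa> > 0" "\<kappa> *\<^sub>R a f \<in> int_points"
      using rational_normal[of "a f" T "b f"] ab[OF f] T(1) V(2) by blast
    have eq: "(\<kappa> * norm (a f)) *\<^sub>R (a f /\<^sub>R norm (a f)) = \<kappa> *\<^sub>R a f" using ab[OF f] by simp
    have "(\<kappa> * norm (a f)) *\<^sub>R (a f /\<^sub>R norm (a f)) \<in> int_points" unfolding eq by (rule \<kappa>(2))
    moreover have "0 < \<kappa> * norm (a f)" using \<kappa>(1) ab[OF f] by simp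
    ultimately show ?thesis by blast
  qed
  have "slab_polytope ?P N ?h (max 0 R)"
  proof
    show "finite N" using F(1) by (simp add: N_def)
    show unit: "norm u = 1" if "u \<in> N" for u using that ab by (auto simp: N_def)
    show "- u \<in> N" if "u \<in> N" for u using that by (auto simp: N_def)
    show "?P = {x. \<forall>u\<in>N. u \<bullet> x \<le> ?h u}"
    proof (intro equalityI subsetI CollectI ballI)
      show "u \<bullet> x \<le> ?h u" if "x \<in> ?P" for u x using h[OF that] .
      fix x assume x: "x \<in> {x. \<forall>u\<in>N. u \<bullet> x \<le> ?h u}"
      have "x \<in> f" if f: "f \<in> F" for f
      proof -
        let ?u = "a f /\<^sub>R norm (a f)"
        have "?u \<in> N" using f by (auto simp: N_def)
        then have "?u \<bullet> x \<le> ?h ?u" using x by blast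
        obtain v where v: "v \<in> V" "?h ?u = ?u \<bullet> v" using h_att by blast
        have "v \<in> f" using hull_inc[OF v(1), of convex] f unfolding PF by blast
        then have "a f \<bullet> v \<le> b f" using ab[OF f] by blast
        have "inverse (norm (a f)) * (a f \<bullet> x) \<le> inverse (norm (a f)) * (a f \<bullet> v)"
          using \<open>?u \<bullet> x \<le> ?h ?u\<close> v(2) by simp
        then have "a f \<bullet> x \<le> a f \<bullet> v" using ab[OF f] by (simp add: mult_le_cancel_left_pos)
        then show ?thesis using \<open>a f \<bullet> v \<le> b f\<close> ab[OF f] by fastforce
      qed
      then show "x \<in> ?P" unfolding PF by blast
    qed
    show "?P \<subseteq> cball 0 (max 0 R)" using R by (auto simp: le_max_iff_disj)
    show "0 < ?h u + ?h (- u)" if u: "u \<in> N" for u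
    proof -
      obtain x where "x \<in> interior ?P" using int by blast
      then obtain e where e: "e > 0" "cball x e \<subseteq> ?P" unfolding mem_interior_cball by blast
      have "x + e *\<^sub>R u \<in> ?P" "x \<in> ?P" using e unit[OF u] by (auto simp: dist_norm intro!: subsetD[OF e(2)])
      then have "u \<bullet> (x + e *\<^sub>R u) \<le> ?h u" "- u \<bullet> x \<le> ?h (- u)" by (intro h; simp)+
      then show ?thesis using e(1) unit[OF u] by (simp add: inner_add_right dot_square_norm)
    qed
  qed simp
  moreover have "\<exists>\<kappa>>0. \<kappa> *\<^sub>R u \<in> int_points" if u: "u \<in> N" for u
  proof -
    obtain f where f: "f \<in> F" "u = a f /\<^sub>R norm (a f) \<or> u = - (a f /\<^sub>R norm (a f))" using u by (auto simp: N_def)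
    obtain \<kappa> where \<kappa>: "\<kappa> > 0" "\<kappa> *\<^sub>R (a f /\<^sub>R norm (a f)) \<in> int_points" using rat[OF f(1)] by blast
    have "\<kappa> *\<^sub>R u \<in> int_points" using f(2) \<kappa>(2) int_points_minus[OF \<kappa>(2)] by (elim disjE) (simp_all only: scaleR_minus_right)
    then show ?thesis using \<kappa>(1) by blast
  qed
  ultimately show ?thesis using that by blast
qed

lemma int_points_inner: "x \<in> int_points \<Longrightarrow> y \<in> int_points \<Longrightarrow> x \<bullet> y \<in> \<int>"
  by (auto simp: int_points_def inner_vec_def intro!: Ints_sum Ints_mult)

text \<open>Since \<kappa> u is an integer vector, the family \<open>?S\<close> of slabs is
  periodic, and the maximum of \<kappa> u on P, attained at a point of V, is an integer. Reflection
  exchanges \<open>?S\<close> and \<open>?S'\<close>, so equal volumes of P and -P within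
  \<open>?S\<close> become equal volumes of P below and above the integer levels.\<close>

theorem centrally_symmetric_full_dim:
  fixes V :: "(real ^ 'n) set"
  assumes V: "finite V" "V \<subseteq> int_points" and int: "interior (convex hull V) \<noteq> {}"
    and sym: "\<And>c. c \<in> rat_points \<Longrightarrow> translate_count (convex hull V) (- c) 1 = translate_count (convex hull V) c 1"
  shows "centrally_symmetric (convex hull V)"
proof -
  let ?P = "convex hull V"
  let ?h = "\<lambda>u. Max ((\<lambda>v. u \<bullet> v) ` V)"
  obtain N R where sp: "slab_polytope ?P N ?h R" and rat: "\<And>u. u \<in> N \<Longrightarrow> \<exists>\<kappa>>0. \<kappa> *\<^sub>R u \<in> int_points"
    using rational_slab_description[OF V int] by metis
  interpret slab_polytope ?P N ?h R by (rule sp)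
  have ne: "V \<noteq> {}" using int by auto
  show ?thesis
  proof (rule centrally_symmetric_if_parity)
    fix u assume u: "u \<in> N"
    obtain \<kappa> where \<kappa>: "\<kappa> > 0" "\<kappa> *\<^sub>R u \<in> int_points" using rat[OF u] by blast
    have hint: "\<kappa> * ?h w \<in> \<int>" if "\<kappa> *\<^sub>R w \<in> int_points" for w
    proof -
      have "?h w \<in> (\<lambda>v. w \<bullet> v) ` V" by (rule Max_in) (use V ne in auto)
      then obtain v where v: "v \<in> V" "?h w = w \<bullet> v" by (elim imageE)
      have "(\<kappa> *\<^sub>R w) \<bullet> v \<in> \<int>" using that v V by (intro int_points_inner) auto
      then show ?thesis using v by simp
    qed
    obtain b where b: "\<kappa> * ?h u = of_int b" using hint[OF \<kappa>(2)] by (elim Ints_cases)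
    have "\<kappa> *\<^sub>R (- u) \<in> int_points" using int_points_minus[OF \<kappa>(2)] by simp
    then obtain a' where a': "\<kappa> * ?h (- u) = of_int a'" using hint by (meson Ints_cases)
    show "\<exists>C. \<forall>\<^sub>F s in at_right 0. slab u s \<le> slab (- u) s + C * s\<^sup>2"
    proof (rule slab_parity[OF u \<kappa>(1) b])
      show "\<kappa> * ?h (- u) = - of_int (- a')" using a' by simp
      fix \<delta> :: real assume \<delta>: "0 < \<delta>" "\<delta> < 1"
      let ?S = "{x. \<exists>j::int. of_int j - \<delta> \<le> \<kappa> * (u \<bullet> x) \<and> \<kappa> * (u \<bullet> x) \<le> of_int j}"
      let ?S' = "{x. \<exists>j::int. of_int j \<le> \<kappa> * (u \<bullet> x) \<and> \<kappa> * (u \<bullet> x) \<le> of_int j + \<delta>}"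
      have S [measurable]: "?S \<in> sets borel" "?S' \<in> sets borel" by measurable
      have per: "x + z \<in> ?S \<longleftrightarrow> x \<in> ?S" if z: "z \<in> int_points" for x z
      proof -
        have "(\<kappa> *\<^sub>R u) \<bullet> z \<in> \<int>" using \<kappa>(2) z by (rule int_points_inner)
        then obtain m where m: "\<kappa> * (u \<bullet> z) = of_int m" by (auto elim: Ints_cases)
        have eq: "\<kappa> * (u \<bullet> (x + z)) = \<kappa> * (u \<bullet> x) + of_int m" by (simp add: inner_add_right distrib_left m)
        show ?thesis
        proof
          assume "x + z \<in> ?S"
          then obtain j :: int where "of_int j - \<delta> \<le> \<kappa> * (u \<bullet> x) + of_int m" "\<kappa> * (u \<bullet> x) + of_int m \<le> of_int j" unfolding mem_Collect_eq eq by blast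
          then show "x \<in> ?S" by (intro CollectI exI[of _ "j - m"]) (auto simp: algebra_simps)
        next
          assume "x \<in> ?S"
          then obtain j :: int where "of_int j - \<delta> \<le> \<kappa> * (u \<bullet> x)" "\<kappa> * (u \<bullet> x) \<le> of_int j" by blast
          then show "x + z \<in> ?S" unfolding mem_Collect_eq eq by (intro exI[of _ "j + m"]) auto
        qed
      qed
      have [measurable]: "?P \<in> sets borel" using compact_P by (simp add: compact_imp_closed)
      have "uminus ` (?P \<inter> ?S') = uminus ` ?P \<inter> ?S"
      proof -
        have "x \<in> ?S' \<longleftrightarrow> - x \<in> ?S" for x
        proof
          assume "x \<in> ?S'"
          then obtain j :: int where "of_int j \<le> \<kappa> * (u \<bullet> x)" "\<kappa> * (u \<bullet> x) \<le> of_int j + \<delta>" by blast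
          then show "- x \<in> ?S" by (intro CollectI exI[of _ "- j"]) auto
        next
          assume "- x \<in> ?S"
          then obtain j :: int where "of_int j - \<delta> \<le> \<kappa> * (u \<bullet> - x)" "\<kappa> * (u \<bullet> - x) \<le> of_int j" by blast
          then show "x \<in> ?S'" by (intro CollectI exI[of _ "- j"]) auto
        qed
        then show ?thesis by blast
      qed
      then have "measure lborel (?P \<inter> ?S') = measure lborel (uminus ` ?P \<inter> ?S)"
        using measure_lborel_uminus[of "?P \<inter> ?S'"] by simp
      also have "\<dots> = measure lborel (?P \<inter> ?S)"
        using measure_periodic_symmetric[OF compact_P convex_P sym S(1) per] by (simp add: measure_def)
      finally show "measure lebesgue (?P \<inter> ?S) = measure lebesgue (?P \<inter> ?S')"
        by (simp add: measure_completion)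
    qed
  next
    have "\<not> negligible ?P" using int open_not_negligible[OF open_interior] negligible_subset interior_subset by metis
    then show "measure lebesgue ?P > 0"
      using lmeasurable_compact[OF compact_P] by (metis measure_nonneg negligible_iff_measure order_less_le)
  qed
qed


section \<open>Reduction to full-dimensional polytopes\<close>

lemma translate_count_sum:
  fixes P Q :: "(real ^ 'n) set"
  assumes P: "bounded P" and fin: "finite {z \<in> int_points. z - c \<in> {p + w | p w. p \<in> P \<and> w \<in> Q}}"
    and \<omega>: "\<And>p w. p \<in> P \<Longrightarrow> w \<in> Q \<Longrightarrow> \<omega> (p + w) = w"
  defines "S \<equiv> {w \<in> Q. translate_count P (c + w) 1 \<noteq> 0}"
  shows "finite S" "translate_count {p + w | p w. p \<in> P \<and> w \<in> Q} c 1 = (\<Sum>w\<in>S. translate_count P (c + w) 1)"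
    "S = \<omega> ` (\<lambda>z. z - c) ` {z \<in> int_points. z - c \<in> {p + w | p w. p \<in> P \<and> w \<in> Q}}"
proof -
  let ?Z = "{z \<in> int_points. z - c \<in> {p + w | p w. p \<in> P \<and> w \<in> Q}}"
  let ?F = "\<lambda>w. {z \<in> int_points. z - (c + w) \<in> P}"
  have finF: "finite (?F w)" for w using P by (rule finite_translate)
  have S: "w \<in> S \<longleftrightarrow> w \<in> Q \<and> ?F w \<noteq> {}" for w
    using finF[of w] by (simp add: S_def translate_count_1 card_eq_0_iff)
  \<comment> \<open>\<omega> recovers the component in Q from a point of P + Q, so every lattice
    point of c + P + Q belongs to exactly one w. Describing \<open>S\<close> through lattice points
    is what later shows that the relevant w are rational.\<close>
  have F\<omega>: "\<omega> (z - c) = w \<and> z \<in> ?Z" if "w \<in> Q" "z \<in> ?F w" for w z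
  proof -
    have eq: "z - c = (z - (c + w)) + w" and p: "z - (c + w) \<in> P" using that by simp_all
    then have "z - c \<in> {p + w | p w. p \<in> P \<and> w \<in> Q}" using that(1) by blast
    moreover have "\<omega> (z - c) = w" by (subst eq) (rule \<omega>[OF p that(1)])
    ultimately show ?thesis using that(2) by blast
  qed
  have F\<omega>': "\<omega> (z - c) \<in> Q \<and> z \<in> ?F (\<omega> (z - c))" if "z \<in> ?Z" for z
  proof -
    obtain p w where z: "z \<in> int_points" "p \<in> P" "w \<in> Q" "z - c = p + w" using \<open>z \<in> ?Z\<close> by blast
    have "\<omega> (z - c) = w" unfolding z(4) by (rule \<omega>[OF z(2,3)])
    moreover have "z - (c + w) = p" unfolding diff_diff_eq[symmetric] z(4) by simp
    ultimately show ?thesis using z by simp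
  qed
  show S_eq: "S = \<omega> ` (\<lambda>z. z - c) ` ?Z"
  proof (intro equalityI subsetI)
    fix w assume "w \<in> S"
    then obtain z where "w \<in> Q" "z \<in> ?F w" unfolding S by blast
    then have "\<omega> (z - c) = w" "z \<in> ?Z" using F\<omega> by blast+
    then show "w \<in> \<omega> ` (\<lambda>z. z - c) ` ?Z" by blast
  next
    fix w assume "w \<in> \<omega> ` (\<lambda>z. z - c) ` ?Z"
    then obtain z where "z \<in> ?Z" "w = \<omega> (z - c)" by blast
    then show "w \<in> S" unfolding S using F\<omega>'[of z] by blast
  qed
  show finS: "finite S" unfolding S_eq using fin by (intro finite_imageI)
  have "?Z = (\<Union>w\<in>S. ?F w)"
  proof (intro equalityI subsetI)
    fix z assume "z \<in> ?Z"
    then show "z \<in> (\<Union>w\<in>S. ?F w)" using F\<omega>'[of z] S[of "\<omega> (z - c)"] by blast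
  next
    fix z assume "z \<in> (\<Union>w\<in>S. ?F w)"
    then show "z \<in> ?Z" using F\<omega> S by blast
  qed
  moreover have "card (\<Union>w\<in>S. ?F w) = (\<Sum>w\<in>S. card (?F w))"
  proof (rule card_UN_disjoint[OF finS])
    show "\<forall>i\<in>S. \<forall>j\<in>S. i \<noteq> j \<longrightarrow> ?F i \<inter> ?F j = {}"
    proof (intro ballI impI)
      fix i j assume "i \<in> S" "j \<in> S" "i \<noteq> j"
      then show "?F i \<inter> ?F j = {}" using F\<omega>[of i] F\<omega>[of j] S by blast
    qed
  qed (use finF in blast)
  ultimately show "translate_count {p + w | p w. p \<in> P \<and> w \<in> Q} c 1 = (\<Sum>w\<in>S. translate_count P (c + w) 1)"
    by (simp add: translate_count_1)
qed

lemma int_points_subset_rat_points: "int_points \<subseteq> rat_points"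
  using Ints_subset_Rats by (auto simp: int_points_def rat_points_def)

text \<open>
  A \<open>\<rat>\<close>-linear \<open>\<psi>\<close> with \<open>\<psi> 1 = 1\<close>, applied to the real coefficients, gives a second representation of
  \<open>x\<close>.
\<close>

lemma rational_representation:
  fixes B :: "(real ^ 'n) set"
  assumes B: "independent B" "span B = UNIV" "B \<subseteq> int_points" and x: "x \<in> rat_points"
  shows "representation B x b \<in> \<rat>"
proof -
  obtain \<psi> :: "real \<Rightarrow> real" where \<psi>: "\<And>x. \<psi> x \<in> \<rat>" "\<And>x y. \<psi> (x + y) = \<psi> x + \<psi> y"
      "\<And>q x. q \<in> \<rat> \<Longrightarrow> \<psi> (q * x) = q * \<psi> x" "\<psi> 1 = 1"
    using ex_rat_functional[of 1] by (metis zero_neq_one)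
  have finB: "finite B" using B(1) by (rule independent_imp_finite)
  let ?r = "representation B x"
  have x_eq: "x = (\<Sum>b\<in>B. ?r b *\<^sub>R b)"
    using sum_representation_eq[OF B(1) _ finB subset_refl, of x] B(2) by simp
  have "x = (\<Sum>b\<in>B. \<psi> (?r b) *\<^sub>R b)"
  proof (rule vec_eq_iff[THEN iffD2, rule_format])
    fix i
    have "x $ i = \<psi> (x $ i)" using \<psi>(3)[of "x $ i" 1] \<psi>(4) x by (simp add: rat_points_def)
    also have "\<psi> (x $ i) = \<psi> (\<Sum>b\<in>B. b $ i * ?r b)"
      using arg_cong[OF x_eq, of "\<lambda>x. x $ i"] by (simp add: mult.commute)
    also have "\<dots> = (\<Sum>b\<in>B. \<psi> (b $ i * ?r b))" by (rule rat_functional_sum[OF \<psi>(2)])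
    also have "\<dots> = (\<Sum>b\<in>B. b $ i * \<psi> (?r b))"
      using B(3) Ints_subset_Rats by (intro sum.cong refl \<psi>(3)) (auto simp: int_points_def)
    finally show "x $ i = (\<Sum>b\<in>B. \<psi> (?r b) *\<^sub>R b) $ i" by (simp add: mult.commute)
  qed
  then have "(\<Sum>b\<in>B. (?r b - \<psi> (?r b)) *\<^sub>R b) = 0"
    using x_eq by (simp add: scaleR_diff_left sum_subtractf)
  then have "?r b = \<psi> (?r b)" if "b \<in> B" for b
    using B(1) finB that independent_explicit[of B] by (auto dest!: spec[of _ "\<lambda>b. ?r b - \<psi> (?r b)"])
  then show ?thesis using \<psi>(1)[of "?r b"] representation_ne_zero[of B x b]
    by (cases "b \<in> B"; cases "?r b = 0") auto
qed

text \<open>C spans the directions of P, E completes it to a basis of integer vectors, and \<rho> is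
  the projection onto the span of E along that of C. As \<rho> is constant on P and the identity on
  Q, P + Q splits into the parallel copies w + P. The copy for w at the translation c is matched
  with the copy for -w at the translation -c.\<close>

theorem centrally_symmetric_if_translate_count:
  fixes V :: "(real ^ 'n) set"
  assumes V: "finite V" "V \<subseteq> int_points" "V \<noteq> {}"
    and sym: "\<And>c. c \<in> rat_points \<Longrightarrow> translate_count (convex hull V) (- c) 1 = translate_count (convex hull V) c 1"
  shows "centrally_symmetric (convex hull V)"
proof -
  let ?P = "convex hull V"
  obtain p0 where p0: "p0 \<in> V" using V by blast
  let ?D = "(\<lambda>x. x - p0) ` V"
  let ?A = "range (\<lambda>i. axis i 1) :: (real ^ 'n) set"
  obtain C where C: "C \<subseteq> ?D" "independent C" "?D \<subseteq> span C" by (rule maximal_independent_subset)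
  obtain B where B: "C \<subseteq> B" "B \<subseteq> C \<union> ?A" "independent B" "C \<union> ?A \<subseteq> span B"
    by (rule maximal_independent_subset_extend[of C "C \<union> ?A"]) (use C in auto)
  have spanA: "span ?A = UNIV"
  proof -
    have "Basis \<subseteq> ?A" by (auto simp: Basis_vec_def)
    then show ?thesis using span_Basis span_mono by blast
  qed
  have spanB: "span B = UNIV"
    using B(4) spanA by (metis Un_subset_iff span_mono span_span top.extremum_unique)
  have finB: "finite B" using B(3) by (rule independent_imp_finite)
  have Bint: "B \<subseteq> int_points"
  proof -
    have "?D \<subseteq> int_points" using V(2) p0 by (auto intro: int_points_diff)
    then have "C \<subseteq> int_points" using C(1) by blast
    moreover have "?A \<subseteq> int_points" by (auto simp: int_points_def axis_def)
    ultimately show ?thesis using B(2) by blast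
  qed
  define E where "E = B - C"
  \<comment> \<open>The hull is the cross-polytope on E. With 0 among the generators it is nonempty
    even if E is empty, and P is contained in P + Q.\<close>
  define U where "U = insert 0 (E \<union> uminus ` E)"
  let ?Q = "convex hull U"
  have finU: "finite U" and Uint: "U \<subseteq> int_points"
    using finB Bint by (auto simp: U_def E_def int_points_0 int_points_minus_iff)
  have Qsym: "- w \<in> ?Q" if "w \<in> ?Q" for w
  proof -
    have "uminus ` U = U" unfolding U_def image_insert image_Un image_image by auto
    then have "uminus ` ?Q = ?Q" using convex_hull_linear_image[OF linear_uminus, of U] by simp
    then show ?thesis using that by blast
  qed
  define \<rho> where "\<rho> x = (\<Sum>b\<in>E. representation B x b *\<^sub>R b)" for x
  have lin: "linear \<rho>"
    unfolding \<rho>_def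
    by (rule linearI) (simp_all add: representation_add[OF B(3)] representation_scale[OF B(3)] spanB scaleR_add_left sum.distrib scaleR_sum_right)
  have \<rho>C: "\<rho> b = 0" if "b \<in> C" for b
  proof -
    have "representation B b b' = 0" if "b' \<in> E" for b'
      using representation_basis[OF B(3), of b] \<open>b \<in> C\<close> B(1) that by (auto simp: E_def)
    then show ?thesis by (simp add: \<rho>_def)
  qed
  have \<rho>E: "\<rho> b = b" if b: "b \<in> E" for b
  proof -
    have "\<rho> b = (\<Sum>b'\<in>E. (if b' = b then 1 else 0) *\<^sub>R b')"
      using representation_basis[OF B(3), of b] b unfolding \<rho>_def by (intro sum.cong) (auto simp: E_def)
    also have "\<dots> = b" using b finB by (simp add: E_def if_distrib[of "\<lambda>c. c *\<^sub>R _"] sum.delta cong: if_cong)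
    finally show ?thesis .
  qed
  have \<rho>Q: "\<rho> w = w" if "w \<in> ?Q" for w
  proof -
    have "\<rho> x = x" if "x \<in> U" for x
      using that \<rho>E lin by (auto simp: U_def linear_0 linear_neg)
    then have "U \<subseteq> {x. \<rho> x = x}" by blast
    moreover have "convex {x. \<rho> x = x}"
      using lin by (intro convexI) (simp add: linear_add linear_scale)
    ultimately have "?Q \<subseteq> {x. \<rho> x = x}" by (rule hull_minimal)
    then show ?thesis using that by blast
  qed
  have \<rho>D: "\<rho> (x - p0) = 0" if "x \<in> V" for x
  proof -
    have "x - p0 \<in> span C" using C(3) that by blast
    moreover have "subspace {x. \<rho> x = 0}" using lin by (rule linear_subspace_kernel)
    ultimately show ?thesis using span_minimal[of C "{x. \<rho> x = 0}"] \<rho>C by blast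
  qed
  have \<rho>P: "\<rho> p = \<rho> p0" if "p \<in> ?P" for p
  proof -
    have "V \<subseteq> {x. \<rho> x = \<rho> p0}" using \<rho>D lin by (auto simp: linear_diff)
    moreover have "convex {x. \<rho> x = \<rho> p0}"
      using lin by (intro convexI) (simp add: linear_add linear_scale flip: scaleR_add_left)
    ultimately have "?P \<subseteq> {x. \<rho> x = \<rho> p0}" by (rule hull_minimal)
    then show ?thesis using that by blast
  qed
  define V' where "V' = {x + y | x y. x \<in> V \<and> y \<in> U}"
  let ?P' = "convex hull V'"
  have P': "?P' = {p + w | p w. p \<in> ?P \<and> w \<in> ?Q}"
  proof -
    have "V' = V + U" by (auto simp: V'_def set_plus_def)
    then have "?P' = ?P + ?Q" by (simp only: convex_hull_set_plus)
    then show ?thesis by (auto simp: set_plus_def)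
  qed
  have V'im: "V' = (\<lambda>(x, y). x + y) ` (V \<times> U)" by (auto simp: V'_def)
  have V': "finite V'" "V' \<subseteq> int_points"
    using V finU Uint by (auto simp: V'im intro!: int_points_add)
  have bP: "bounded ?P" using V by (intro compact_imp_bounded finite_imp_compact_convex_hull)
  have bP': "bounded ?P'" using V' by (intro compact_imp_bounded finite_imp_compact_convex_hull)
  have "interior ?P' \<noteq> {}"
  proof
    assume "interior ?P' = {}"
    then obtain a b where ab: "a \<noteq> 0" "?P' \<subseteq> {x. a \<bullet> x = b}"
      using empty_interior_subset_hyperplane[OF convex_convex_hull] by metis
    have av: "a \<bullet> (x + y) = b" if "x \<in> V" "y \<in> U" for x y
    proof -
      have "x + y \<in> ?P'" using that by (intro hull_inc) (auto simp: V'_def)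
      then show ?thesis using ab(2) by blast
    qed
    have U0: "0 \<in> U" by (simp add: U_def)
    have "a \<bullet> y = 0" if "y \<in> B" for y
    proof (cases "y \<in> C")
      case True
      then obtain x where "x \<in> V" "y = x - p0" using C(1) by blast
      then show ?thesis using av[OF _ U0] p0 by (simp add: inner_diff_right)
    next
      case False
      then have "y \<in> U" using that by (simp add: U_def E_def)
      then show ?thesis using av[OF p0 \<open>y \<in> U\<close>] av[OF p0 U0] by (simp add: inner_add_right)
    qed
    then have "orthogonal a y" if "y \<in> B" for y using that by (simp add: orthogonal_def)
    then have "orthogonal a a" using orthogonal_to_span[of a B a] spanB by auto
    then show False using ab(1) by (simp add: orthogonal_self)
  qed
  moreover have "translate_count ?P' (- c) 1 = translate_count ?P' c 1" if c: "c \<in> rat_points" for c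
  proof -
    define \<omega> where "\<omega> x = \<rho> x - \<rho> p0" for x
    have \<omega>: "\<omega> (p + w) = w" if "p \<in> ?P" "w \<in> ?Q" for p w
      using \<rho>P[OF that(1)] \<rho>Q[OF that(2)] lin by (simp add: \<omega>_def linear_add)
    let ?S = "\<lambda>c. {w \<in> ?Q. translate_count ?P (c + w) 1 \<noteq> 0}"
    have fin: "finite {z \<in> int_points. z - d \<in> {p + w | p w. p \<in> ?P \<and> w \<in> ?Q}}" for d
      unfolding P'[symmetric] using bP' by (rule finite_translate)
    note ts = translate_count_sum[OF bP fin, where \<omega> = \<omega>]
    \<comment> \<open>Symmetry of the counts is given only at rational translations, while w ranges
      over a real polytope. But only those w contribute for which some lattice point lies in d + w +
      P, and each of these is the image under \<rho> of a rational vector.\<close>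
    have rat: "w \<in> rat_points" if d: "d \<in> rat_points" and w: "w \<in> ?S d" for d w
    proof -
      have "w \<in> \<omega> ` (\<lambda>z. z - d) ` {z \<in> int_points. z - d \<in> {p + w | p w. p \<in> ?P \<and> w \<in> ?Q}}"
        using w by (simp only: ts(3)[OF \<omega>])
      then obtain z where z: "z \<in> int_points" "w = \<omega> (z - d)" by blast
      have "w = \<rho> (z - d - p0)" using lin by (simp add: z(2) \<omega>_def linear_diff)
      moreover have "z - d - p0 \<in> rat_points"
      proof -
        have "z \<in> rat_points" "p0 \<in> rat_points" using z(1) V(2) p0 int_points_subset_rat_points by blast+
        then show ?thesis using d by (simp add: rat_points_def)
      qed
      then have "representation B (z - d - p0) b \<in> \<rat>" for b by (rule rational_representation[OF B(3) spanB Bint])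
      ultimately show ?thesis
      proof -
        have "E \<subseteq> rat_points" using Bint int_points_subset_rat_points by (auto simp: E_def)
        then show ?thesis unfolding \<open>w = \<rho> (z - d - p0)\<close> \<rho>_def rat_points_def
          using \<open>\<And>b. representation B (z - d - p0) b \<in> \<rat>\<close>
          by (auto intro!: Rats_sum Rats_mult simp: rat_points_def subset_iff)
      qed
    qed
    have step: "- w \<in> ?S (- d) \<and> translate_count ?P (- d + - w) 1 = translate_count ?P (d + w) 1"
      if d: "d \<in> rat_points" and w: "w \<in> ?S d" for d w
    proof -
      have "d + w \<in> rat_points" using d rat[OF d w] by (auto simp: rat_points_def)
      moreover have "- d + - w = - (d + w)" by simp
      ultimately have eq: "translate_count ?P (- d + - w) 1 = translate_count ?P (d + w) 1" using sym by (simp only:)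
      have "w \<in> ?Q" "translate_count ?P (d + w) 1 \<noteq> 0" using w by blast+
      then show ?thesis using Qsym unfolding mem_Collect_eq eq by blast
    qed
    have mc: "- c \<in> rat_points" using c by (auto simp: rat_points_def)
    have "translate_count ?P' (- c) 1 = (\<Sum>w\<in>?S (- c). translate_count ?P (- c + w) 1)" unfolding P' by (rule ts(2)[OF \<omega>])
    also have "\<dots> = (\<Sum>w\<in>?S c. translate_count ?P (c + w) 1)"
    proof (rule sum.reindex_bij_witness[of _ uminus uminus])
      show "- w \<in> ?S c" if "w \<in> ?S (- c)" for w using step[OF mc that] unfolding minus_minus by (rule conjunct1)
      show "- w \<in> ?S (- c)" if "w \<in> ?S c" for w using step[OF c that] by (rule conjunct1)
      show "translate_count ?P (c + - w) 1 = translate_count ?P (- c + w) 1" if "w \<in> ?S (- c)" for w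
        using step[OF mc that] unfolding minus_minus by (rule conjunct2)
    qed simp_all
    also have "\<dots> = translate_count ?P' c 1" unfolding P' by (rule ts(2)[OF \<omega>, symmetric])
    finally show ?thesis .
  qed
  ultimately have "centrally_symmetric ?P'" by (intro centrally_symmetric_full_dim V')
  then obtain k where k: "?P' = (\<lambda>x. k + x) ` uminus ` ?P'" unfolding centrally_symmetric_def by blast
  \<comment> \<open>If k - x = p + w with x and p in P and w in Q, then applying \<rho> gives w =
    \<rho> k - 2 \<rho> p0, which does not depend on x. So p = c' - x, with c' equal to k -
    w.\<close>
  define c' where "c' = \<rho> p0 + \<rho> p0 + (k - \<rho> k)"
  have Q0: "0 \<in> ?Q" by (rule hull_inc) (simp add: U_def)
  have refl: "c' - x \<in> ?P" if x: "x \<in> ?P" for x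
  proof -
    have "x \<in> ?P'" unfolding P' using x Q0 by force
    then have "k - x \<in> ?P'" by (subst k) auto
    then obtain p w where pw: "p \<in> ?P" "w \<in> ?Q" "k - x = p + w" unfolding P' by blast
    have "\<rho> k - \<rho> x = \<rho> p + \<rho> w" using arg_cong[OF pw(3), of \<rho>] lin by (simp add: linear_diff linear_add)
    then have "w = \<rho> k - \<rho> p0 - \<rho> p0" using \<rho>P[OF x] \<rho>P[OF pw(1)] \<rho>Q[OF pw(2)] by (simp add: algebra_simps)
    then have "c' - x = p" using pw(3) by (simp add: c'_def algebra_simps)
    then show ?thesis using pw(1) by simp
  qed
  have "?P = (\<lambda>x. c' + x) ` uminus ` ?P"
  proof (intro equalityI subsetI)
    fix x assume "x \<in> ?P"
    then have "c' + - (c' - x) \<in> (\<lambda>x. c' + x) ` uminus ` ?P" by (intro imageI refl)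
    then show "x \<in> (\<lambda>x. c' + x) ` uminus ` ?P" by simp
  next
    fix x assume "x \<in> (\<lambda>x. c' + x) ` uminus ` ?P"
    then show "x \<in> ?P" using refl by auto
  qed
  then show ?thesis unfolding centrally_symmetric_def by blast
qed

section \<open>The equivalence\<close>

text \<open>The reflection x -> c - x permutes the vertices, so c is the sum of the two lattice
  points v and c - v.\<close>

lemma centre_in_int_points:
  fixes P :: "(real ^ 'd) set"
  assumes P: "lattice_polytope P" and c: "P = (\<lambda>x. c + x) ` uminus ` P"
  shows "c \<in> int_points"
proof -
  have "compact P" "convex P" "P \<noteq> {}"
    using P polytope_imp_compact polytope_imp_convex by (auto simp: lattice_polytope_def)
  then obtain v where v: "v extreme_point_of P"
    using Krein_Milman_Minkowski[of P] by (metis (no_types, lifting) Collect_empty_eq convex_hull_empty)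
  have refl: "c - x \<in> P" if "x \<in> P" for x using that by (subst c) auto
  have "(c + - v) extreme_point_of P"
    unfolding extreme_point_of_def
  proof (intro conjI ballI notI)
    show "c + - v \<in> P" using refl[of v] v by (simp add: extreme_point_of_def)
    fix a b assume ab: "a \<in> P" "b \<in> P" and "c + - v \<in> open_segment a b"
    then obtain u where u: "a \<noteq> b" "0 < u" "u < 1" "c + - v = (1 - u) *\<^sub>R a + u *\<^sub>R b" unfolding in_segment by blast
    have "v = c - (c + - v)" by simp
    also have "\<dots> = (1 - u) *\<^sub>R (c - a) + u *\<^sub>R (c - b)" unfolding u(4) by (simp add: algebra_simps)
    finally have "v \<in> open_segment (c - a) (c - b)" using u(1-3) unfolding in_segment by auto
    then show False using v refl[OF ab(1)] refl[OF ab(2)] unfolding extreme_point_of_def by blast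
  qed
  then have "v \<in> int_points" "c + - v \<in> int_points" using v P unfolding lattice_polytope_def by blast+
  from int_points_add[OF this] show ?thesis by simp
qed

theorem theorem4p2:
  fixes P :: "(real ^ 'd) set"
  assumes "lattice_polytope P"
  shows "centrally_symmetric P \<longleftrightarrow>
    (\<forall>c\<in>rat_points. symmetric_quasi_polynomial (ehrhart ((\<lambda>x. c + x) ` P)))"
proof -
  have poly: "polytope P" "P \<noteq> {}" using assms by (auto simp: lattice_polytope_def)
  define V where "V = {v. v extreme_point_of P}"
  have P: "P = convex hull V"
    unfolding V_def by (rule Krein_Milman_Minkowski) (use poly polytope_imp_compact polytope_imp_convex in auto)
  have V: "finite V" "V \<subseteq> int_points"
    using finite_polyhedron_extreme_points[OF polytope_imp_polyhedron[OF poly(1)]] assms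
    unfolding V_def lattice_polytope_def by blast+
  have ne: "V \<noteq> {}" using poly(2) by (subst (asm) P) auto
  show ?thesis
  proof
    assume "centrally_symmetric P"
    then obtain c0 where c0: "P = (\<lambda>x. c0 + x) ` uminus ` P" unfolding centrally_symmetric_def by blast
    have "translate_count P (- v) t = translate_count P v t" for v t
      by (rule translate_count_minus[OF c0 centre_in_int_points[OF assms c0]])
    then show "\<forall>c\<in>rat_points. symmetric_quasi_polynomial (ehrhart ((\<lambda>x. c + x) ` P))"
      unfolding P by (intro ballI symmetric_ehrhart V)
  next
    assume "\<forall>c\<in>rat_points. symmetric_quasi_polynomial (ehrhart ((\<lambda>x. c + x) ` P))"
    then have "translate_count (convex hull V) (- c) 1 = translate_count (convex hull V) c 1" if "c \<in> rat_points" for c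
      using that unfolding P by (intro symmetric_ehrhartD V) auto
    then show "centrally_symmetric P" unfolding P by (intro centrally_symmetric_if_translate_count V ne)
  qed
qed

end
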